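(* Let $X$ be a metric space, let $Y$ be a uniformly locally finite metric space and assume that there exists a uniformly finite-to-one coarse map $f\colon X\to Y$. If all sparse subspaces of $Y$ yield only compact ghost projections in $\mathrm{C}^*_s(Y)$, then all sparse subspaces of $X$ yield only compact ghost projections in $\mathrm{C}^*_s(X)$.
   Context: A metric space $(X,d)$ is uniformly locally finite if $\sup_{x\in X}|B_r(x)|<\infty$ for all $r>0$. A map $f\colon(X,d)\to(Y,\partial)$ is coarse if $\sup\{\partial(f(x),f(y))\mid d(x,y)\leq r\}<\infty$ for all $r>0$, and uniformly finite-to-one if $\sup_{y\in Y}|f^{-1}(\{y\})|<\infty$. Let $H$ be the infinite-dimensional separable Hilbert space and identify $\ell_2(X)\otimes H$ with $\ell_2(X,H)$. For $x\in X$ let $e_{xx}$ be the projection of $\ell_2(X,H)$ onto $\delta_x\otimes H$. For $a\in\mathcal{B}(\ell_2(X,H))$ and $x,y\in X$ let $a_{xy}=e_{yy}ae_{xx}$, identified canonically with an element of $\mathcal{B}(H)$. The stable Roe algebra $\mathrm{C}^*_s(X)$ is the norm closure in $\mathcal{B}(\ell_2(X,H))$ of the algebra of all $a\in\mathcal{B}(\ell_2(X,H))$ such that (1) there is $r>0$ with $a_{xy}=0$ whenever $d(x,y)>r$, and (2) there is a finite-dimensional subspace $H_a\subseteq H$ with $a_{xy}\in\mathcal{B}(H_a)$ for all $x,y\in X$. An operator $a\in\mathrm{C}^*_s(X)$ is a ghost if for all $\varepsilon>0$ there is a bounded $A\subseteq X$ with $\|a_{xy}\|<\varepsilon$ for all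 $x,y\in X\setminus A$. A metric space is sparse if it has a partition $\bigsqcup_{n\in\mathbb{N}}X_n$ into finite subsets with $d(X_n,X_m)\to\infty$ as $n+m\to\infty$ ($n\neq m$). All sparse subspaces of $X$ yield only compact ghost projections in $\mathrm{C}^*_s(X)$ if for every sparse subspace $X'\subseteq X$ (restricted metric) all ghost projections in $\mathrm{C}^*_s(X')$ are compact. *)

theory Defs
  imports "HOL-Analysis.Analysis"
begin

section \<open>Complex inner product spaces\<close>

text \<open>Inner products are linear in the first argument.\<close>

class complex_inner = real_normed_vector +
  fixes scaleC :: "complex \<Rightarrow> 'a \<Rightarrow> 'a" (infixr \<open>*\<^sub>C\<close> 75)
    and cinner :: "'a \<Rightarrow> 'a \<Rightarrow> complex"
  assumes scaleC_add_right: "c *\<^sub>C (x + y) = c *\<^sub>C x + c *\<^sub>C y"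
    and scaleC_add_left: "(b + c) *\<^sub>C x = b *\<^sub>C x + c *\<^sub>C x"
    and scaleC_scaleC: "b *\<^sub>C (c *\<^sub>C x) = (b * c) *\<^sub>C x"
    and scaleC_of_real: "complex_of_real r *\<^sub>C x = r *\<^sub>R x"
    and cinner_commute: "cinner x y = cnj (cinner y x)"
    and cinner_add_left: "cinner (x + y) z = cinner x z + cinner y z"
    and cinner_scaleC_left: "cinner (c *\<^sub>C x) y = c * cinner x y"
    and cinner_self: "cinner x x = complex_of_real ((norm x)\<^sup>2)"

instantiation complex :: complex_inner
begin

definition scaleC_complex :: "complex \<Rightarrow> complex \<Rightarrow> complex"
  where "scaleC_complex c x = c * x"

definition cinner_complex :: "complex \<Rightarrow> complex \<Rightarrow> complex"
  where "cinner_complex x y = x * cnj y"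

instance
  by standard
    (simp_all add: scaleC_complex_def cinner_complex_def algebra_simps scaleR_conv_of_real
      flip: complex_norm_square)

end

lemma cinner_add_right:
  "cinner (x :: 'a :: complex_inner) (y + z) = cinner x y + cinner x z"
  by (metis cinner_add_left cinner_commute complex_cnj_add)

lemma cinner_scaleC_right:
  "cinner (x :: 'a :: complex_inner) (c *\<^sub>C y) = cnj c * cinner x y"
  by (metis cinner_scaleC_left cinner_commute complex_cnj_mult)

lemma norm_scaleC: "norm (c *\<^sub>C (x :: 'a :: complex_inner)) = cmod c * norm x"
proof -
  have "complex_of_real ((norm (c *\<^sub>C x))\<^sup>2) = complex_of_real ((cmod c * norm x)\<^sup>2)"
    unfolding power_mult_distrib of_real_mult complex_norm_square cinner_self[symmetric]
    by (simp add: cinner_scaleC_left cinner_scaleC_right complex_norm_square)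
  then have "(norm (c *\<^sub>C x))\<^sup>2 = (cmod c * norm x)\<^sup>2"
    using of_real_eq_iff by blast
  then show ?thesis
    by (simp add: power2_eq_iff_nonneg)
qed

lemma two_norm_cinner_le:
  "2 * cmod (cinner (x :: 'a :: complex_inner) y) \<le> (norm x)\<^sup>2 + (norm y)\<^sup>2"
proof -
  define c where "c = - cnj (sgn (cinner x y))"
  have c: "c * cinner x y = - complex_of_real (cmod (cinner x y))"
    using complex_norm_square[of "cinner x y"]
    by (cases "cinner x y = 0")
      (simp_all add: c_def sgn_div_norm power2_eq_square field_simps scaleR_conv_of_real)
  then have c': "cnj c * cinner y x = - complex_of_real (cmod (cinner x y))"
    by (metis cinner_commute complex_cnj_complex_of_real complex_cnj_minus complex_cnj_mult)
  have "cmod c \<le> 1"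
    by (simp add: c_def norm_sgn)
  have "complex_of_real ((norm (c *\<^sub>C x + y))\<^sup>2)
      = complex_of_real ((norm (c *\<^sub>C x))\<^sup>2 + (norm y)\<^sup>2 - 2 * cmod (cinner x y))"
    by (simp only: cinner_self[symmetric] cinner_add_left cinner_add_right of_real_add
        of_real_diff of_real_mult)
      (simp add: cinner_scaleC_left[of c x y] cinner_scaleC_right[of y c x] c c')
  then have "(norm (c *\<^sub>C x + y))\<^sup>2 = (norm (c *\<^sub>C x))\<^sup>2 + (norm y)\<^sup>2 - 2 * cmod (cinner x y)"
    using of_real_eq_iff by blast
  moreover have "(norm (c *\<^sub>C x))\<^sup>2 \<le> (norm x)\<^sup>2"
    using \<open>cmod c \<le> 1\<close> by (simp add: norm_scaleC mult_left_le_one_le power_mono)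
  ultimately show ?thesis
    using zero_le_power2[of "norm (c *\<^sub>C x + y)"] by linarith
qed

global_interpretation complex_vector:
  vector_space "scaleC :: complex \<Rightarrow> 'a \<Rightarrow> 'a :: complex_inner"
  by standard
    (use scaleC_of_real[of 1] in
      \<open>simp_all add: scaleC_add_right scaleC_add_left scaleC_scaleC\<close>)

section \<open>Square-summable functions with values in a normed space\<close>

typedef (overloaded) ('a, 'b) l2 =
  "{f :: 'a \<Rightarrow> 'b :: real_normed_vector. (\<lambda>x. (norm (f x))\<^sup>2) summable_on UNIV}"
  morphisms l2_apply Abs_l2
  by (rule exI[of _ "\<lambda>_. 0"]) simp

setup_lifting type_definition_l2

lemma l2_norm_bound:
  assumes "\<And>F. finite F \<Longrightarrow> L2_set (\<lambda>x. norm (f x)) F \<le> B"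
  shows "(\<lambda>x. (norm (f x))\<^sup>2) summable_on UNIV" (is ?A)
    and "sqrt (\<Sum>\<^sub>\<infinity>x. (norm (f x))\<^sup>2) \<le> B" (is ?B)
proof -
  have B: "0 \<le> B" using assms[of "{}"] by simp
  have le: "(\<Sum>x\<in>F. (norm (f x))\<^sup>2) \<le> B\<^sup>2" if "finite F" for F
    using assms[OF that] B by (simp add: L2_set_def sqrt_le_D)
  show ?A
    by (rule nonneg_bdd_above_summable_on) (auto intro!: bdd_aboveI2[of _ _ "B\<^sup>2"] le)
  then have "(\<Sum>\<^sub>\<infinity>x. (norm (f x))\<^sup>2) \<le> B\<^sup>2"
    by (rule infsum_le_finite_sums) (simp add: le)
  then show ?B
    using B by (simp add: real_le_lsqrt infsum_nonneg)
qed

lemma L2_set_le_l2_norm: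
  assumes "(\<lambda>x. (norm (f x))\<^sup>2) summable_on UNIV" "finite F"
  shows "L2_set (\<lambda>x. norm (f x)) F \<le> sqrt (\<Sum>\<^sub>\<infinity>x. (norm (f x))\<^sup>2)"
  using finite_sum_le_infsum[OF assms] by (simp add: L2_set_def)

lemma L2_set_add_le:
  assumes "(\<lambda>x. (norm (f x))\<^sup>2) summable_on UNIV" "(\<lambda>x. (norm (g x))\<^sup>2) summable_on UNIV"
    and "finite F"
  shows "L2_set (\<lambda>x. norm (f x + g x)) F
    \<le> sqrt (\<Sum>\<^sub>\<infinity>x. (norm (f x))\<^sup>2) + sqrt (\<Sum>\<^sub>\<infinity>x. (norm (g x))\<^sup>2)"
proof -
  have "L2_set (\<lambda>x. norm (f x + g x)) F \<le> L2_set (\<lambda>x. norm (f x) + norm (g x)) F"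
    by (intro L2_set_mono norm_triangle_ineq) auto
  also have "\<dots> \<le> L2_set (\<lambda>x. norm (f x)) F + L2_set (\<lambda>x. norm (g x)) F"
    by (rule L2_set_triangle_ineq)
  finally show ?thesis
    using L2_set_le_l2_norm[OF assms(1,3)] L2_set_le_l2_norm[OF assms(2,3)] by linarith
qed

instantiation l2 :: (type, real_normed_vector) real_normed_vector
begin

lift_definition zero_l2 :: "('a, 'b) l2" is "\<lambda>_. 0" by simp

lift_definition plus_l2 :: "('a, 'b) l2 \<Rightarrow> ('a, 'b) l2 \<Rightarrow> ('a, 'b) l2" is "\<lambda>f g x. f x + g x"
  by (rule l2_norm_bound(1), rule L2_set_add_le)

lift_definition uminus_l2 :: "('a, 'b) l2 \<Rightarrow> ('a, 'b) l2" is "\<lambda>f x. - f x" by simp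

lift_definition minus_l2 :: "('a, 'b) l2 \<Rightarrow> ('a, 'b) l2 \<Rightarrow> ('a, 'b) l2" is "\<lambda>f g x. f x - g x"
proof -
  fix f g :: "'a \<Rightarrow> 'b"
  assume "(\<lambda>x. (norm (f x))\<^sup>2) summable_on UNIV" "(\<lambda>x. (norm (g x))\<^sup>2) summable_on UNIV"
  then show "(\<lambda>x. (norm (f x - g x))\<^sup>2) summable_on UNIV"
    using l2_norm_bound(1)[OF L2_set_add_le, of f "\<lambda>x. - g x"] by simp
qed

lift_definition scaleR_l2 :: "real \<Rightarrow> ('a, 'b) l2 \<Rightarrow> ('a, 'b) l2" is "\<lambda>r f x. r *\<^sub>R f x"
  by (simp add: power_mult_distrib summable_on_cmult_right)

lift_definition norm_l2 :: "('a, 'b) l2 \<Rightarrow> real" is "\<lambda>f. sqrt (\<Sum>\<^sub>\<infinity>x. (norm (f x))\<^sup>2)" .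

definition dist_l2 :: "('a, 'b) l2 \<Rightarrow> ('a, 'b) l2 \<Rightarrow> real"
  where "dist_l2 f g = norm (f - g)"

definition sgn_l2 :: "('a, 'b) l2 \<Rightarrow> ('a, 'b) l2"
  where "sgn_l2 f = scaleR (inverse (norm f)) f"

definition uniformity_l2 :: "(('a, 'b) l2 \<times> ('a, 'b) l2) filter"
  where "uniformity_l2 = (INF e\<in>{0 <..}. principal {(x, y). dist x y < e})"

definition open_l2 :: "('a, 'b) l2 set \<Rightarrow> bool"
  where "open_l2 U = (\<forall>x\<in>U. eventually (\<lambda>(x', y). x' = x \<longrightarrow> y \<in> U) uniformity)"

instance
proof
  fix f g h :: "('a, 'b) l2" and r s :: real and U :: "('a, 'b) l2 set"
  show "f + g + h = f + (g + h)" by transfer (simp add: algebra_simps)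
  show "f + g = g + f" by transfer (simp add: algebra_simps)
  show "0 + f = f" by transfer simp
  show "- f + f = 0" by transfer simp
  show "f - g = f + - g" by transfer simp
  show "r *\<^sub>R (f + g) = r *\<^sub>R f + r *\<^sub>R g" by transfer (simp add: algebra_simps)
  show "(r + s) *\<^sub>R f = r *\<^sub>R f + s *\<^sub>R f" by transfer (simp add: algebra_simps)
  show "r *\<^sub>R s *\<^sub>R f = (r * s) *\<^sub>R f" by transfer simp
  show "1 *\<^sub>R f = f" by transfer simp
  show "norm f = 0 \<longleftrightarrow> f = 0"
  proof transfer
    fix f :: "'a \<Rightarrow> 'b"
    assume f: "(\<lambda>x. (norm (f x))\<^sup>2) summable_on UNIV"
    show "sqrt (\<Sum>\<^sub>\<infinity>x. (norm (f x))\<^sup>2) = 0 \<longleftrightarrow> f = (\<lambda>_. 0)"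
      using nonneg_infsum_le_0D[OF _ f] by auto
  qed
  show "norm (f + g) \<le> norm f + norm g"
    by transfer (rule l2_norm_bound(2), rule L2_set_add_le)
  show "norm (r *\<^sub>R f) = \<bar>r\<bar> * norm f"
    by transfer (simp add: power_mult_distrib infsum_cmult_right real_sqrt_mult)
qed (fact dist_l2_def sgn_l2_def uniformity_l2_def open_l2_def)+

end

lemma L2_set_l2_apply_le: "finite F \<Longrightarrow> L2_set (\<lambda>x. norm (l2_apply f x)) F \<le> norm f"
  by transfer (rule L2_set_le_l2_norm)

lemma norm_l2_apply_le: "norm (l2_apply f x) \<le> norm f"
  using L2_set_l2_apply_le[of "{x}" f] by simp

instance l2 :: (type, banach) banach
proof
  fix X :: "nat \<Rightarrow> ('a, 'b) l2"
  assume X: "Cauchy X"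
  have cauchy: "Cauchy (\<lambda>n. l2_apply (X n) x)" for x
  proof (rule CauchyI)
    fix e :: real
    assume "0 < e"
    then obtain M where "\<forall>m\<ge>M. \<forall>n\<ge>M. norm (X m - X n) < e"
      using CauchyD[OF X] by blast
    moreover have "norm (l2_apply (X m) x - l2_apply (X n) x) \<le> norm (X m - X n)" for m n
      using norm_l2_apply_le[of "X m - X n" x] by (simp add: minus_l2.rep_eq)
    ultimately show "\<exists>M. \<forall>m\<ge>M. \<forall>n\<ge>M. norm (l2_apply (X m) x - l2_apply (X n) x) < e"
      by (meson le_less_trans)
  qed
  define g where "g x = lim (\<lambda>n. l2_apply (X n) x)" for x
  have g: "(\<lambda>n. l2_apply (X n) x) \<longlonglongrightarrow> g x" for x
    using cauchy[of x] by (simp add: g_def Cauchy_convergent_iff convergent_LIMSEQ_iff)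
  have le: "L2_set (\<lambda>x. norm (l2_apply (X n) x - g x)) F \<le> e"
    if "finite F" and M: "\<forall>m\<ge>M. \<forall>n\<ge>M. norm (X m - X n) < e" and "M \<le> n" for F n e M
  proof (rule Lim_bounded)
    show "(\<lambda>m. L2_set (\<lambda>x. norm (l2_apply (X n) x - l2_apply (X m) x)) F)
      \<longlonglongrightarrow> L2_set (\<lambda>x. norm (l2_apply (X n) x - g x)) F"
      unfolding L2_set_def by (intro tendsto_intros g)
    show "\<forall>m\<ge>M. L2_set (\<lambda>x. norm (l2_apply (X n) x - l2_apply (X m) x)) F \<le> e"
    proof (intro allI impI)
      fix m
      assume "M \<le> m"
      then have "norm (X n - X m) < e"
        using M \<open>M \<le> n\<close> by blast
      then show "L2_set (\<lambda>x. norm (l2_apply (X n) x - l2_apply (X m) x)) F \<le> e"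
        using L2_set_l2_apply_le[OF \<open>finite F\<close>, of "X n - X m"] by (simp add: minus_l2.rep_eq)
    qed
  qed
  obtain M where M: "\<forall>m\<ge>M. \<forall>n\<ge>M. norm (X m - X n) < 1"
    using CauchyD[OF X, of 1] by auto
  have "(\<lambda>x. (norm (l2_apply (X M) x - g x))\<^sup>2) summable_on UNIV"
    by (rule l2_norm_bound(1)[of _ 1]) (rule le[OF _ M], auto)
  then have "(\<lambda>x. (norm (g x - l2_apply (X M) x))\<^sup>2) summable_on UNIV"
    by (simp add: norm_minus_commute)
  moreover have "(\<lambda>x. (norm (l2_apply (X M) x))\<^sup>2) summable_on UNIV"
    using l2_apply[of "X M"] by simp
  ultimately have "(\<lambda>x. (norm (g x))\<^sup>2) summable_on UNIV"
    using l2_norm_bound(1)[OF L2_set_add_le, of "\<lambda>x. g x - l2_apply (X M) x" "l2_apply (X M)"]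
    by simp
  then obtain L where L: "l2_apply L = g"
    using Abs_l2_inverse[of g] by auto
  have "X \<longlonglongrightarrow> L"
  proof (rule LIMSEQ_I)
    fix e :: real
    assume "0 < e"
    then obtain M where M: "\<forall>m\<ge>M. \<forall>n\<ge>M. norm (X m - X n) < e / 2"
      using CauchyD[OF X, of "e / 2"] by auto
    have "norm (X n - L) \<le> e / 2" if "M \<le> n" for n
      unfolding norm_l2.rep_eq by (rule l2_norm_bound(2)) (use le[OF _ M that] L in \<open>simp add: minus_l2.rep_eq\<close>)
    then show "\<exists>M. \<forall>n\<ge>M. norm (X n - L) < e"
      using \<open>0 < e\<close> by (intro exI[of _ M]) force
  qed
  then show "convergent X"
    by (auto simp: convergent_def)
qed

lemma summable_cinner:
  fixes f g :: "'a \<Rightarrow> 'b :: complex_inner"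
  assumes "(\<lambda>x. (norm (f x))\<^sup>2) summable_on UNIV" "(\<lambda>x. (norm (g x))\<^sup>2) summable_on UNIV"
  shows "(\<lambda>x. cinner (f x) (g x)) summable_on UNIV"
proof (rule abs_summable_summable, rule Infinite_Sum.abs_summable_on_comparison_test)
  show "(\<lambda>x. norm ((norm (f x))\<^sup>2 + (norm (g x))\<^sup>2)) summable_on UNIV"
    using summable_on_add[OF assms] by simp
  show "norm (cinner (f x) (g x)) \<le> norm ((norm (f x))\<^sup>2 + (norm (g x))\<^sup>2)" for x
  proof -
    have "0 \<le> cmod (cinner (f x) (g x))" by simp
    then have "cmod (cinner (f x) (g x)) \<le> (norm (f x))\<^sup>2 + (norm (g x))\<^sup>2"
      using two_norm_cinner_le[of "f x" "g x"] by linarith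
    then show ?thesis by simp
  qed
qed

instantiation l2 :: (type, complex_inner) complex_inner
begin

lift_definition scaleC_l2 :: "complex \<Rightarrow> ('a, 'b) l2 \<Rightarrow> ('a, 'b) l2" is "\<lambda>c f x. c *\<^sub>C f x"
  by (simp add: norm_scaleC power_mult_distrib summable_on_cmult_right)

lift_definition cinner_l2 :: "('a, 'b) l2 \<Rightarrow> ('a, 'b) l2 \<Rightarrow> complex"
  is "\<lambda>f g. \<Sum>\<^sub>\<infinity>x. cinner (f x) (g x)" .

instance
proof
  fix f g h :: "('a, 'b) l2" and b c :: complex and r :: real
  show "c *\<^sub>C (f + g) = c *\<^sub>C f + c *\<^sub>C g" by transfer (simp add: scaleC_add_right)
  show "(b + c) *\<^sub>C f = b *\<^sub>C f + c *\<^sub>C f" by transfer (simp add: scaleC_add_left)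
  show "b *\<^sub>C c *\<^sub>C f = (b * c) *\<^sub>C f" by transfer (simp add: scaleC_scaleC)
  show "complex_of_real r *\<^sub>C f = r *\<^sub>R f" by transfer (simp add: scaleC_of_real)
  show "cinner f g = cnj (cinner g f)"
    by transfer (simp flip: infsum_cnj cinner_commute)
  show "cinner (f + g) h = cinner f h + cinner g h"
    by transfer (simp add: cinner_add_left infsum_add summable_cinner)
  show "cinner (c *\<^sub>C f) g = c * cinner f g"
    by transfer (simp add: cinner_scaleC_left infsum_cmult_right summable_cinner)
  show "cinner f f = complex_of_real ((norm f)\<^sup>2)"
  proof transfer
    fix f :: "'a \<Rightarrow> 'b"
    assume "(\<lambda>x. (norm (f x))\<^sup>2) summable_on UNIV"
    then have "((\<lambda>x. complex_of_real ((norm (f x))\<^sup>2))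
        has_sum complex_of_real (\<Sum>\<^sub>\<infinity>x. (norm (f x))\<^sup>2)) UNIV"
      by (intro has_sum_of_real has_sum_infsum)
    then show "(\<Sum>\<^sub>\<infinity>x. cinner (f x) (f x)) = complex_of_real ((sqrt (\<Sum>\<^sub>\<infinity>x. (norm (f x))\<^sup>2))\<^sup>2)"
      by (simp add: cinner_self infsumI infsum_nonneg)
  qed
qed

end

section \<open>Operators\<close>

text \<open>
  \<open>E \<Rightarrow>\<^sub>L E\<close> is the real Banach space of bounded real-linear maps with the operator norm.
  For a closed complex subspace \<open>K\<close> of \<open>E\<close>, the algebra \<open>B(K)\<close> is identified with the norm closed
  set of those bounded complex-linear operators on \<open>E\<close> that have range in \<open>K\<close> and vanish on the
  orthogonal complement of \<open>K\<close>.
\<close>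

definition bounded_ops :: "'e :: complex_inner set \<Rightarrow> ('e \<Rightarrow>\<^sub>L 'e) set"
  where "bounded_ops K =
    {a. (\<forall>c \<xi>. blinfun_apply a (c *\<^sub>C \<xi>) = c *\<^sub>C blinfun_apply a \<xi>) \<and>
        range (blinfun_apply a) \<subseteq> K \<and>
        (\<forall>\<xi>. (\<forall>\<eta>\<in>K. cinner \<xi> \<eta> = 0) \<longrightarrow> blinfun_apply a \<xi> = 0)}"

definition projection_op :: "('e :: complex_inner \<Rightarrow>\<^sub>L 'e) \<Rightarrow> bool"
  where "projection_op p \<longleftrightarrow>
    p o\<^sub>L p = p \<and>
    (\<forall>\<xi> \<eta>. cinner (blinfun_apply p \<xi>) \<eta> = cinner \<xi> (blinfun_apply p \<eta>))"

definition compact_op :: "('e :: real_normed_vector \<Rightarrow>\<^sub>L 'e) \<Rightarrow> bool"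
  where "compact_op a \<longleftrightarrow> compact (closure (blinfun_apply a ` cball 0 1))"

text \<open>The infinite-dimensional separable Hilbert space \<open>H\<close> is realised as \<open>\<ell>\<^sub>2(\<nat>)\<close>.\<close>

type_synonym hilb = "(nat, complex) l2"

text \<open>
  Subspaces \<open>X\<close> of a metric space are subsets of one type \<open>'a\<close>, and \<open>\<ell>\<^sub>2(X, H)\<close> is the subspace of
  \<open>\<ell>\<^sub>2('a, H)\<close> of functions supported on \<open>X\<close>.
\<close>

definition l2_on :: "'a set \<Rightarrow> ('a, hilb) l2 set"
  where "l2_on X = {\<xi>. \<forall>x. x \<notin> X \<longrightarrow> l2_apply \<xi> x = 0}"

lift_definition l2_single :: "'a \<Rightarrow> 'b :: real_normed_vector \<Rightarrow> ('a, 'b) l2"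
  is "\<lambda>x h y. if y = x then h else 0"
proof -
  fix x :: 'a and h :: 'b
  have "(\<lambda>y. (norm (if y = x then h else 0))\<^sup>2) summable_on {x}"
    by simp
  then show "(\<lambda>y. (norm (if y = x then h else 0))\<^sup>2) summable_on UNIV"
    by (subst summable_on_cong_neutral[where T = "{x}"]) auto
qed

lemma norm_l2_single: "norm (l2_single x h) = norm h"
proof transfer
  fix x :: 'a and h :: 'b
  have "(\<Sum>\<^sub>\<infinity>y. (norm (if y = x then h else 0))\<^sup>2) = (\<Sum>\<^sub>\<infinity>y\<in>{x}. (norm h)\<^sup>2)"
    by (rule infsum_cong_neutral) auto
  then show "sqrt (\<Sum>\<^sub>\<infinity>y. (norm (if y = x then h else 0))\<^sup>2) = norm h"
    by simp
qed

text \<open>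
  Since \<open>e\<^sub>x\<^sub>x \<xi> = \<delta>\<^sub>x \<otimes> \<xi>(x)\<close>, the operator \<open>a\<^sub>x\<^sub>y = e\<^sub>y\<^sub>y a e\<^sub>x\<^sub>x\<close> is, as an operator on \<open>H\<close>,
  the map \<open>h \<mapsto> (a(\<delta>\<^sub>x \<otimes> h))(y)\<close>.
\<close>

definition entry ::
  "(('a, hilb) l2 \<Rightarrow>\<^sub>L ('a, hilb) l2) \<Rightarrow> 'a \<Rightarrow> 'a \<Rightarrow> (hilb \<Rightarrow>\<^sub>L hilb)"
  where "entry a x y = Blinfun (\<lambda>h. l2_apply (blinfun_apply a (l2_single x h)) y)"

lemma entry_apply:
  "blinfun_apply (entry a x y) h = l2_apply (blinfun_apply a (l2_single x h)) y"
proof -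
  have "bounded_linear (\<lambda>h. l2_apply (blinfun_apply a (l2_single x h)) y)"
  proof (rule bounded_linear_intro[where K = "norm a"])
    fix h k :: hilb and r :: real
    have "l2_single x (h + k) = l2_single x h + l2_single x k"
      by (rule l2_apply_inject[THEN iffD1], rule ext) (simp add: l2_single.rep_eq plus_l2.rep_eq)
    then show "l2_apply (blinfun_apply a (l2_single x (h + k))) y
        = l2_apply (blinfun_apply a (l2_single x h)) y + l2_apply (blinfun_apply a (l2_single x k)) y"
      by (simp add: blinfun.add_right plus_l2.rep_eq)
    have "l2_single x (r *\<^sub>R h) = r *\<^sub>R l2_single x h"
      by (rule l2_apply_inject[THEN iffD1], rule ext) (simp add: l2_single.rep_eq scaleR_l2.rep_eq)
    then show "l2_apply (blinfun_apply a (l2_single x (r *\<^sub>R h))) y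
        = r *\<^sub>R l2_apply (blinfun_apply a (l2_single x h)) y"
      by (simp add: blinfun.scaleR_right scaleR_l2.rep_eq)
    show "norm (l2_apply (blinfun_apply a (l2_single x h)) y) \<le> norm h * norm a"
      using norm_l2_apply_le[of "blinfun_apply a (l2_single x h)" y]
        norm_blinfun[of a "l2_single x h"]
      by (simp add: norm_l2_single mult.commute)
  qed
  then show ?thesis
    by (simp add: entry_def bounded_linear_Blinfun_apply)
qed

section \<open>The stable Roe algebra and ghosts\<close>

definition stable_Roe_algebraic ::
  "'a set \<Rightarrow> ('a \<Rightarrow> 'a \<Rightarrow> real) \<Rightarrow> (('a, hilb) l2 \<Rightarrow>\<^sub>L ('a, hilb) l2) set"
  where "stable_Roe_algebraic X d =
    {a \<in> bounded_ops (l2_on X).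
      (\<exists>r>0. \<forall>x\<in>X. \<forall>y\<in>X. d x y > r \<longrightarrow> entry a x y = 0) \<and>
      (\<exists>B. finite B \<and> (\<forall>x\<in>X. \<forall>y\<in>X. entry a x y \<in> bounded_ops (complex_vector.span B)))}"

definition stable_Roe ::
  "'a set \<Rightarrow> ('a \<Rightarrow> 'a \<Rightarrow> real) \<Rightarrow> (('a, hilb) l2 \<Rightarrow>\<^sub>L ('a, hilb) l2) set"
  where "stable_Roe X d = closure (stable_Roe_algebraic X d)"

definition ghost ::
  "'a set \<Rightarrow> ('a \<Rightarrow> 'a \<Rightarrow> real) \<Rightarrow> (('a, hilb) l2 \<Rightarrow>\<^sub>L ('a, hilb) l2) \<Rightarrow> bool"
  where "ghost X d a \<longleftrightarrow>
    a \<in> stable_Roe X d \<and>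
    (\<forall>\<epsilon>>0. \<exists>A. Metric_space.mbounded X d A \<and>
      (\<forall>x\<in>X - A. \<forall>y\<in>X - A. norm (entry a x y) < \<epsilon>))"

section \<open>Coarse notions\<close>

definition uniformly_locally_finite :: "'a set \<Rightarrow> ('a \<Rightarrow> 'a \<Rightarrow> real) \<Rightarrow> bool"
  where "uniformly_locally_finite X d \<longleftrightarrow>
    (\<forall>r>0. \<exists>N. \<forall>x\<in>X. finite (Metric_space.mcball X d x r) \<and>
      card (Metric_space.mcball X d x r) \<le> N)"

definition coarse_map ::
  "'a set \<Rightarrow> ('a \<Rightarrow> 'a \<Rightarrow> real) \<Rightarrow> 'b set \<Rightarrow> ('b \<Rightarrow> 'b \<Rightarrow> real) \<Rightarrow> ('a \<Rightarrow> 'b) \<Rightarrow> bool"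
  where "coarse_map X d Y d' f \<longleftrightarrow>
    f \<in> X \<rightarrow> Y \<and>
    (\<forall>r>0. bdd_above {d' (f x) (f y) | x y. x \<in> X \<and> y \<in> X \<and> d x y \<le> r})"

definition uniformly_finite_to_one :: "'a set \<Rightarrow> 'b set \<Rightarrow> ('a \<Rightarrow> 'b) \<Rightarrow> bool"
  where "uniformly_finite_to_one X Y f \<longleftrightarrow>
    (\<exists>N. \<forall>y\<in>Y. finite {x \<in> X. f x = y} \<and> card {x \<in> X. f x = y} \<le> N)"

text \<open>
  The last condition says that \<open>d(P\<^sub>m, P\<^sub>n)\<close>, the infimum of the distances between points of the
  two pieces, tends to infinity. Pieces may be empty, and the infimum is then infinite.
\<close>

definition sparse_space :: "'a set \<Rightarrow> ('a \<Rightarrow> 'a \<Rightarrow> real) \<Rightarrow> bool"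
  where "sparse_space X d \<longleftrightarrow>
    (\<exists>P :: nat \<Rightarrow> 'a set.
      (\<Union>n. P n) = X \<and> disjoint_family P \<and> (\<forall>n. finite (P n)) \<and>
      (\<forall>r. \<exists>N. \<forall>m n. m \<noteq> n \<and> m + n \<ge> N \<longrightarrow> (\<forall>x\<in>P m. \<forall>y\<in>P n. d x y \<ge> r)))"

definition sparse_only_compact_ghost_projections :: "'a set \<Rightarrow> ('a \<Rightarrow> 'a \<Rightarrow> real) \<Rightarrow> bool"
  where "sparse_only_compact_ghost_projections X d \<longleftrightarrow>
    (\<forall>X'\<subseteq>X. sparse_space X' d \<longrightarrow>
      (\<forall>p. ghost X' d p \<and> projection_op p \<longrightarrow> compact_op p))"

end

theory Submission
  imports Defs
begin

text \<open>
  Let \<open>p\<close> be a ghost projection over a sparse subspace \<open>X' = \<Squnion> P\<^sub>n\<close> of \<open>X\<close> and suppose that \<open>p\<close> is not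
  compact. The image of \<open>X'\<close> under \<open>f\<close> need not be sparse, because \<open>f\<close> may bring distant pieces together. It
  becomes sparse, however, after passing to a subsequence of pieces: balls in \<open>Y\<close> and fibres of \<open>f\<close> are
  finite, so only finitely many pieces come close to the pieces chosen before (\<open>separated_pieces\<close>). The task
  is to cut \<open>p\<close> down to these pieces and to move it to \<open>Y\<close> while keeping it a noncompact ghost projection.

  Operators of finite propagation do not connect pieces that are far apart. Hence the norms
  \<open>\<parallel>e\<^sub>n p (1 - e\<^sub>n)\<parallel>\<close>, where \<open>e\<^sub>n\<close> is the projection onto \<open>\<ell>\<^sub>2(P\<^sub>n, H)\<close>, tend to zero (\<open>off_diagonal_small\<close>), and
  if \<open>\<parallel>e\<^sub>n p\<parallel>\<close> tended to zero as well, then \<open>p\<close> would be compact (\<open>compact_if_rows_tend_to_zero\<close>). So the pieces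
  can be chosen with \<open>\<parallel>e\<^sub>n p\<parallel>\<close> bounded below and with summable, arbitrarily small \<open>\<parallel>e\<^sub>n p (1 - e\<^sub>n)\<parallel>\<close>.

  Let \<open>S\<close> be the union of the chosen pieces and \<open>e\<close> the projection onto \<open>\<ell>\<^sub>2(S, H)\<close>. Fibres of \<open>f\<close> have at most
  \<open>N\<close> points. Numbering them and using pairwise orthogonal copies of \<open>H\<close> inside \<open>H\<close>, one gets an isometry
  \<open>U\<close> from \<open>\<ell>\<^sub>2(S, H)\<close> to \<open>\<ell>\<^sub>2(f(S), H)\<close> over \<open>f\<close>. Since \<open>f\<close> is coarse, \<open>a \<mapsto> U a U\<^sup>*\<close> maps the Roe algebra of \<open>X'\<close> to
  that of \<open>f(S)\<close> (\<open>transport_stable_Roe\<close>). The operator \<open>b = U p U\<^sup>*\<close> is a ghost, and its defect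
  \<open>b - b\<^sup>2 = U p (1 - e) p U\<^sup>*\<close> is small in norm and concentrated near finite sets, because its rows over the
  \<open>k\<close>-th piece are bounded by the \<open>k\<close>-th error.

  Iterating \<open>x \<mapsto> 3x\<^sup>2 - 2x\<^sup>3\<close>, starting from \<open>b\<close>, gives a projection \<open>q\<close> close to \<open>b\<close> that stays in the Roe algebra
  and differs from \<open>b\<close> only by an operator concentrated near finite sets
  (\<open>projection_near_almost_projection\<close>). So \<open>q\<close> is a ghost, too (\<open>ghost_if_tail_small_perturbation\<close>). It is
  not compact, because it is bounded below on a sequence of vectors in the unit ball with disjoint supports
  (\<open>not_compact_near_b\<close>). This contradicts the hypothesis on \<open>Y\<close>.
\<close>

section \<open>Inner products and square-summable functions\<close>

lemma cauchy_schwarz: "cmod (cinner (x :: 'a :: complex_inner) y) \<le> norm x * norm y"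
proof (cases "x = 0 \<or> y = 0")
  case True
  then show ?thesis
    using cinner_scaleC_left[of 0 0 y] cinner_scaleC_right[of x 0 0]
    by (auto simp: complex_vector.scale_zero_left)
next
  case False
  define u where "u = complex_of_real (inverse (norm x)) *\<^sub>C x"
  define v where "v = complex_of_real (inverse (norm y)) *\<^sub>C y"
  have "norm u = 1" "norm v = 1"
    using False by (simp_all add: u_def v_def norm_scaleC flip: of_real_inverse)
  then have "cmod (cinner u v) \<le> 1"
    using two_norm_cinner_le[of u v] by simp
  moreover have "cinner u v
      = complex_of_real (inverse (norm x)) * (complex_of_real (inverse (norm y)) * cinner x y)"
    by (simp add: u_def v_def cinner_scaleC_left cinner_scaleC_right del: of_real_inverse)
  then have "cmod (cinner u v) = cmod (cinner x y) / (norm x * norm y)"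
    by (simp add: norm_mult norm_inverse norm_divide divide_inverse)
  ultimately show ?thesis
    using False by (simp add: divide_le_eq)
qed

lemma cinner_minus_left: "cinner (x - y :: 'a :: complex_inner) z = cinner x z - cinner y z"
  using cinner_add_left[of "x - y" y z] by simp

lemma cinner_minus_right: "cinner (z :: 'a :: complex_inner) (x - y) = cinner z x - cinner z y"
  using cinner_add_right[of z "x - y" y] by simp

lemma cinner_zero_left [simp]: "cinner (0 :: 'a :: complex_inner) x = 0"
  using cinner_add_left[of 0 0 x] by simp

lemma cinner_zero_right [simp]: "cinner (x :: 'a :: complex_inner) 0 = 0"
  using cinner_add_right[of x 0 0] by simp

lemma cinner_sum_left: "cinner (\<Sum>i\<in>I. g i :: 'a :: complex_inner) x = (\<Sum>i\<in>I. cinner (g i) x)"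
  by (induction I rule: infinite_finite_induct) (auto simp: cinner_add_left)

lemma cinner_scaleR_left: "cinner (r *\<^sub>R x :: 'a :: complex_inner) y = r *\<^sub>R cinner x y"
  by (simp add: cinner_scaleC_left scaleR_conv_of_real flip: scaleC_of_real)

lemma cinner_scaleR_right: "cinner (x :: 'a :: complex_inner) (r *\<^sub>R y) = r *\<^sub>R cinner x y"
  by (simp add: cinner_scaleC_right scaleR_conv_of_real flip: scaleC_of_real)

lemma bounded_bilinear_cinner: "bounded_bilinear (cinner :: 'a :: complex_inner \<Rightarrow> 'a \<Rightarrow> complex)"
  by (rule bounded_bilinear.intro)
    (auto simp: cinner_add_left cinner_add_right cinner_scaleR_left cinner_scaleR_right
      cauchy_schwarz intro!: exI[of _ 1])

lemmas bounded_linear_cinner_left = bounded_bilinear.bounded_linear_left[OF bounded_bilinear_cinner]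
  and tendsto_cinner = bounded_bilinear.tendsto[OF bounded_bilinear_cinner]

lemma eq_if_cinner_eq:
  assumes "\<And>z. cinner (x :: 'a :: complex_inner) z = cinner y z"
  shows "x = y"
proof -
  have "cinner (x - y) (x - y) = 0"
    using assms by (simp add: cinner_minus_left)
  then show ?thesis
    by (simp add: cinner_self)
qed

lemma scaleR_eq_scaleC: "r *\<^sub>R (x :: 'a :: complex_inner) = complex_of_real r *\<^sub>C x"
  by (simp add: scaleC_of_real)

text \<open>
  The scalar can be moved to the other side of the inner product, which separates vectors. So the
  adjoints provide the complex linearity of the operators constructed below.
\<close>

lemma adjoint_complex_linear:
  assumes "\<And>\<xi> \<eta>. cinner (blinfun_apply V \<xi>) \<eta> = cinner \<xi> (blinfun_apply W \<eta>)"
  shows "blinfun_apply V (c *\<^sub>C \<xi>) = c *\<^sub>C blinfun_apply V \<xi>"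
  by (rule eq_if_cinner_eq) (simp add: assms cinner_scaleC_left)

lemma adjoint_sym:
  assumes "\<And>\<xi> \<eta>. cinner (blinfun_apply V \<xi>) \<eta> = cinner \<xi> (blinfun_apply W \<eta>)"
  shows "cinner (blinfun_apply W \<eta>) \<xi> = cinner \<eta> (blinfun_apply V \<xi>)"
  by (metis assms cinner_commute)

text \<open>
  Both bounds come from \<open>\<parallel>V \<xi>\<parallel>\<^sup>2 = \<langle>\<xi>, W V \<xi>\<rangle>\<close> and its counterpart for \<open>W\<close>. Applied to a partial isometry \<open>V\<close>,
  for which \<open>W V\<close> is the identity or a projection, they replace any direct estimate of norms.
\<close>

lemma adjoint_contraction:
  assumes adj: "\<And>\<xi> \<eta>. cinner (blinfun_apply V \<xi>) \<eta> = cinner \<xi> (blinfun_apply W \<eta>)"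
    and le: "\<And>\<xi>. norm (blinfun_apply W (blinfun_apply V \<xi>)) \<le> norm \<xi>"
  shows "norm (blinfun_apply V \<xi>) \<le> norm \<xi>" "norm (blinfun_apply W \<eta>) \<le> norm \<eta>"
proof -
  have V: "norm (blinfun_apply V \<xi>) \<le> norm \<xi>" for \<xi>
  proof -
    have "(norm (blinfun_apply V \<xi>))\<^sup>2 = cmod (cinner \<xi> (blinfun_apply W (blinfun_apply V \<xi>)))"
      by (simp flip: adj add: cinner_self norm_power)
    also have "\<dots> \<le> norm \<xi> * norm \<xi>"
      by (rule order_trans[OF cauchy_schwarz mult_left_mono[OF le norm_ge_zero]])
    finally show ?thesis
      by (simp add: power2_eq_square[symmetric] power_mono_iff)
  qed
  show "norm (blinfun_apply V \<xi>) \<le> norm \<xi>"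
    by (rule V)
  have "norm (blinfun_apply W \<eta>) * norm (blinfun_apply W \<eta>)
      = cmod (cinner (blinfun_apply W \<eta>) (blinfun_apply W \<eta>))"
    by (simp add: cinner_self power2_eq_square flip: of_real_mult)
  also have "\<dots> = cmod (cinner (blinfun_apply V (blinfun_apply W \<eta>)) \<eta>)"
    by (simp add: adj)
  also have "\<dots> \<le> norm (blinfun_apply W \<eta>) * norm \<eta>"
    by (rule order_trans[OF cauchy_schwarz mult_right_mono[OF V norm_ge_zero]])
  finally show "norm (blinfun_apply W \<eta>) \<le> norm \<eta>"
    by (cases "blinfun_apply W \<eta> = 0") auto
qed

lemma l2_eqI: "(\<And>x. l2_apply \<xi> x = l2_apply \<eta> x) \<Longrightarrow> \<xi> = \<eta>"
  by (metis ext l2_apply_inject)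

lemma l2_apply_sum: "l2_apply (\<Sum>i\<in>I. g i) x = (\<Sum>i\<in>I. l2_apply (g i) x)"
  by (induction I rule: infinite_finite_induct) (auto simp: zero_l2.rep_eq plus_l2.rep_eq)

lemma norm_l2_le:
  assumes "\<And>F. finite F \<Longrightarrow> L2_set (\<lambda>x. norm (l2_apply \<xi> x)) F \<le> B"
  shows "norm \<xi> \<le> B"
  unfolding norm_l2.rep_eq by (rule l2_norm_bound(2)) (rule assms)

lemma bounded_linear_l2_apply: "bounded_linear (\<lambda>\<xi>. l2_apply \<xi> x)"
  by (rule bounded_linear_intro[where K = 1])
    (auto simp: plus_l2.rep_eq scaleR_l2.rep_eq norm_l2_apply_le)

lemma sum_norm_l2_apply_le: "finite F \<Longrightarrow> (\<Sum>x\<in>F. (norm (l2_apply \<xi> x))\<^sup>2) \<le> (norm \<xi>)\<^sup>2"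
  using L2_set_l2_apply_le[of F \<xi>] sqrt_le_D unfolding L2_set_def by blast

lemma norm_l2_sq_le:
  assumes "\<And>F. finite F \<Longrightarrow> (\<Sum>x\<in>F. (norm (l2_apply \<xi> x))\<^sup>2) \<le> B\<^sup>2" "0 \<le> B"
  shows "norm \<xi> \<le> B"
  by (rule norm_l2_le) (use assms in \<open>auto simp: L2_set_def intro!: real_le_lsqrt sum_nonneg\<close>)

lemma cinner_l2_single: "cinner (l2_single x h) \<eta> = cinner h (l2_apply \<eta> x)"
proof -
  have "cinner (l2_single x h) \<eta> = (\<Sum>\<^sub>\<infinity>y. cinner (l2_apply (l2_single x h) y) (l2_apply \<eta> y))"
    by (rule cinner_l2.rep_eq)
  also have "\<dots> = (\<Sum>\<^sub>\<infinity>y\<in>{x}. cinner h (l2_apply \<eta> x))"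
    by (rule infsum_cong_neutral) (auto simp: l2_single.rep_eq)
  finally show ?thesis
    by simp
qed

text \<open>
  The tail is formulated through domination by \<open>\<xi>\<close>, so that it covers both the error of a finite
  truncation and any cut-down of \<open>\<xi>\<close> to a set far out.
\<close>

lemma l2_tail:
  fixes \<xi> :: "('a, 'h :: real_normed_vector) l2"
  assumes "0 < e"
  shows "\<exists>F. finite F \<and> (\<forall>\<eta> :: ('a, 'h) l2. (\<forall>x\<in>F. l2_apply \<eta> x = 0) \<longrightarrow>
    (\<forall>x. x \<notin> F \<longrightarrow> norm (l2_apply \<eta> x) \<le> norm (l2_apply \<xi> x)) \<longrightarrow> norm \<eta> \<le> e)"
proof -
  let ?g = "\<lambda>x. (norm (l2_apply \<xi> x))\<^sup>2"
  have sm: "?g summable_on UNIV"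
    using l2_apply[of \<xi>] by simp
  obtain F where F: "finite F" "\<bar>sum ?g F - infsum ?g UNIV\<bar> \<le> e\<^sup>2"
    using infsum_finite_approximation[OF sm, of "e\<^sup>2"] assms by (auto simp: dist_real_def)
  show ?thesis
  proof (intro exI[of _ F] conjI F(1) allI impI)
    fix \<eta> :: "('a, 'h) l2"
    assume \<eta>: "\<forall>x\<in>F. l2_apply \<eta> x = 0"
      "\<forall>x. x \<notin> F \<longrightarrow> norm (l2_apply \<eta> x) \<le> norm (l2_apply \<xi> x)"
    show "norm \<eta> \<le> e"
    proof (rule norm_l2_sq_le)
      fix G :: "'a set"
      assume G: "finite G"
      have "(\<Sum>x\<in>G. (norm (l2_apply \<eta> x))\<^sup>2) = (\<Sum>x\<in>G - F. (norm (l2_apply \<eta> x))\<^sup>2)"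
        by (rule sum.mono_neutral_right) (use G \<eta> in auto)
      also have "\<dots> \<le> sum ?g (G - F)"
        by (rule sum_mono) (use \<eta> in \<open>auto intro!: power_mono\<close>)
      also have "\<dots> = sum ?g (F \<union> (G - F)) - sum ?g F"
        using F G by (subst sum.union_disjoint) auto
      also have "sum ?g (F \<union> (G - F)) \<le> infsum ?g UNIV"
        by (rule finite_sum_le_infsum[OF sm]) (use F G in auto)
      finally show "(\<Sum>x\<in>G. (norm (l2_apply \<eta> x))\<^sup>2) \<le> e\<^sup>2"
        using F(2) by linarith
    qed (use assms in auto)
  qed
qed

lemma l2_finite_sum_singles:
  assumes "finite F" "\<And>x. x \<notin> F \<Longrightarrow> l2_apply \<xi> x = 0"
  shows "\<xi> = (\<Sum>x\<in>F. l2_single x (l2_apply \<xi> x))"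
proof (rule l2_eqI)
  fix x
  have "l2_apply (\<Sum>x\<in>F. l2_single x (l2_apply \<xi> x)) x
      = (\<Sum>y\<in>F. if x = y then l2_apply \<xi> y else 0)"
    by (simp add: l2_apply_sum l2_single.rep_eq cong: if_cong)
  also have "\<dots> = l2_apply \<xi> x"
    using assms by (simp add: sum.delta')
  finally show "l2_apply \<xi> x = l2_apply (\<Sum>x\<in>F. l2_single x (l2_apply \<xi> x)) x" ..
qed

text \<open>
  Finite sums of the vectors \<open>\<delta>\<^sub>x \<otimes> h\<close> are dense, so bounded maps need only be compared there.
\<close>

lemma bounded_linear_zero_on_singles:
  fixes \<xi> :: "('a, 'h :: real_normed_vector) l2"
  assumes T: "bounded_linear T"
    and zero: "\<And>x h. x \<in> S \<Longrightarrow> T (l2_single x h) = 0"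
    and supp: "\<And>x. x \<notin> S \<Longrightarrow> l2_apply \<xi> x = 0"
  shows "T \<xi> = 0"
proof -
  obtain K where K: "\<And>\<eta>. norm (T \<eta>) \<le> norm \<eta> * K" "0 < K"
    using bounded_linear.pos_bounded[OF T] by blast
  have "norm (T \<xi>) \<le> e" if "0 < e" for e
  proof -
    have "0 < e / K"
      using that K by simp
    from l2_tail[OF this, of \<xi>] obtain F where F: "finite F"
      and le: "\<And>\<eta> :: ('a, 'h) l2. \<forall>x\<in>F. l2_apply \<eta> x = 0 \<Longrightarrow>
        \<forall>x. x \<notin> F \<longrightarrow> norm (l2_apply \<eta> x) \<le> norm (l2_apply \<xi> x) \<Longrightarrow> norm \<eta> \<le> e / K"
      by metis
    define \<zeta> where "\<zeta> = (\<Sum>x\<in>F. l2_single x (l2_apply \<xi> x))"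
    have \<zeta>: "l2_apply \<zeta> x = (if x \<in> F then l2_apply \<xi> x else 0)" for x
      using F by (simp add: \<zeta>_def l2_apply_sum l2_single.rep_eq sum.delta' cong: if_cong)
    have "T (l2_single x (l2_apply \<xi> x)) = 0" if "x \<in> F" for x
    proof (cases "x \<in> S")
      case False
      have "l2_single x (0 :: 'h) = 0"
        by (rule l2_eqI) (simp add: l2_single.rep_eq zero_l2.rep_eq)
      then show ?thesis
        using supp[OF False] linear_0[OF bounded_linear.linear[OF T]] by simp
    qed (rule zero)
    then have "T \<zeta> = 0"
      by (simp add: \<zeta>_def linear_sum[OF bounded_linear.linear[OF T]])
    then have "T \<xi> = T (\<xi> - \<zeta>)"
      by (simp add: linear_diff[OF bounded_linear.linear[OF T]])
    also have "norm \<dots> \<le> norm (\<xi> - \<zeta>) * K"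
      by (rule K)
    also have "norm (\<xi> - \<zeta>) \<le> e / K"
      by (rule le) (auto simp: minus_l2.rep_eq \<zeta>)
    finally show ?thesis
      using K by (simp add: mult_right_mono)
  qed
  then have "norm (T \<xi>) \<le> 0"
    by (rule field_le_epsilon) simp
  then show ?thesis
    by simp
qed

section \<open>Operators that move the base points\<close>

text \<open>
  An operator given by its coordinates. It has the intended values only if the coordinates are linear
  and square-summable with a uniform bound, which is the content of the lemma that follows.
\<close>

definition l2_op :: "(('a, 'h) l2 \<Rightarrow> 'b \<Rightarrow> 'k) \<Rightarrow>
    ('a, 'h :: real_normed_vector) l2 \<Rightarrow>\<^sub>L ('b, 'k :: real_normed_vector) l2"
  where "l2_op g = Blinfun (\<lambda>\<xi>. Abs_l2 (g \<xi>))"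

lemma l2_op_apply:
  fixes g :: "('a, 'h :: real_normed_vector) l2 \<Rightarrow> 'b \<Rightarrow> 'k :: real_normed_vector"
  assumes add: "\<And>\<xi> \<eta> y. g (\<xi> + \<eta>) y = g \<xi> y + g \<eta> y"
    and scale: "\<And>r \<xi> y. g (r *\<^sub>R \<xi>) y = r *\<^sub>R g \<xi> y"
    and bound: "\<And>\<xi> F. finite F \<Longrightarrow> (\<Sum>y\<in>F. (norm (g \<xi> y))\<^sup>2) \<le> C * (norm \<xi>)\<^sup>2"
  shows "l2_apply (blinfun_apply (l2_op g) \<xi>) y = g \<xi> y"
proof -
  have L2: "L2_set (\<lambda>y. norm (g \<xi> y)) F \<le> norm \<xi> * sqrt C" if "finite F" for F \<xi>
    using bound[OF that, of \<xi>] real_sqrt_le_mono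
    by (fastforce simp: L2_set_def real_sqrt_mult mult.commute)
  have app: "l2_apply (Abs_l2 (g \<xi>)) = g \<xi>" for \<xi>
    by (rule Abs_l2_inverse) (simp add: l2_norm_bound(1)[OF L2])
  have "bounded_linear (\<lambda>\<xi>. Abs_l2 (g \<xi>))"
  proof (rule bounded_linear_intro)
    show "norm (Abs_l2 (g \<xi>)) \<le> norm \<xi> * sqrt C" for \<xi>
      by (rule norm_l2_le) (simp add: app L2)
  qed (auto intro!: l2_eqI simp: app add scale plus_l2.rep_eq scaleR_l2.rep_eq)
  then show ?thesis
    by (simp add: l2_op_def bounded_linear_Blinfun_apply app)
qed

text \<open>
  \<open>l2_push\<close> sends \<open>\<delta>\<^sub>x \<otimes> h\<close> to \<open>\<delta>\<^bsub>f x\<^esub> \<otimes> v\<^sub>x h\<close> for \<open>x\<close> in \<open>S\<close> and to \<open>0\<close> otherwise; \<open>l2_pull\<close>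
  is its adjoint when \<open>w\<^sub>x\<close> is the adjoint of \<open>v\<^sub>x\<close>.
\<close>

definition l2_push :: "'a set \<Rightarrow> ('a \<Rightarrow> 'b) \<Rightarrow> ('a \<Rightarrow> 'h \<Rightarrow>\<^sub>L 'h) \<Rightarrow>
    ('a, 'h :: real_normed_vector) l2 \<Rightarrow>\<^sub>L ('b, 'h) l2"
  where "l2_push S f v = l2_op (\<lambda>\<xi> y. \<Sum>x | x \<in> S \<and> f x = y. (v x) (l2_apply \<xi> x))"

definition l2_pull :: "'a set \<Rightarrow> ('a \<Rightarrow> 'b) \<Rightarrow> ('a \<Rightarrow> 'h \<Rightarrow>\<^sub>L 'h) \<Rightarrow>
    ('b, 'h :: real_normed_vector) l2 \<Rightarrow>\<^sub>L ('a, 'h) l2"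
  where "l2_pull S f w =
    l2_op (\<lambda>\<eta> x. if x \<in> S then (w x) (l2_apply \<eta> (f x)) else 0)"

text \<open>
  A uniform bound \<open>N\<close> on the fibres makes both maps bounded: by the Cauchy--Schwarz inequality on each
  fibre, pushing forward multiplies the square of the norm by at most \<open>N\<close>.
\<close>

locale fibre_maps =
  fixes S :: "'a set" and f :: "'a \<Rightarrow> 'b" and N :: nat
    and v w :: "'a \<Rightarrow> 'h :: complex_inner \<Rightarrow>\<^sub>L 'h"
  assumes fibres: "finite {x \<in> S. f x = y}" "card {x \<in> S. f x = y} \<le> N"
    and norm_v: "norm (v x h) \<le> norm h"
    and norm_w: "norm (w x h) \<le> norm h"
    and adjoint_v: "cinner (v x h) k = cinner h (w x k)"
begin

abbreviation "push \<equiv> l2_push S f v"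
abbreviation "pull \<equiv> l2_pull S f w"

lemma push_apply:
  "l2_apply (push \<xi>) y = (\<Sum>x | x \<in> S \<and> f x = y. (v x) (l2_apply \<xi> x))"
  unfolding l2_push_def
proof (rule l2_op_apply[where C = "real N"])
  fix \<xi> :: "('a, 'h) l2" and F :: "'b set"
  assume F: "finite F"
  have fin: "finite {x. x \<in> S \<and> f x = y}" for y
    using fibres(1)[of y] by simp
  have "(\<Sum>y\<in>F. (norm (\<Sum>x | x \<in> S \<and> f x = y. (v x) (l2_apply \<xi> x)))\<^sup>2)
      \<le> (\<Sum>y\<in>F. real N * (\<Sum>x | x \<in> S \<and> f x = y. (norm (l2_apply \<xi> x))\<^sup>2))"
  proof (rule sum_mono)
    fix y
    have "(norm (\<Sum>x | x \<in> S \<and> f x = y. (v x) (l2_apply \<xi> x)))\<^sup>2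
        \<le> (\<Sum>x | x \<in> S \<and> f x = y. norm (l2_apply \<xi> x))\<^sup>2"
      by (intro power_mono sum_norm_le norm_v norm_ge_zero)
    also have "\<dots> \<le> real (card {x. x \<in> S \<and> f x = y}) * (\<Sum>x | x \<in> S \<and> f x = y. (norm (l2_apply \<xi> x))\<^sup>2)"
      using sum_squared_le_sum_of_squares[of "\<lambda>x. norm (l2_apply \<xi> x)" "{x. x \<in> S \<and> f x = y}"]
      by (simp add: mult.commute)
    also have "\<dots> \<le> real N * (\<Sum>x | x \<in> S \<and> f x = y. (norm (l2_apply \<xi> x))\<^sup>2)"
      using fibres(2)[of y] by (intro mult_right_mono sum_nonneg) auto
    finally show "(norm (\<Sum>x | x \<in> S \<and> f x = y. (v x) (l2_apply \<xi> x)))\<^sup>2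
        \<le> real N * (\<Sum>x | x \<in> S \<and> f x = y. (norm (l2_apply \<xi> x))\<^sup>2)" .
  qed
  also have "\<dots> = real N * (\<Sum>x\<in>(\<Union>y\<in>F. {x. x \<in> S \<and> f x = y}). (norm (l2_apply \<xi> x))\<^sup>2)"
    by (subst sum.UNION_disjoint) (use F fin in \<open>auto simp: sum_distrib_left\<close>)
  also have "\<dots> \<le> real N * (norm \<xi>)\<^sup>2"
    by (intro mult_left_mono sum_norm_l2_apply_le) (use F fin in auto)
  finally show "(\<Sum>y\<in>F. (norm (\<Sum>x | x \<in> S \<and> f x = y. (v x) (l2_apply \<xi> x)))\<^sup>2)
      \<le> real N * (norm \<xi>)\<^sup>2" .
qed (auto simp: plus_l2.rep_eq scaleR_l2.rep_eq blinfun.add_right blinfun.scaleR_right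
      sum.distrib scaleR_sum_right)

lemma pull_apply:
  "l2_apply (pull \<eta>) x = (if x \<in> S then (w x) (l2_apply \<eta> (f x)) else 0)"
  unfolding l2_pull_def
proof (rule l2_op_apply[where C = "real N"])
  fix \<eta> :: "('b, 'h) l2" and F :: "'a set"
  assume F: "finite F"
  have "(\<Sum>x\<in>F. (norm (if x \<in> S then (w x) (l2_apply \<eta> (f x)) else 0))\<^sup>2)
      = (\<Sum>x\<in>F \<inter> S. (norm (w x (l2_apply \<eta> (f x))))\<^sup>2)"
    using F by (intro sum.mono_neutral_cong_right) auto
  also have "\<dots> \<le> (\<Sum>x\<in>F \<inter> S. (norm (l2_apply \<eta> (f x)))\<^sup>2)"
    by (intro sum_mono power_mono norm_w) auto
  also have "\<dots> = (\<Sum>y\<in>f ` (F \<inter> S). \<Sum>x | x \<in> F \<inter> S \<and> f x = y. (norm (l2_apply \<eta> (f x)))\<^sup>2)"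
    using F by (intro sum.image_gen) auto
  also have "\<dots> = (\<Sum>y\<in>f ` (F \<inter> S). card {x. x \<in> F \<inter> S \<and> f x = y} * (norm (l2_apply \<eta> y))\<^sup>2)"
    by (intro sum.cong) auto
  also have "\<dots> \<le> (\<Sum>y\<in>f ` (F \<inter> S). real N * (norm (l2_apply \<eta> y))\<^sup>2)"
  proof (intro sum_mono mult_right_mono)
    fix y
    have "card {x. x \<in> F \<inter> S \<and> f x = y} \<le> card {x \<in> S. f x = y}"
      by (rule card_mono[OF fibres(1)]) auto
    then show "real (card {x. x \<in> F \<inter> S \<and> f x = y}) \<le> real N"
      using fibres(2)[of y] by linarith
  qed auto
  also have "\<dots> \<le> real N * (norm \<eta>)\<^sup>2"
    unfolding sum_distrib_left[symmetric]
    by (intro mult_left_mono sum_norm_l2_apply_le) (use F in auto)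
  finally show "(\<Sum>x\<in>F. (norm (if x \<in> S then (w x) (l2_apply \<eta> (f x)) else 0))\<^sup>2)
      \<le> real N * (norm \<eta>)\<^sup>2" .
qed (auto simp: plus_l2.rep_eq scaleR_l2.rep_eq blinfun.add_right blinfun.scaleR_right)

lemma push_single:
  assumes "x \<in> S"
  shows "push (l2_single x h) = l2_single (f x) (v x h)"
proof (rule l2_eqI)
  fix y
  have "l2_apply (push (l2_single x h)) y
      = (\<Sum>x' | x' \<in> S \<and> f x' = y. if x' = x then (v x) h else 0)"
    unfolding push_apply by (rule sum.cong) (auto simp: l2_single.rep_eq)
  also have "\<dots> = l2_apply (l2_single (f x) (v x h)) y"
    using assms fibres(1)[of y] by (auto simp: l2_single.rep_eq sum.delta)
  finally show "l2_apply (push (l2_single x h)) y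
      = l2_apply (l2_single (f x) (v x h)) y" .
qed

lemma push_single_outside: "x \<notin> S \<Longrightarrow> push (l2_single x h) = 0"
  by (rule l2_eqI) (auto simp: push_apply l2_single.rep_eq zero_l2.rep_eq intro!: sum.neutral)

lemma pull_single:
  "pull (l2_single y h) = (\<Sum>x | x \<in> S \<and> f x = y. l2_single x (w x h))"
proof (rule l2_eqI)
  fix x
  have "l2_apply (\<Sum>x | x \<in> S \<and> f x = y. l2_single x (w x h)) x
      = (\<Sum>x' | x' \<in> S \<and> f x' = y. if x' = x then (w x) h else 0)"
    unfolding l2_apply_sum by (rule sum.cong) (auto simp: l2_single.rep_eq)
  also have "\<dots> = l2_apply (pull (l2_single y h)) x"
    using fibres(1)[of y] by (auto simp: pull_apply l2_single.rep_eq sum.delta)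
  finally show "l2_apply (pull (l2_single y h)) x
      = l2_apply (\<Sum>x | x \<in> S \<and> f x = y. l2_single x (w x h)) x" ..
qed

text \<open>
  Comparing both sides on \<open>\<delta>\<^sub>x \<otimes> h\<close> avoids rearranging a double sum over the fibres.
\<close>

lemma adjoint_push: "cinner (push \<xi>) \<eta> = cinner \<xi> (pull \<eta>)"
proof -
  have "cinner (push \<xi>) \<eta> - cinner \<xi> (pull \<eta>) = 0"
  proof (rule bounded_linear_zero_on_singles[where S = UNIV
        and T = "\<lambda>\<xi>. cinner (push \<xi>) \<eta> - cinner \<xi> (pull \<eta>)"])
    show "bounded_linear (\<lambda>\<xi>. cinner (push \<xi>) \<eta> - cinner \<xi> (pull \<eta>))"
      by (rule bounded_linear_sub[OF bounded_linear_compose[OF bounded_linear_cinner_left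
            blinfun.bounded_linear_right] bounded_linear_cinner_left])
    show "cinner (push (l2_single x h)) \<eta>
        - cinner (l2_single x h) (pull \<eta>) = 0" for x h
      by (cases "x \<in> S") (auto simp: push_single push_single_outside cinner_l2_single pull_apply adjoint_v)
  qed simp
  then show ?thesis
    by simp
qed

end

text \<open>
  If the points of a fibre are sent to orthogonal copies of the coefficient space, then no information is
  lost although \<open>f\<close> is not injective: pulling back after pushing forward is the identity over \<open>S\<close>.
\<close>

locale fibre_isometry = fibre_maps +
  assumes w_v: "w x (v x h) = h"
    and w_v_other: "x \<in> S \<Longrightarrow> x' \<in> S \<Longrightarrow> f x = f x' \<Longrightarrow> x \<noteq> x' \<Longrightarrow>
      w x (v x' h) = 0"
begin

lemma pull_push_apply:
  "l2_apply (pull (push \<xi>)) x = (if x \<in> S then l2_apply \<xi> x else 0)"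
proof (cases "x \<in> S")
  case True
  have "w x (\<Sum>x' | x' \<in> S \<and> f x' = f x. (v x') (l2_apply \<xi> x'))
      = (\<Sum>x' | x' \<in> S \<and> f x' = f x. if x' = x then l2_apply \<xi> x else 0)"
    unfolding blinfun.sum_right
    by (rule sum.cong) (use True w_v w_v_other in auto)
  also have "\<dots> = l2_apply \<xi> x"
    using True fibres(1)[of "f x"] by (auto simp: sum.delta)
  finally show ?thesis
    using True by (simp add: pull_apply push_apply)
qed (simp add: pull_apply)

lemma norm_push: "norm (push \<xi>) \<le> norm \<xi>"
  and norm_pull: "norm (pull \<eta>) \<le> norm \<eta>"
proof -
  have "norm (pull (push \<xi>)) \<le> norm \<xi>" for \<xi>
    by (rule norm_l2_sq_le)
      (auto simp: pull_push_apply intro!: order_trans[OF sum_mono sum_norm_l2_apply_le])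
  from adjoint_contraction[OF adjoint_push this]
  show "norm (push \<xi>) \<le> norm \<xi>" "norm (pull \<eta>) \<le> norm \<eta>"
    by blast+
qed

end

text \<open>
  A Hilbert space of the form \<open>\<ell>\<^sub>2(\<nat>)\<close> contains countably many pairwise orthogonal copies of itself:
  the \<open>i\<close>-th one sits on the coordinates \<open>prod_encode (i, m)\<close>. These copies keep the points of a
  fibre apart when the fibre is collapsed to a point.
\<close>

definition shift :: "nat \<Rightarrow> (nat, 'h :: real_normed_vector) l2 \<Rightarrow>\<^sub>L (nat, 'h) l2"
  where "shift i = l2_push UNIV (\<lambda>m. prod_encode (i, m)) (\<lambda>_. id_blinfun)"

definition unshift :: "nat \<Rightarrow> (nat, 'h :: real_normed_vector) l2 \<Rightarrow>\<^sub>L (nat, 'h) l2"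
  where "unshift i = l2_pull UNIV (\<lambda>m. prod_encode (i, m)) (\<lambda>_. id_blinfun)"

lemma fibre_isometry_shift:
  "fibre_isometry UNIV (\<lambda>m. prod_encode (i, m)) 1
    (\<lambda>_. id_blinfun :: 'h :: complex_inner \<Rightarrow>\<^sub>L 'h) (\<lambda>_. id_blinfun)"
proof
  fix y
  have sub: "{m \<in> UNIV. prod_encode (i, m) = y} \<subseteq> {snd (prod_decode y)}"
    by auto
  show "finite {m \<in> UNIV. prod_encode (i, m) = y}"
    by (rule finite_subset[OF sub]) simp
  show "card {m \<in> UNIV. prod_encode (i, m) = y} \<le> 1"
    using card_mono[OF _ sub] by simp
qed (auto simp: prod_encode_eq)

lemma unshift_shift: "unshift i (shift i (h :: (nat, 'h :: complex_inner) l2)) = h"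
proof -
  interpret fibre_isometry UNIV "\<lambda>m. prod_encode (i, m)" 1
    "\<lambda>_. id_blinfun :: 'h \<Rightarrow>\<^sub>L 'h" "\<lambda>_. id_blinfun"
    by (rule fibre_isometry_shift)
  show ?thesis
    by (rule l2_eqI) (simp add: shift_def unshift_def pull_push_apply)
qed

lemma unshift_shift_other:
  assumes "i \<noteq> j"
  shows "unshift i (shift j (h :: (nat, 'h :: complex_inner) l2)) = 0"
proof -
  interpret i: fibre_isometry UNIV "\<lambda>m. prod_encode (i, m)" 1
    "\<lambda>_. id_blinfun :: 'h \<Rightarrow>\<^sub>L 'h" "\<lambda>_. id_blinfun"
    by (rule fibre_isometry_shift)
  interpret j: fibre_isometry UNIV "\<lambda>m. prod_encode (j, m)" 1
    "\<lambda>_. id_blinfun :: 'h \<Rightarrow>\<^sub>L 'h" "\<lambda>_. id_blinfun"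
    by (rule fibre_isometry_shift)
  show ?thesis
    using assms
    by (intro l2_eqI) (simp add: shift_def unshift_def i.pull_apply j.push_apply zero_l2.rep_eq prod_encode_eq)
qed

lemma shift_adjoint:
  "cinner (shift i (h :: (nat, 'h :: complex_inner) l2)) k = cinner h (unshift i k)"
  and norm_shift: "norm (shift i h) \<le> norm h"
  and norm_unshift: "norm (unshift i h) \<le> norm h"
proof -
  interpret fibre_isometry UNIV "\<lambda>m. prod_encode (i, m)" 1
    "\<lambda>_. id_blinfun :: 'h \<Rightarrow>\<^sub>L 'h" "\<lambda>_. id_blinfun"
    by (rule fibre_isometry_shift)
  show "cinner (shift i h) k = cinner h (unshift i k)"
    "norm (shift i h) \<le> norm h" "norm (unshift i h) \<le> norm h"
    by (simp_all add: shift_def unshift_def adjoint_push norm_push norm_pull)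
qed

section \<open>Corners\<close>

definition corner :: "'a set \<Rightarrow> ('a, 'h :: real_normed_vector) l2 \<Rightarrow>\<^sub>L ('a, 'h) l2"
  where "corner S = l2_op (\<lambda>\<xi> x. if x \<in> S then l2_apply \<xi> x else 0)"

lemma corner_apply: "l2_apply (corner S \<xi>) x = (if x \<in> S then l2_apply \<xi> x else 0)"
  unfolding corner_def
  by (rule l2_op_apply[where C = 1])
    (auto simp: plus_l2.rep_eq scaleR_l2.rep_eq intro!: order_trans[OF sum_mono sum_norm_l2_apply_le])

lemma norm_corner_mono:
  assumes "S \<subseteq> T"
  shows "norm (corner S \<xi>) \<le> norm (corner T \<xi>)"
  by (rule norm_l2_sq_le, rule order_trans[OF sum_mono sum_norm_l2_apply_le])
    (use assms in \<open>auto simp: corner_apply\<close>)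

lemma norm_corner: "norm (corner S \<xi>) \<le> norm \<xi>"
  by (rule norm_l2_sq_le, rule order_trans[OF sum_mono sum_norm_l2_apply_le])
    (auto simp: corner_apply)

lemma corner_symmetric:
  "cinner (corner S \<xi>) (\<eta> :: ('a, 'h :: complex_inner) l2) = cinner \<xi> (corner S \<eta>)"
  unfolding cinner_l2.rep_eq by (rule infsum_cong) (simp add: corner_apply)

lemma corner_id: "(\<And>x. x \<notin> S \<Longrightarrow> l2_apply \<xi> x = 0) \<Longrightarrow> corner S \<xi> = \<xi>"
  by (rule l2_eqI) (auto simp: corner_apply)

lemma corner_union_disjoint:
  assumes "S \<inter> T = {}"
  shows "corner (S \<union> T) \<xi> = corner S \<xi> + corner T \<xi>"
  by (rule l2_eqI) (use assms in \<open>auto simp: corner_apply plus_l2.rep_eq\<close>)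

lemma corner_compl: "corner S \<xi> + corner (- S) \<xi> = \<xi>"
  by (rule l2_eqI) (auto simp: corner_apply plus_l2.rep_eq)

lemma norm_corner_union_disjoint:
  fixes \<xi> :: "('a, 'h :: complex_inner) l2"
  assumes "S \<inter> T = {}"
  shows "(norm (corner (S \<union> T) \<xi>))\<^sup>2
    = (norm (corner S \<xi>))\<^sup>2 + (norm (corner T \<xi>))\<^sup>2"
proof -
  have "cinner (corner S \<xi>) (corner T \<xi>) = 0"
    "cinner (corner T \<xi>) (corner S \<xi>) = 0"
    unfolding cinner_l2.rep_eq by (rule infsum_0; use assms in \<open>auto simp: corner_apply\<close>)+
  then have "complex_of_real ((norm (corner (S \<union> T) \<xi>))\<^sup>2)
    = complex_of_real ((norm (corner S \<xi>))\<^sup>2 + (norm (corner T \<xi>))\<^sup>2)"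
    unfolding of_real_add cinner_self[symmetric] corner_union_disjoint[OF assms]
    by (simp add: cinner_add_left cinner_add_right)
  then show ?thesis
    using of_real_eq_iff by blast
qed

lemma norm_corner_UN_disjoint:
  fixes \<xi> :: "('a, 'h :: complex_inner) l2"
  assumes "disjoint_family P" "finite I"
  shows "(norm (corner (\<Union>n\<in>I. P n) \<xi>))\<^sup>2 = (\<Sum>n\<in>I. (norm (corner (P n) \<xi>))\<^sup>2)"
  using assms(2)
proof (induction I rule: finite_induct)
  case empty
  have "(corner {}) \<xi> = 0"
    by (rule l2_eqI) (simp add: corner_apply zero_l2.rep_eq)
  then show ?case
    by simp
next
  case (insert n I)
  have "P n \<inter> P m = {}" if "m \<in> I" for m
    using insert.hyps(2) that disjoint_family_onD[OF assms(1), of n m] by auto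
  then have "P n \<inter> (\<Union>n\<in>I. P n) = {}"
    by blast
  then show ?case
    using insert.hyps insert.IH by (simp add: norm_corner_union_disjoint)
qed

text \<open>
  The blocks of a vector are orthogonal, so a bound on every block gives the same bound on the sum.
\<close>

lemma norm_le_blockwise:
  fixes \<xi> \<eta> :: "('a, 'h :: complex_inner) l2"
  assumes P: "disjoint_family (P :: nat \<Rightarrow> 'a set)" and C: "0 \<le> C"
    and le: "\<And>n. norm (corner (P n) \<eta>) \<le> C * norm (corner (P n) \<xi>)"
    and supp: "\<And>x. x \<notin> (\<Union>n. P n) \<Longrightarrow> l2_apply \<eta> x = 0"
  shows "norm \<eta> \<le> C * norm \<xi>"
proof (rule norm_l2_sq_le)
  fix F :: "'a set"
  assume F: "finite F"
  have "\<exists>I. finite I \<and> F \<inter> (\<Union>n. P n) \<subseteq> (\<Union>n\<in>I. P n)"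
    using finite_subset_Union[of "F \<inter> (\<Union>n. P n)" "range P"] F
    by (metis Int_lower2 finite_Int finite_subset_image image_mono)
  then obtain I where I: "finite I" "F \<inter> (\<Union>n. P n) \<subseteq> (\<Union>n\<in>I. P n)"
    by blast
  have "(\<Sum>x\<in>F. (norm (l2_apply \<eta> x))\<^sup>2) \<le> (\<Sum>x\<in>F. (norm (l2_apply (corner (\<Union>n\<in>I. P n) \<eta>) x))\<^sup>2)"
  proof (rule sum_mono)
    fix x
    assume "x \<in> F"
    then have "l2_apply \<eta> x = 0" if "x \<notin> (\<Union>n\<in>I. P n)"
      using I(2) supp[of x] that by blast
    then show "(norm (l2_apply \<eta> x))\<^sup>2 \<le> (norm (l2_apply (corner (\<Union>n\<in>I. P n) \<eta>) x))\<^sup>2"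
      by (auto simp: corner_apply)
  qed
  also have "\<dots> \<le> (norm (corner (\<Union>n\<in>I. P n) \<eta>))\<^sup>2"
    by (rule sum_norm_l2_apply_le[OF F])
  also have "\<dots> = (\<Sum>n\<in>I. (norm (corner (P n) \<eta>))\<^sup>2)"
    by (rule norm_corner_UN_disjoint[OF P I(1)])
  also have "\<dots> \<le> (\<Sum>n\<in>I. (C * norm (corner (P n) \<xi>))\<^sup>2)"
    by (intro sum_mono power_mono le norm_ge_zero)
  also have "\<dots> = C\<^sup>2 * (norm (corner (\<Union>n\<in>I. P n) \<xi>))\<^sup>2"
    by (simp add: norm_corner_UN_disjoint[OF P I(1)] power_mult_distrib sum_distrib_left)
  also have "\<dots> \<le> (C * norm \<xi>)\<^sup>2"
    by (simp add: power_mult_distrib mult_left_mono power_mono norm_corner)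
  finally show "(\<Sum>x\<in>F. (norm (l2_apply \<eta> x))\<^sup>2) \<le> (C * norm \<xi>)\<^sup>2" .
qed (use C in simp)

text \<open>
  For a geometric series \<open>b\<close> the triangle inequality is sharp enough, and it does not ask for disjoint
  pieces.
\<close>

lemma norm_corner_UN_le_suminf:
  fixes b :: "nat \<Rightarrow> real"
  assumes le: "\<And>n. norm (corner (P n) \<eta>) \<le> b n" and b: "summable b"
  shows "norm (corner (\<Union>n. P n) \<eta>) \<le> suminf b"
proof (rule norm_l2_le)
  fix F :: "'a set"
  assume F: "finite F"
  have b0: "0 \<le> b n" for n
    using le[of n] norm_ge_zero order_trans by blast
  have fin: "norm (corner (\<Union>n\<in>I. P n) \<eta>) \<le> sum b I" if "finite I" for I
    using that
  proof (induction I rule: finite_induct)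
    case empty
    have "(corner {}) \<eta> = 0"
      by (rule l2_eqI) (simp add: corner_apply zero_l2.rep_eq)
    then show ?case
      by simp
  next
    case (insert n I)
    have "(\<Union>m\<in>insert n I. P m) = (P n - (\<Union>m\<in>I. P m)) \<union> (\<Union>m\<in>I. P m)"
      by auto
    then have "corner (\<Union>m\<in>insert n I. P m) \<eta>
        = corner (P n - (\<Union>m\<in>I. P m)) \<eta> + corner (\<Union>m\<in>I. P m) \<eta>"
      by (metis Diff_disjoint Int_commute corner_union_disjoint)
    moreover have "norm (corner (P n - (\<Union>m\<in>I. P m)) \<eta>) \<le> b n"
      by (rule order_trans[OF norm_corner_mono le]) auto
    ultimately show ?case
      using insert norm_triangle_le[of "corner (P n - (\<Union>m\<in>I. P m)) \<eta>"
          "corner (\<Union>m\<in>I. P m) \<eta>" "sum b (insert n I)"]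
      by simp
  qed
  have "\<exists>I. finite I \<and> F \<inter> (\<Union>n. P n) \<subseteq> (\<Union>n\<in>I. P n)"
    using finite_subset_Union[of "F \<inter> (\<Union>n. P n)" "range P"] F
    by (metis Int_lower2 finite_Int finite_subset_image image_mono)
  then obtain I where I: "finite I" "F \<inter> (\<Union>n. P n) \<subseteq> (\<Union>n\<in>I. P n)"
    by blast
  have "L2_set (\<lambda>x. norm (l2_apply (corner (\<Union>n. P n) \<eta>) x)) F
      \<le> L2_set (\<lambda>x. norm (l2_apply (corner (\<Union>n\<in>I. P n) \<eta>) x)) F"
    by (rule L2_set_mono) (use I in \<open>auto simp: corner_apply\<close>)
  also have "\<dots> \<le> norm (corner (\<Union>n\<in>I. P n) \<eta>)"
    by (rule L2_set_l2_apply_le[OF F])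
  also have "\<dots> \<le> sum b I"
    by (rule fin[OF I(1)])
  also have "\<dots> \<le> suminf b"
    by (rule sum_le_suminf[OF b I(1)]) (use b0 in auto)
  finally show "L2_set (\<lambda>x. norm (l2_apply (corner (\<Union>n. P n) \<eta>) x)) F \<le> suminf b" .
qed

text \<open>
  Up to a small error \<open>\<zeta>\<close> lives on a finite set, and such a set meets only finitely many of the
  supports.
\<close>

lemma disjoint_supports_weakly_null:
  fixes \<eta> :: "nat \<Rightarrow> ('a, 'h :: complex_inner) l2"
  assumes P: "disjoint_family P"
    and supp: "\<And>k x. x \<notin> P k \<Longrightarrow> l2_apply (\<eta> k) x = 0"
    and norm: "\<And>k. norm (\<eta> k) \<le> 1"
  shows "(\<lambda>k. cinner (\<eta> k) \<zeta>) \<longlonglongrightarrow> 0"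
proof (rule LIMSEQ_I)
  fix e :: real
  assume e: "0 < e"
  obtain F where F: "finite F" and le: "\<And>\<eta> :: ('a, 'h) l2. \<forall>x\<in>F. l2_apply \<eta> x = 0 \<Longrightarrow>
      \<forall>x. x \<notin> F \<longrightarrow> norm (l2_apply \<eta> x) \<le> norm (l2_apply \<zeta> x) \<Longrightarrow> norm \<eta> \<le> e / 2"
    using l2_tail[of "e / 2" \<zeta>] e by (metis half_gt_zero)
  have "finite {k. x \<in> P k}" for x
  proof (cases "\<exists>k. x \<in> P k")
    case True
    then obtain k where "x \<in> P k"
      by blast
    then have "{k. x \<in> P k} \<subseteq> {k}"
      using P by (auto simp: disjoint_family_on_def)
    then show ?thesis
      using finite_subset by blast
  qed simp
  then have "finite (\<Union>x\<in>F. {k. x \<in> P k})"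
    using F by blast
  then obtain K where K: "\<forall>k\<in>(\<Union>x\<in>F. {k. x \<in> P k}). k < K"
    using finite_nat_set_iff_bounded by blast
  have "norm (cinner (\<eta> k) \<zeta> - 0) < e" if "K \<le> k" for k
  proof -
    have disj: "x \<notin> P k" if "x \<in> F" for x
      using K that \<open>K \<le> k\<close> by force
    have "cinner (\<eta> k) \<zeta> = cinner (\<eta> k) (corner (P k) \<zeta>)"
      by (simp add: corner_id supp flip: corner_symmetric)
    also have "cmod \<dots> \<le> norm (\<eta> k) * norm (corner (P k) \<zeta>)"
      by (rule cauchy_schwarz)
    also have "\<dots> \<le> 1 * (e / 2)"
      by (intro mult_mono norm le) (use disj e in \<open>auto simp: corner_apply\<close>)
    finally show ?thesis
      using e by simp
  qed
  then show "\<exists>K. \<forall>k\<ge>K. norm (cinner (\<eta> k) \<zeta> - 0) < e"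
    by blast
qed

section \<open>Compact operators\<close>

lemma compact_op_if_image_subset:
  assumes "compact K" "blinfun_apply a ` cball 0 1 \<subseteq> K"
  shows "compact_op a"
proof -
  have "closure (blinfun_apply a ` cball 0 1) \<subseteq> K"
    by (rule closure_minimal[OF assms(2) compact_imp_closed[OF assms(1)]])
  then have "closure (blinfun_apply a ` cball 0 1) = K \<inter> closure (blinfun_apply a ` cball 0 1)"
    by blast
  then show ?thesis
    unfolding compact_op_def by (metis assms(1) closed_closure compact_Int_closed)
qed

text \<open>
  Total boundedness survives uniform approximation on the unit ball.
\<close>

lemma compact_op_if_approximable:
  fixes a :: "'e :: {real_normed_vector, banach} \<Rightarrow>\<^sub>L 'e"
  assumes "\<And>e. 0 < e \<Longrightarrow> \<exists>t :: 'e \<Rightarrow>\<^sub>L 'e. compact_op t \<and> norm (a - t) \<le> e"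
  shows "compact_op a"
  unfolding compact_op_def compact_eq_totally_bounded
proof (intro conjI allI impI)
  show "complete (closure (blinfun_apply a ` cball 0 1))"
    by (simp add: complete_eq_closed)
  fix e :: real
  assume e: "0 < e"
  then obtain t :: "'e \<Rightarrow>\<^sub>L 'e" where t: "compact_op t" "norm (a - t) \<le> e / 4"
    using assms[of "e / 4"] by auto
  have "\<exists>k. finite k \<and> closure (blinfun_apply t ` cball 0 1) \<subseteq> (\<Union>x\<in>k. ball x (e / 4))"
    using t(1) e unfolding compact_op_def compact_eq_totally_bounded by auto
  then obtain k where k: "finite k" "closure (blinfun_apply t ` cball 0 1) \<subseteq> (\<Union>x\<in>k. ball x (e / 4))"
    by blast
  show "\<exists>k. finite k \<and> closure (blinfun_apply a ` cball 0 1) \<subseteq> (\<Union>x\<in>k. ball x e)"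
  proof (intro exI[of _ k] conjI k(1) subsetI)
    fix z
    assume "z \<in> closure (blinfun_apply a ` cball 0 1)"
    then obtain \<xi> where \<xi>: "norm \<xi> \<le> 1" "dist (a \<xi>) z < e / 4"
      using e unfolding closure_approachable by (auto dest!: spec[of _ "e / 4"])
    have "t \<xi> \<in> closure (blinfun_apply t ` cball 0 1)"
      using \<xi> closure_subset by fastforce
    then obtain x where x: "x \<in> k" "dist x (t \<xi>) < e / 4"
      using k(2) by auto
    have "norm ((a - t) \<xi>) \<le> e / 4 * 1"
      by (rule order_trans[OF norm_blinfun mult_mono[OF t(2) \<xi>(1)]]) (use e in auto)
    then have "dist (t \<xi>) (a \<xi>) \<le> e / 4"
      by (simp add: dist_norm blinfun.diff_left norm_minus_commute)
    then have "dist x z < e"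
      using \<xi> x e dist_triangle[of x z "t \<xi>"]
        dist_triangle[of "t \<xi>" z "a \<xi>"] by linarith
    then show "z \<in> (\<Union>x\<in>k. ball x e)"
      using x(1) by auto
  qed
qed

lemma compact_finite_sums:
  fixes K :: "'i \<Rightarrow> 'e :: real_normed_vector set"
  assumes "finite I" "\<And>i. i \<in> I \<Longrightarrow> compact (K i)"
  shows "compact ((\<lambda>g. \<Sum>i\<in>I. g i) ` Pi I K)"
  using assms
proof (induction I rule: finite_induct)
  case empty
  then show ?case
    by (simp add: image_constant_conv)
next
  case (insert j I)
  have "(\<lambda>g. \<Sum>i\<in>insert j I. g i) ` Pi (insert j I) K
      = {x + y | x y. x \<in> K j \<and> y \<in> (\<lambda>g. \<Sum>i\<in>I. g i) ` Pi I K}" (is "?A = ?B")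
  proof
    show "?A \<subseteq> ?B"
    proof
      fix z
      assume "z \<in> ?A"
      then obtain g where g: "g \<in> Pi (insert j I) K" "z = (\<Sum>i\<in>insert j I. g i)"
        by blast
      then have "z = g j + (\<Sum>i\<in>I. g i)" "g j \<in> K j" "g \<in> Pi I K"
        using insert.hyps by auto
      then show "z \<in> ?B"
        by blast
    qed
    show "?B \<subseteq> ?A"
    proof
      fix z
      assume "z \<in> ?B"
      then obtain x g where z: "z = x + (\<Sum>i\<in>I. g i)" "x \<in> K j" "g \<in> Pi I K"
        by auto
      have "(\<Sum>i\<in>I. (g(j := x)) i) = (\<Sum>i\<in>I. g i)"
        by (rule sum.cong) (use insert.hyps in auto)
      then have "z = (\<Sum>i\<in>insert j I. (g(j := x)) i)"
        using insert.hyps z by simp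
      moreover have "g(j := x) \<in> Pi (insert j I) K"
        using z insert.hyps by auto
      ultimately show "z \<in> ?A"
        by blast
    qed
  qed
  then show ?case
    using insert by (simp add: compact_sums)
qed

text \<open>
  The Gram--Schmidt process yields an orthonormal basis; only its Parseval expansion is recorded, since
  this is what bounds the coefficients of a vector by its norm.
\<close>

lemma span_finite_frame:
  fixes B :: "'e :: complex_inner set"
  assumes "finite B"
  shows "\<exists>E. finite E \<and> E \<subseteq> complex_vector.span B \<and>
    (\<forall>s\<in>complex_vector.span B. s = (\<Sum>e\<in>E. cinner s e *\<^sub>C e))"
  using assms
proof (induction B rule: finite_induct)
  case empty
  then show ?case
    by (intro exI[of _ "{}"]) simp
next
  case (insert b B)
  then obtain E where E: "finite E" "E \<subseteq> complex_vector.span B"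
    and frame: "\<And>s. s \<in> complex_vector.span B \<Longrightarrow> s = (\<Sum>e\<in>E. cinner s e *\<^sub>C e)"
    by blast
  define P where "P s = (\<Sum>e\<in>E. cinner s e *\<^sub>C e)" for s
  have P_span: "P s \<in> complex_vector.span B" for s
    unfolding P_def using E by (auto intro!: complex_vector.span_sum complex_vector.span_scale)
  have P_add: "P (s + t) = P s + P t" and P_scale: "P (c *\<^sub>C s) = c *\<^sub>C P s" for s t c
    by (simp_all add: P_def cinner_add_left cinner_scaleC_left scaleC_add_left sum.distrib
        complex_vector.scale_sum_right)
  have P_sym: "cinner (P s) t = cinner s (P t)" for s t
  proof -
    have "cinner (P s) t = (\<Sum>e\<in>E. cinner s e * cinner e t)"
      by (simp add: P_def cinner_sum_left cinner_scaleC_left)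
    also have "\<dots> = cnj (\<Sum>e\<in>E. cinner t e * cinner e s)"
      by (simp add: mult.commute flip: cinner_commute)
    also have "\<dots> = cnj (cinner (P t) s)"
      by (simp add: P_def cinner_sum_left cinner_scaleC_left)
    finally show ?thesis
      by (simp flip: cinner_commute)
  qed
  define u where "u = b - P b"
  have u_orth: "cinner t u = 0" if "t \<in> complex_vector.span B" for t
    using frame[OF that] P_sym[of t b] by (simp add: u_def cinner_minus_right P_def)
  have u_span: "u \<in> complex_vector.span (insert b B)"
    unfolding u_def by (intro complex_vector.span_diff complex_vector.span_base insertI1
        set_mp[OF complex_vector.span_mono[OF subset_insertI] P_span])
  have expand: "\<exists>k. s = P s + k *\<^sub>C u" if "s \<in> complex_vector.span (insert b B)" for s
  proof -
    obtain k where k: "s - k *\<^sub>C b \<in> complex_vector.span B"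
      using \<open>s \<in> _\<close> complex_vector.span_breakdown_eq by blast
    have "s = (s - k *\<^sub>C b) + k *\<^sub>C b" "P (s - k *\<^sub>C b) = s - k *\<^sub>C b"
      using frame[OF k] by (simp_all add: P_def)
    moreover have "P ((s - k *\<^sub>C b) + k *\<^sub>C b) = P (s - k *\<^sub>C b) + k *\<^sub>C P b"
      by (simp only: P_add P_scale)
    ultimately have "P s = s - k *\<^sub>C b + k *\<^sub>C P b"
      by simp
    then show ?thesis
      by (intro exI[of _ k]) (simp add: u_def complex_vector.scale_right_diff_distrib)
  qed
  show ?case
  proof (cases "u = 0")
    case True
    have "s = (\<Sum>e\<in>E. cinner s e *\<^sub>C e)" if "s \<in> complex_vector.span (insert b B)" for s
      using expand[OF that] True by (simp add: P_def)
    moreover have "E \<subseteq> complex_vector.span (insert b B)"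
      using E(2) complex_vector.span_mono[OF subset_insertI] by (rule subset_trans)
    ultimately show ?thesis
      using E(1) by (intro exI[of _ E] conjI ballI)
  next
    case False
    define e where "e = complex_of_real (inverse (norm u)) *\<^sub>C u"
    have "e \<notin> E"
    proof
      assume "e \<in> E"
      then have "cinner e e = 0"
        using u_orth E(2) by (subst (2) e_def) (auto simp: cinner_scaleC_right)
      then show False
        using False by (simp add: cinner_self e_def norm_scaleC)
    qed
    have "s = (\<Sum>e\<in>insert e E. cinner s e *\<^sub>C e)" if s: "s \<in> complex_vector.span (insert b B)" for s
    proof -
      obtain k where k: "s = P s + k *\<^sub>C u"
        using expand[OF s] by blast
      have "cinner s u = k * complex_of_real ((norm u)\<^sup>2)"
        by (subst k) (simp add: cinner_add_left cinner_scaleC_left u_orth P_span cinner_self)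
      then have "cinner s e *\<^sub>C e = k *\<^sub>C u"
        using False by (simp add: e_def cinner_scaleC_right scaleC_scaleC power2_eq_square)
      then show ?thesis
        using k E \<open>e \<notin> E\<close> by (simp add: P_def add.commute)
    qed
    moreover have "e \<in> complex_vector.span (insert b B)"
      unfolding e_def by (rule complex_vector.span_scale[OF u_span])
    moreover have "E \<subseteq> complex_vector.span (insert b B)"
      using E(2) complex_vector.span_mono[OF subset_insertI] by (rule subset_trans)
    ultimately show ?thesis
      using E(1) by (intro exI[of _ "insert e E"] conjI ballI) simp_all
  qed
qed

lemma bounded_span_subset_compact:
  fixes B :: "'e :: complex_inner set"
  assumes "finite B"
  shows "\<exists>K. compact K \<and> (\<forall>s\<in>complex_vector.span B. norm s \<le> R \<longrightarrow> s \<in> K)"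
proof -
  from span_finite_frame[OF assms] obtain E where E: "finite E"
    and frame': "\<forall>s\<in>complex_vector.span B. s = (\<Sum>e\<in>E. cinner s e *\<^sub>C e)"
    by (elim exE conjE)
  note frame = bspec[OF frame']
  define K where "K e = (\<lambda>c. c *\<^sub>C e) ` cball 0 (R * norm e)" for e :: 'e
  have lin: "bounded_linear (\<lambda>c. c *\<^sub>C e)" for e :: 'e
  proof (rule bounded_linear_intro[where K = "norm e"])
    show "(r *\<^sub>R c) *\<^sub>C e = r *\<^sub>R (c *\<^sub>C e)" for r c
      by (simp only: scaleR_conv_of_real scaleC_scaleC[symmetric] scaleC_of_real)
  qed (simp_all only: scaleC_add_left norm_scaleC order_refl)
  have "compact (K e)" for e
    unfolding K_def by (rule compact_continuous_image[OF linear_continuous_on[OF lin] compact_cball])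
  then have "compact ((\<lambda>g. \<Sum>e\<in>E. g e) ` Pi E K)"
    by (rule compact_finite_sums[OF E])
  moreover have "s \<in> (\<lambda>g. \<Sum>e\<in>E. g e) ` Pi E K" if "s \<in> complex_vector.span B" "norm s \<le> R" for s
  proof -
    have "cmod (cinner s e) \<le> R * norm e" for e
      by (rule order_trans[OF cauchy_schwarz mult_right_mono]) (use that in auto)
    then have "(\<lambda>e. cinner s e *\<^sub>C e) \<in> Pi E K"
      unfolding K_def by (intro Pi_I imageI) simp
    then show ?thesis
      by (rule image_eqI[where x = "\<lambda>e. cinner s e *\<^sub>C e", rotated]) (rule frame[OF that(1)])
  qed
  ultimately show ?thesis
    by (intro exI[of _ "(\<lambda>g. \<Sum>e\<in>E. g e) ` Pi E K"]) simp
qed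

lemma bounded_linear_l2_single: "bounded_linear (l2_single x)"
  by (rule bounded_linear_intro[where K = 1])
    (auto simp: norm_l2_single l2_single.rep_eq plus_l2.rep_eq scaleR_l2.rep_eq intro!: l2_eqI)

text \<open>
  The image of the unit ball consists of sums over \<open>F\<close> of vectors from one bounded, hence relatively
  compact, part of a finite-dimensional space.
\<close>

lemma compact_op_if_finite_rank:
  fixes a :: "('a, 'h :: complex_inner) l2 \<Rightarrow>\<^sub>L ('a, 'h) l2"
  assumes F: "finite F" and B: "finite B"
    and supp: "\<And>\<xi> y. y \<notin> F \<Longrightarrow> l2_apply (a \<xi>) y = 0"
    and span: "\<And>\<xi> y. y \<in> F \<Longrightarrow> l2_apply (a \<xi>) y \<in> complex_vector.span B"
  shows "compact_op a"
proof -
  from bounded_span_subset_compact[OF B, of "norm a"] obtain K where K: "compact K"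
    "\<forall>s\<in>complex_vector.span B. norm s \<le> norm a \<longrightarrow> s \<in> K"
    by (elim exE conjE)
  show ?thesis
  proof (rule compact_op_if_image_subset)
    show "compact ((\<lambda>g. \<Sum>y\<in>F. g y) ` Pi F (\<lambda>y. l2_single y ` K))"
      by (rule compact_finite_sums[OF F
            compact_continuous_image[OF linear_continuous_on[OF bounded_linear_l2_single] K(1)]])
    show "blinfun_apply a ` cball 0 1 \<subseteq> (\<lambda>g. \<Sum>y\<in>F. g y) ` Pi F (\<lambda>y. l2_single y ` K)"
    proof
      fix \<eta>
      assume "\<eta> \<in> blinfun_apply a ` cball 0 1"
      then obtain \<xi> where \<xi>: "norm \<xi> \<le> 1" "\<eta> = a \<xi>"
        by auto
      have "norm (l2_apply \<eta> y) \<le> norm a" for y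
        using norm_l2_apply_le[of \<eta> y] norm_blinfun[of a \<xi>] \<xi> mult_left_mono[OF \<xi>(1), of "norm a"] by simp
      then have "(\<lambda>y. l2_single y (l2_apply \<eta> y)) \<in> Pi F (\<lambda>y. l2_single y ` K)"
        using span \<xi>(2) K(2) by (intro Pi_I imageI) simp
      moreover have "\<eta> = (\<Sum>y\<in>F. l2_single y (l2_apply \<eta> y))"
        by (rule l2_finite_sum_singles[OF F]) (simp add: supp \<xi>(2))
      ultimately show "\<eta> \<in> (\<lambda>g. \<Sum>y\<in>F. g y) ` Pi F (\<lambda>y. l2_single y ` K)"
        by (rule image_eqI[where x = "\<lambda>y. l2_single y (l2_apply \<eta> y)", rotated])
    qed
  qed
qed

text \<open>
  A compact operator maps weakly null sequences to null sequences. For a projection this is immediate: a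
  limit \<open>\<zeta>\<close> of a subsequence of \<open>q \<eta>\<^sub>k\<close> satisfies \<open>\<langle>\<zeta>, \<zeta>\<rangle> = lim \<langle>\<eta>\<^sub>k, q \<zeta>\<rangle> = 0\<close>.
\<close>

lemma compact_projection_weakly_null:
  fixes q :: "'e :: complex_inner \<Rightarrow>\<^sub>L 'e"
  assumes q: "compact_op q" "projection_op q"
    and weak: "\<And>\<zeta>. (\<lambda>k. cinner (\<eta> k) \<zeta>) \<longlonglongrightarrow> 0"
    and norm: "\<And>k. norm (\<eta> k) \<le> 1"
    and c: "0 < c" "\<And>k. c \<le> norm (q (\<eta> k))"
  shows False
proof -
  have "q (\<eta> k) \<in> closure (blinfun_apply q ` cball 0 1)" for k
    by (rule set_mp[OF closure_subset]) (use norm in auto)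
  moreover have "seq_compact (closure (blinfun_apply q ` cball 0 1))"
    using q(1) by (simp add: compact_op_def compact_imp_seq_compact)
  ultimately obtain \<zeta> r where r: "strict_mono (r :: nat \<Rightarrow> nat)"
    and lim: "((\<lambda>k. q (\<eta> k)) \<circ> r) \<longlonglongrightarrow> \<zeta>"
    using seq_compactE[of _ "\<lambda>k. q (\<eta> k)"] by metis
  have "(\<lambda>k. cinner (q (\<eta> (r k))) \<zeta>) \<longlonglongrightarrow> cinner \<zeta> \<zeta>"
    using tendsto_cinner[OF lim tendsto_const[of \<zeta>]] by (simp add: o_def)
  moreover have "cinner (q (\<eta> (r k))) \<zeta> = cinner (\<eta> (r k)) (q \<zeta>)" for k
    using q(2) by (simp add: projection_op_def)
  moreover have "(\<lambda>k. cinner (\<eta> (r k)) (q \<zeta>)) \<longlonglongrightarrow> 0"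
    using LIMSEQ_subseq_LIMSEQ[OF weak r] by (simp add: o_def)
  ultimately have "cinner \<zeta> \<zeta> = 0"
    using LIMSEQ_unique by force
  then have "\<zeta> = 0"
    by (simp add: cinner_self)
  moreover have "c \<le> norm \<zeta>"
    by (rule tendsto_lowerbound[OF tendsto_norm[OF lim]]) (use c in auto)
  ultimately show False
    using c by simp
qed

section \<open>From almost projections to projections\<close>

lemmas blinfun_arith = blinfun.add_left blinfun.diff_left blinfun.scaleR_left
  blinfun.add_right blinfun.diff_right blinfun.scaleR_right blinfun.minus_left blinfun.minus_right

definition newton :: "('e :: real_normed_vector \<Rightarrow>\<^sub>L 'e) \<Rightarrow> 'e \<Rightarrow>\<^sub>L 'e"
  where "newton x = 3 *\<^sub>R (x o\<^sub>L x) - 2 *\<^sub>R (x o\<^sub>L x o\<^sub>L x)"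

definition defect :: "('e :: real_normed_vector \<Rightarrow>\<^sub>L 'e) \<Rightarrow> 'e \<Rightarrow>\<^sub>L 'e"
  where "defect x = x - (x o\<^sub>L x)"

text \<open>
  Written as repeated sums, the numerical coefficients of polynomials in an operator leave identities that
  hold in every abelian group.
\<close>

lemma scaleR_as_sum:
  "2 *\<^sub>R u = u + (u :: 'e :: real_vector)" "3 *\<^sub>R u = u + u + (u :: 'e)"
  "4 *\<^sub>R u = u + u + u + (u :: 'e)"
  using scaleR_add_left[of 1 1 u] scaleR_add_left[of 2 1 u] scaleR_add_left[of 3 1 u]
  by simp_all

lemma newton_step: "newton x - x = 2 *\<^sub>R (defect x o\<^sub>L x) - defect x"
  by (rule blinfun_eqI) (simp add: newton_def defect_def blinfun_arith scaleR_as_sum)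

lemma defect_newton:
  "defect (newton x) = 3 *\<^sub>R (defect x o\<^sub>L defect x) + 4 *\<^sub>R (defect x o\<^sub>L (defect x o\<^sub>L defect x))"
  by (rule blinfun_eqI) (simp add: newton_def defect_def scaleR_as_sum blinfun_arith algebra_simps)

text \<open>
  The polynomial \<open>3x\<^sup>2 - 2x\<^sup>3\<close> has the fixed points \<open>0\<close> and \<open>1\<close>, both with vanishing derivative, so
  its iterates improve an almost projection \<open>x\<close> quadratically. They stay in every closed algebra \<open>A\<close> that
  contains \<open>x\<close>, and differ from \<open>x\<close> by elements of every closed right ideal \<open>J\<close> that contains \<open>x - x\<^sup>2\<close>. With
  \<open>\<kappa> \<le> 1/32\<close> the defect is at least halved in every step while the norms stay below \<open>2\<close>; so step \<open>j\<close> moves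
  the iterate by at most \<open>5\<kappa>/2\<^sup>j\<close>, and these bounds add up to \<open>10\<kappa>\<close>.
\<close>

lemma projection_near_almost_projection:
  fixes x :: "'e :: {complex_inner, banach} \<Rightarrow>\<^sub>L 'e"
  assumes sym: "\<And>\<xi> \<eta>. cinner (x \<xi>) \<eta> = cinner \<xi> (x \<eta>)"
    and norm: "norm x \<le> 1" "norm (defect x) \<le> \<kappa>" "\<kappa> \<le> 1 / 32"
    and A: "closed A" "x \<in> A" "\<And>a b. a \<in> A \<Longrightarrow> b \<in> A \<Longrightarrow> a + b \<in> A"
      "\<And>r a. a \<in> A \<Longrightarrow> r *\<^sub>R a \<in> A" "\<And>a b. a \<in> A \<Longrightarrow> b \<in> A \<Longrightarrow> a o\<^sub>L b \<in> A"
    and J: "closed J" "defect x \<in> J" "\<And>a b. a \<in> J \<Longrightarrow> b \<in> J \<Longrightarrow> a + b \<in> J"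
      "\<And>r a. a \<in> J \<Longrightarrow> r *\<^sub>R a \<in> J" "\<And>a b. a \<in> J \<Longrightarrow> a o\<^sub>L b \<in> J"
  shows "\<exists>q. projection_op q \<and> q \<in> A \<and> q - x \<in> J \<and> norm (q - x) \<le> 10 * \<kappa>"
proof -
  define X where "X j = (newton ^^ j) x" for j
  have X0: "X 0 = x" and XS: "X (Suc j) = newton (X j)" for j
    by (simp_all add: X_def)
  have diffA: "a - b \<in> A" if "a \<in> A" "b \<in> A" for a b
    using A(3)[OF that(1) A(4)[OF that(2), of "-1"]] by simp
  have diffJ: "a - b \<in> J" if "a \<in> J" "b \<in> J" for a b
    using J(3)[OF that(1) J(4)[OF that(2), of "-1"]] by simp
  have \<kappa>: "0 \<le> \<kappa>"
    using norm(2) norm_ge_zero order_trans by blast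
  have XA: "X j \<in> A" for j
    by (induction j) (simp_all add: X0 XS A newton_def diffA)
  have CJ: "defect (X j) \<in> J" for j
    by (induction j) (simp_all add: X0 XS J defect_newton)
  have XJ: "X j - x \<in> J" for j
  proof (induction j)
    case 0
    show ?case
      using J(4)[OF J(2), of 0] by (simp add: X0)
  next
    case (Suc j)
    have "X (Suc j) - X j \<in> J"
      unfolding XS newton_step by (intro diffJ J(4,5) CJ)
    from J(3)[OF this Suc] show ?case
      by simp
  qed
  have X_sym: "cinner ((X j) \<xi>) \<eta> = cinner \<xi> ((X j) \<eta>)" for j \<xi> \<eta>
  proof (induction j arbitrary: \<xi> \<eta>)
    case (Suc j)
    then show ?case
      by (simp add: XS newton_def blinfun_arith cinner_minus_left cinner_minus_right
          cinner_scaleR_left cinner_scaleR_right)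
  qed (simp add: X0 sym)
  have bounds: "norm (defect (X j)) \<le> \<kappa> * (1 / 2) ^ j \<and> norm (X j) \<le> 2 - (1 / 2) ^ j
    \<and> norm (X (Suc j) - X j) \<le> 5 * \<kappa> * (1 / 2) ^ j" for j
  proof -
    have step: "norm (X (Suc j) - X j) \<le> 5 * \<kappa> * (1 / 2) ^ j"
      if "norm (defect (X j)) \<le> \<kappa> * (1 / 2) ^ j" "norm (X j) \<le> 2 - (1 / 2) ^ j" for j
    proof -
      have two: "norm (X j) \<le> 2"
      proof -
        have "0 \<le> (1 / 2 :: real) ^ j"
          by simp
        with that(2) show ?thesis
          by linarith
      qed
      have "norm (X (Suc j) - X j) \<le> 2 * norm (defect (X j) o\<^sub>L X j) + norm (defect (X j))"
        unfolding XS newton_step by (rule order_trans[OF norm_triangle_ineq4]) simp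
      also have "\<dots> \<le> 2 * (norm (defect (X j)) * 2) + norm (defect (X j))"
        using order_trans[OF norm_blinfun_compose mult_left_mono[OF two norm_ge_zero],
            of "defect (X j)"] by simp
      also have "\<dots> \<le> 5 * \<kappa> * (1 / 2) ^ j"
        using that(1) by simp
      finally show ?thesis .
    qed
    have "norm (defect (X j)) \<le> \<kappa> * (1 / 2) ^ j \<and> norm (X j) \<le> 2 - (1 / 2) ^ j"
    proof (induction j)
      case 0
      show ?case
        using norm by (simp add: X0)
    next
      case (Suc j)
      define D where "D = defect (X j)"
      have D: "norm D \<le> \<kappa> * (1 / 2) ^ j" "norm D \<le> 1 / 32"
      proof -
        show "norm D \<le> \<kappa> * (1 / 2) ^ j"
          using Suc by (simp add: D_def)
        also have "\<dots> \<le> 1 / 32 * 1"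
          by (intro mult_mono norm power_le_one) auto
        finally show "norm D \<le> 1 / 32"
          by simp
      qed
      have D2: "norm (D o\<^sub>L D) \<le> norm D * (1 / 32)"
        by (rule order_trans[OF norm_blinfun_compose mult_left_mono]) (use D in auto)
      have D3: "norm (D o\<^sub>L (D o\<^sub>L D)) \<le> norm D * (1 / 32)"
      proof (rule order_trans[OF norm_blinfun_compose mult_left_mono])
        show "norm (D o\<^sub>L D) \<le> 1 / 32"
          using D2 D(2) by linarith
      qed simp
      have "norm (defect (X (Suc j))) \<le> 3 * norm (D o\<^sub>L D) + 4 * norm (D o\<^sub>L (D o\<^sub>L D))"
        unfolding XS defect_newton D_def[symmetric]
        by (rule order_trans[OF norm_triangle_ineq]) simp
      also have "\<dots> \<le> norm D / 2"
        using D2 D3 norm_ge_zero[of D] by linarith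
      also have "\<dots> \<le> \<kappa> * (1 / 2) ^ Suc j"
        using D(1) by simp
      finally have 1: "norm (defect (X (Suc j))) \<le> \<kappa> * (1 / 2) ^ Suc j" .
      have "norm (X (Suc j)) \<le> norm (X (Suc j) - X j) + norm (X j)"
        by (metis diff_add_cancel norm_triangle_ineq)
      also have "\<dots> \<le> 5 * \<kappa> * (1 / 2) ^ j + (2 - (1 / 2) ^ j)"
        using step[of j] Suc by (intro add_mono) auto
      also have "5 * \<kappa> * (1 / 2) ^ j \<le> 1 / 2 * (1 / 2) ^ j"
        using norm(3) by (intro mult_right_mono) auto
      finally show ?case
        using 1 by simp
    qed
    then show ?thesis
      using step by blast
  qed
  define D where "D j = X (Suc j) - X j" for j
  have geo: "(\<lambda>j. 5 * \<kappa> * (1 / 2) ^ j) sums (10 * \<kappa>)"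
    using sums_mult[OF geometric_sums[of "1 / 2 :: real"], of "5 * \<kappa>"] by simp
  have sum_norm: "summable (\<lambda>j. norm (D j))"
    by (rule summable_comparison_test[OF _ sums_summable[OF geo]]) (use bounds in \<open>simp add: D_def\<close>)
  then have "summable D"
    by (rule summable_norm_cancel)
  then have "(\<lambda>n. \<Sum>j<n. D j) \<longlonglongrightarrow> suminf D"
    by (rule summable_LIMSEQ)
  then have "(\<lambda>n. X n - x) \<longlonglongrightarrow> suminf D"
    unfolding D_def sum_lessThan_telescope X0 .
  define q where "q = x + suminf D"
  have lim: "X \<longlonglongrightarrow> q"
    using tendsto_add[OF tendsto_const[of x] \<open>(\<lambda>n. X n - x) \<longlonglongrightarrow> suminf D\<close>] by (simp add: q_def)
  have "norm (q - x) \<le> (\<Sum>j. norm (D j))"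
    unfolding q_def using summable_norm[OF sum_norm] by simp
  also have "\<dots> \<le> 10 * \<kappa>"
    using suminf_le[OF _ sum_norm sums_summable[OF geo]] bounds sums_unique[OF geo]
    by (simp add: D_def)
  finally have "norm (q - x) \<le> 10 * \<kappa>" .
  moreover have "q \<in> A"
    by (rule closed_sequentially[OF A(1) _ lim]) (use XA in blast)
  moreover have "q - x \<in> J"
    by (rule closed_sequentially[OF J(1) _ tendsto_diff[OF lim tendsto_const]]) (use XJ in blast)
  moreover have "projection_op q"
    unfolding projection_op_def
  proof (intro conjI allI)
    have "(\<lambda>j. defect (X j)) \<longlonglongrightarrow> defect q"
      unfolding defect_def
      by (intro tendsto_diff lim bounded_bilinear.tendsto[OF bounded_bilinear_blinfun_compose])
    moreover have "(\<lambda>j. defect (X j)) \<longlonglongrightarrow> 0"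
    proof (rule Lim_null_comparison)
      show "\<forall>\<^sub>F j in sequentially. norm (defect (X j)) \<le> \<kappa> * (1 / 2) ^ j"
        using bounds by simp
      show "(\<lambda>j. \<kappa> * (1 / 2) ^ j) \<longlonglongrightarrow> 0"
        by (intro tendsto_mult_right_zero LIMSEQ_power_zero) simp
    qed
    ultimately have "defect q = 0"
      by (rule LIMSEQ_unique)
    then show "q o\<^sub>L q = q"
      by (simp add: defect_def)
    fix \<xi> \<eta>
    have "(\<lambda>j. cinner ((X j) \<xi>) \<eta>) \<longlonglongrightarrow> cinner (q \<xi>) \<eta>"
      "(\<lambda>j. cinner \<xi> ((X j) \<eta>)) \<longlonglongrightarrow> cinner \<xi> (q \<eta>)"
      by (intro tendsto_cinner tendsto_const blinfun.tendsto lim)+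
    then show "cinner (q \<xi>) \<eta> = cinner \<xi> (q \<eta>)"
      unfolding X_sym by (rule LIMSEQ_unique)
  qed
  ultimately show ?thesis
    by blast
qed

section \<open>The stable Roe algebra\<close>

abbreviation op_span :: "hilb set \<Rightarrow> (hilb \<Rightarrow>\<^sub>L hilb) set"
  where "op_span B \<equiv> bounded_ops (complex_vector.span B)"

lemma bounded_ops_mono: "K \<subseteq> K' \<Longrightarrow> bounded_ops K \<subseteq> bounded_ops K'"
  unfolding bounded_ops_def by blast

lemma bounded_ops_add:
  "a \<in> bounded_ops K \<Longrightarrow> b \<in> bounded_ops K \<Longrightarrow> complex_vector.subspace K \<Longrightarrow> a + b \<in> bounded_ops K"
  unfolding bounded_ops_def
  by (auto simp: blinfun.add_left scaleC_add_right complex_vector.subspace_add image_subset_iff)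

lemma bounded_ops_scaleR:
  "a \<in> bounded_ops K \<Longrightarrow> complex_vector.subspace K \<Longrightarrow> r *\<^sub>R a \<in> bounded_ops K"
  unfolding bounded_ops_def
  by (auto simp: blinfun.scaleR_left scaleR_eq_scaleC scaleC_scaleC complex_vector.subspace_scale
      image_subset_iff mult.commute)

lemma bounded_ops_compose:
  "a \<in> bounded_ops K \<Longrightarrow> b \<in> bounded_ops K \<Longrightarrow> a o\<^sub>L b \<in> bounded_ops K"
  unfolding bounded_ops_def by (auto simp: image_subset_iff)

lemma bounded_ops_zero: "complex_vector.subspace K \<Longrightarrow> 0 \<in> bounded_ops K"
  unfolding bounded_ops_def by (auto simp: complex_vector.subspace_0)

lemma bounded_ops_sum:
  assumes "complex_vector.subspace K" "\<And>i. i \<in> I \<Longrightarrow> g i \<in> bounded_ops K"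
  shows "(\<Sum>i\<in>I. g i) \<in> bounded_ops K"
  using assms(2)
  by (induction I rule: infinite_finite_induct) (auto simp: bounded_ops_zero bounded_ops_add assms(1))

lemma subspace_l2_on: "complex_vector.subspace (l2_on X)"
  unfolding complex_vector.subspace_def l2_on_def
  by (auto simp: zero_l2.rep_eq plus_l2.rep_eq scaleC_l2.rep_eq)

lemma bounded_ops_l2_on_range:
  "a \<in> bounded_ops (l2_on X) \<Longrightarrow> y \<notin> X \<Longrightarrow> l2_apply (a \<xi>) y = 0"
  by (simp add: bounded_ops_def l2_on_def image_subset_iff)

text \<open>
  Vanishing on \<open>X\<close> is orthogonality to \<open>\<ell>\<^sub>2(X, H)\<close>.
\<close>

lemma bounded_ops_l2_on_kernel:
  assumes a: "a \<in> bounded_ops (l2_on X)" and \<xi>: "\<And>x. x \<in> X \<Longrightarrow> l2_apply \<xi> x = 0"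
  shows "a \<xi> = 0"
proof -
  have "cinner \<xi> \<eta> = 0" if "\<eta> \<in> l2_on X" for \<eta>
  proof (subst cinner_l2.rep_eq, rule infsum_0)
    fix x
    show "cinner (l2_apply \<xi> x) (l2_apply \<eta> x) = 0"
      using that \<xi>[of x] by (cases "x \<in> X") (auto simp: l2_on_def)
  qed
  then show ?thesis
    using a by (auto simp: bounded_ops_def)
qed

lemma entry_add: "entry (a + b) x y = entry a x y + entry b x y"
  by (rule blinfun_eqI) (simp add: entry_apply blinfun.add_left plus_l2.rep_eq)

lemma entry_scaleR: "entry (r *\<^sub>R a) x y = r *\<^sub>R entry a x y"
  by (rule blinfun_eqI) (simp add: entry_apply blinfun.scaleR_left scaleR_l2.rep_eq)

lemma entry_compose:
  assumes F: "finite F" and supp: "\<And>z. z \<notin> F \<Longrightarrow> entry b x z = 0"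
  shows "entry (a o\<^sub>L b) x y = (\<Sum>z\<in>F. entry a z y o\<^sub>L entry b x z)"
proof (rule blinfun_eqI)
  fix h
  have "b (l2_single x h) = (\<Sum>z\<in>F. l2_single z (l2_apply (b (l2_single x h)) z))"
    by (rule l2_finite_sum_singles[OF F]) (simp add: supp flip: entry_apply)
  then have "a (b (l2_single x h))
      = (\<Sum>z\<in>F. a (l2_single z (entry b x z h)))"
    by (metis (no_types, lifting) blinfun.sum_right entry_apply sum.cong)
  then show "entry (a o\<^sub>L b) x y h
      = (\<Sum>z\<in>F. entry a z y o\<^sub>L entry b x z) h"
    by (simp add: entry_apply l2_apply_sum blinfun.sum_left)
qed

lemma stable_Roe_algebraicI:
  assumes "a \<in> bounded_ops (l2_on X)"
    and "\<And>x y. x \<in> X \<Longrightarrow> y \<in> X \<Longrightarrow> r < d x y \<Longrightarrow> entry a x y = 0"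
    and "finite B" "\<And>x y. x \<in> X \<Longrightarrow> y \<in> X \<Longrightarrow> entry a x y \<in> op_span B"
  shows "a \<in> stable_Roe_algebraic X d"
proof -
  have "\<exists>r>0. \<forall>x\<in>X. \<forall>y\<in>X. r < d x y \<longrightarrow> entry a x y = 0"
    by (rule exI[of _ "max r 1"]) (use assms(2) in auto)
  then show ?thesis
    unfolding stable_Roe_algebraic_def using assms(1,3,4) by blast
qed

lemma stable_Roe_algebraicE:
  assumes "a \<in> stable_Roe_algebraic X d"
  obtains r B where "a \<in> bounded_ops (l2_on X)" "0 < r"
    "\<And>x y. x \<in> X \<Longrightarrow> y \<in> X \<Longrightarrow> r < d x y \<Longrightarrow> entry a x y = 0"
    "finite B" "\<And>x y. x \<in> X \<Longrightarrow> y \<in> X \<Longrightarrow> entry a x y \<in> op_span B"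
  using assms unfolding stable_Roe_algebraic_def by blast

lemma stable_Roe_algebraic_add:
  assumes "a \<in> stable_Roe_algebraic X d" "b \<in> stable_Roe_algebraic X d"
  shows "a + b \<in> stable_Roe_algebraic X d"
proof -
  obtain r B where a: "a \<in> bounded_ops (l2_on X)" "0 < r"
    "\<And>x y. x \<in> X \<Longrightarrow> y \<in> X \<Longrightarrow> r < d x y \<Longrightarrow> entry a x y = 0"
    "finite B" "\<And>x y. x \<in> X \<Longrightarrow> y \<in> X \<Longrightarrow> entry a x y \<in> op_span B"
    using assms(1) by (rule stable_Roe_algebraicE) blast
  obtain s C where b: "b \<in> bounded_ops (l2_on X)" "0 < s"
    "\<And>x y. x \<in> X \<Longrightarrow> y \<in> X \<Longrightarrow> s < d x y \<Longrightarrow> entry b x y = 0"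
    "finite C" "\<And>x y. x \<in> X \<Longrightarrow> y \<in> X \<Longrightarrow> entry b x y \<in> op_span C"
    using assms(2) by (rule stable_Roe_algebraicE) blast
  show ?thesis
  proof (rule stable_Roe_algebraicI[where r = "max r s" and B = "B \<union> C"])
    show "a + b \<in> bounded_ops (l2_on X)"
      by (rule bounded_ops_add[OF a(1) b(1) subspace_l2_on])
    show "finite (B \<union> C)"
      using a(4) b(4) by simp
    fix x y
    assume xy: "x \<in> X" "y \<in> X"
    show "entry (a + b) x y = 0" if "max r s < d x y"
      using a(3)[OF xy] b(3)[OF xy] that by (simp add: entry_add)
    show "entry (a + b) x y \<in> op_span (B \<union> C)"
      unfolding entry_add
      by (intro bounded_ops_add complex_vector.subspace_span
          set_mp[OF bounded_ops_mono[OF complex_vector.span_mono] a(5)[OF xy]]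
          set_mp[OF bounded_ops_mono[OF complex_vector.span_mono] b(5)[OF xy]]) auto
  qed
qed

lemma stable_Roe_algebraic_scaleR:
  assumes "a \<in> stable_Roe_algebraic X d"
  shows "r *\<^sub>R a \<in> stable_Roe_algebraic X d"
proof -
  obtain s B where a: "a \<in> bounded_ops (l2_on X)" "0 < s"
    "\<And>x y. x \<in> X \<Longrightarrow> y \<in> X \<Longrightarrow> s < d x y \<Longrightarrow> entry a x y = 0"
    "finite B" "\<And>x y. x \<in> X \<Longrightarrow> y \<in> X \<Longrightarrow> entry a x y \<in> op_span B"
    using assms(1) by (rule stable_Roe_algebraicE) blast
  show ?thesis
    by (rule stable_Roe_algebraicI[where r = s and B = B])
      (simp_all add: entry_scaleR a bounded_ops_scaleR subspace_l2_on)
qed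

text \<open>
  Local finiteness makes all sums in a matrix product finite, so the product of two operators of
  finite propagation is computed entrywise.
\<close>

lemma stable_Roe_algebraic_compose:
  assumes X: "Metric_space X d" and fin: "\<And>x r. x \<in> X \<Longrightarrow> finite {y \<in> X. d x y \<le> r}"
    and "a \<in> stable_Roe_algebraic X d" "b \<in> stable_Roe_algebraic X d"
  shows "a o\<^sub>L b \<in> stable_Roe_algebraic X d"
proof -
  obtain r B where a: "a \<in> bounded_ops (l2_on X)" "0 < r"
    "\<And>x y. x \<in> X \<Longrightarrow> y \<in> X \<Longrightarrow> r < d x y \<Longrightarrow> entry a x y = 0"
    "finite B" "\<And>x y. x \<in> X \<Longrightarrow> y \<in> X \<Longrightarrow> entry a x y \<in> op_span B"
    using assms(3) by (rule stable_Roe_algebraicE) blast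
  obtain s C where b: "b \<in> bounded_ops (l2_on X)" "0 < s"
    "\<And>x y. x \<in> X \<Longrightarrow> y \<in> X \<Longrightarrow> s < d x y \<Longrightarrow> entry b x y = 0"
    "finite C" "\<And>x y. x \<in> X \<Longrightarrow> y \<in> X \<Longrightarrow> entry b x y \<in> op_span C"
    using assms(4) by (rule stable_Roe_algebraicE) blast
  have comp: "entry (a o\<^sub>L b) x y = (\<Sum>z | z \<in> X \<and> d x z \<le> s. entry a z y o\<^sub>L entry b x z)"
    if "x \<in> X" for x y
  proof (rule entry_compose)
    show "finite {z \<in> X. d x z \<le> s}"
      by (rule fin[OF that])
    show "entry b x z = 0" if "z \<notin> {z \<in> X. d x z \<le> s}" for z
    proof (cases "z \<in> X")
      case True
      then show ?thesis
        using b(3)[OF \<open>x \<in> X\<close> True] that by simp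
    next
      case False
      then show ?thesis
        by (intro blinfun_eqI) (simp add: entry_apply bounded_ops_l2_on_range[OF b(1)])
    qed
  qed
  show ?thesis
  proof (rule stable_Roe_algebraicI[where r = "r + s" and B = "B \<union> C"])
    show "a o\<^sub>L b \<in> bounded_ops (l2_on X)"
      by (rule bounded_ops_compose[OF a(1) b(1)])
    show "finite (B \<union> C)"
      using a(4) b(4) by simp
    fix x y
    assume xy: "x \<in> X" "y \<in> X"
    show "entry (a o\<^sub>L b) x y = 0" if "r + s < d x y"
      unfolding comp[OF xy(1)]
    proof (rule sum.neutral, safe)
      fix z
      assume z: "z \<in> X" "d x z \<le> s"
      then have "r < d z y"
        using Metric_space.triangle[OF X xy(1) z(1) xy(2)] that by linarith
      then show "entry a z y o\<^sub>L entry b x z = 0"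
        using a(3)[OF z(1) xy(2)] by simp
    qed
    show "entry (a o\<^sub>L b) x y \<in> op_span (B \<union> C)"
      unfolding comp[OF xy(1)]
    proof (intro bounded_ops_sum bounded_ops_compose complex_vector.subspace_span)
      fix z
      assume "z \<in> {z \<in> X. d x z \<le> s}"
      then have z: "z \<in> X"
        by simp
      show "entry a z y \<in> op_span (B \<union> C)"
        by (rule set_mp[OF bounded_ops_mono[OF complex_vector.span_mono] a(5)[OF z xy(2)]]) auto
      show "entry b x z \<in> op_span (B \<union> C)"
        by (rule set_mp[OF bounded_ops_mono[OF complex_vector.span_mono] b(5)[OF xy(1) z]]) auto
    qed
  qed
qed

lemma stable_Roe_seq:
  assumes "a \<in> stable_Roe X d"
  obtains g where "\<And>n. g n \<in> stable_Roe_algebraic X d" "g \<longlonglongrightarrow> a"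
  using assms unfolding stable_Roe_def closure_sequential by auto

lemma stable_Roe_limit:
  assumes "\<And>n. g n \<in> stable_Roe_algebraic X d" "g \<longlonglongrightarrow> a"
  shows "a \<in> stable_Roe X d"
  unfolding stable_Roe_def closure_sequential by (intro exI[of _ g] conjI allI assms)

lemma stable_Roe_add:
  assumes "a \<in> stable_Roe X d" "b \<in> stable_Roe X d"
  shows "a + b \<in> stable_Roe X d"
proof -
  obtain g where g: "\<And>n. g n \<in> stable_Roe_algebraic X d" "g \<longlonglongrightarrow> a"
    using assms(1) by (rule stable_Roe_seq) blast
  obtain h where h: "\<And>n. h n \<in> stable_Roe_algebraic X d" "h \<longlonglongrightarrow> b"
    using assms(2) by (rule stable_Roe_seq) blast
  show ?thesis
    by (rule stable_Roe_limit[OF stable_Roe_algebraic_add[OF g(1) h(1)] tendsto_add[OF g(2) h(2)]])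
qed

lemma stable_Roe_scaleR:
  assumes "a \<in> stable_Roe X d"
  shows "r *\<^sub>R a \<in> stable_Roe X d"
proof -
  obtain g where g: "\<And>n. g n \<in> stable_Roe_algebraic X d" "g \<longlonglongrightarrow> a"
    using assms by (rule stable_Roe_seq) blast
  show ?thesis
    by (rule stable_Roe_limit[OF stable_Roe_algebraic_scaleR[OF g(1)] tendsto_scaleR[OF tendsto_const g(2)]])
qed

lemma stable_Roe_compose:
  assumes "Metric_space X d" "\<And>x r. x \<in> X \<Longrightarrow> finite {y \<in> X. d x y \<le> r}"
    and "a \<in> stable_Roe X d" "b \<in> stable_Roe X d"
  shows "a o\<^sub>L b \<in> stable_Roe X d"
proof -
  obtain g where g: "\<And>n. g n \<in> stable_Roe_algebraic X d" "g \<longlonglongrightarrow> a"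
    using assms(3) by (rule stable_Roe_seq) blast
  obtain h where h: "\<And>n. h n \<in> stable_Roe_algebraic X d" "h \<longlonglongrightarrow> b"
    using assms(4) by (rule stable_Roe_seq) blast
  show ?thesis
    by (rule stable_Roe_limit[OF stable_Roe_algebraic_compose[OF assms(1,2) g(1) h(1)]
          bounded_bilinear.tendsto[OF bounded_bilinear_blinfun_compose g(2) h(2)]])
qed

lemma stable_Roe_approx:
  assumes "p \<in> stable_Roe X d" "0 < e"
  obtains a where "a \<in> stable_Roe_algebraic X d" "norm (p - a) < e"
  using assms unfolding stable_Roe_def closure_approachable
  by (metis dist_commute dist_norm)

section \<open>Transport of the Roe algebra along a map\<close>

lemma entry_transport:
  assumes "fibre_maps S f N v w"
  shows "entry (l2_push S f v o\<^sub>L a o\<^sub>L l2_pull S f w) y y' h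
    = (\<Sum>x' | x' \<in> S \<and> f x' = y'. \<Sum>x | x \<in> S \<and> f x = y.
        v x' (entry a x x' (w x h)))"
proof -
  interpret fibre_maps S f N v w
    by (rule assms)
  show ?thesis
    by (simp add: entry_apply push_apply pull_single blinfun.sum_right l2_apply_sum) (rule sum.swap)
qed

text \<open>
  An entry of the transported operator is a sum of at most \<open>N\<^sup>2\<close> entries of \<open>a\<close>, each between two contractions. This is
  where the uniformity of the bound on the fibres is needed for ghosts.
\<close>

lemma norm_entry_transport:
  assumes maps: "fibre_maps S f N v w"
    and le: "\<And>x x'. x \<in> S \<Longrightarrow> f x = y \<Longrightarrow> x' \<in> S \<Longrightarrow> f x' = y' \<Longrightarrow> norm (entry a x x') \<le> e" and e: "0 \<le> e"
  shows "norm (entry (l2_push S f v o\<^sub>L a o\<^sub>L l2_pull S f w) y y') \<le> real N * (real N * e)"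
proof (rule norm_blinfun_bound)
  interpret fibre_maps S f N v w
    by (rule maps)
  fix h
  have card: "card {x. x \<in> S \<and> f x = y} \<le> N" for y
    using fibres(2)[of y] by simp
  have "norm (v x' (entry a x x' (w x h))) \<le> e * norm h"
    if "x \<in> S" "f x = y" "x' \<in> S" "f x' = y'" for x x'
    by (rule order_trans[OF norm_v order_trans[OF norm_blinfun mult_mono[OF le[OF that] norm_w e norm_ge_zero]]])
  then have "norm (entry (l2_push S f v o\<^sub>L a o\<^sub>L l2_pull S f w) y y' h)
      \<le> (\<Sum>x' | x' \<in> S \<and> f x' = y'. \<Sum>x | x \<in> S \<and> f x = y. e * norm h)"
    unfolding entry_transport[OF maps] by (intro sum_norm_le) auto
  also have "\<dots> = real (card {x. x \<in> S \<and> f x = y'}) * (real (card {x. x \<in> S \<and> f x = y}) * (e * norm h))"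
    by simp
  also have "\<dots> \<le> real N * (real N * (e * norm h))"
    by (intro mult_mono) (use card e in auto)
  finally show "norm (entry (l2_push S f v o\<^sub>L a o\<^sub>L l2_pull S f w) y y' h)
      \<le> real N * (real N * e) * norm h"
    by (simp add: mult.assoc)
qed (use e in simp)

text \<open>
  A coarse map turns a bound on the propagation into another one. The blocks of the new operator act on the
  span of the shifted copies of the finite set \<open>B\<close>, and this set stays finite because only finitely many
  shifts are in use.
\<close>

lemma transport_stable_Roe_algebraic:
  fixes i :: "'a \<Rightarrow> nat" and f :: "'a \<Rightarrow> 'b"
  assumes maps: "fibre_maps S f N (\<lambda>x. shift (i x) :: hilb \<Rightarrow>\<^sub>L hilb) (\<lambda>x. unshift (i x))"
    and S: "S \<subseteq> X" and i: "finite (i ` S)"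
    and coarse: "\<And>r. 0 < r \<Longrightarrow> \<exists>R. \<forall>x\<in>S. \<forall>x'\<in>S. d x x' \<le> r \<longrightarrow> d' (f x) (f x') \<le> R"
    and a: "a \<in> stable_Roe_algebraic X d"
  shows "l2_push S f (\<lambda>x. shift (i x)) o\<^sub>L a o\<^sub>L l2_pull S f (\<lambda>x. unshift (i x)) \<in> stable_Roe_algebraic (f ` S) d'"
    (is "?b \<in> _")
proof -
  interpret fibre_maps S f N "\<lambda>x. shift (i x) :: hilb \<Rightarrow>\<^sub>L hilb" "\<lambda>x. unshift (i x)"
    by (rule maps)
  obtain r B where ra: "a \<in> bounded_ops (l2_on X)" "0 < r"
    "\<And>x y. x \<in> X \<Longrightarrow> y \<in> X \<Longrightarrow> r < d x y \<Longrightarrow> entry a x y = 0"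
    "finite B" "\<And>x y. x \<in> X \<Longrightarrow> y \<in> X \<Longrightarrow> entry a x y \<in> op_span B"
    using a by (rule stable_Roe_algebraicE) blast
  obtain R where R: "\<And>x x'. x \<in> S \<Longrightarrow> x' \<in> S \<Longrightarrow> d x x' \<le> r \<Longrightarrow> d' (f x) (f x') \<le> R"
    using coarse[OF ra(2)] by blast
  define C where "C = (\<Union>k\<in>i ` S. blinfun_apply (shift k) ` B)"
  have shift_C: "shift (i x) s \<in> complex_vector.span C"
    if "x \<in> S" "s \<in> complex_vector.span B" for x s
    using that(2)
  proof (induction rule: complex_vector.span_induct_alt)
    case base
    show ?case
      by (simp add: complex_vector.span_zero)
  next
    case (step c b s)
    have "shift (i x) b \<in> complex_vector.span C"
      by (rule complex_vector.span_base) (use that(1) step in \<open>auto simp: C_def\<close>)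
    then show ?case
      using step by (simp add: blinfun.add_right adjoint_complex_linear[OF shift_adjoint]
          complex_vector.span_add complex_vector.span_scale)
  qed
  have lin: "blinfun_apply ?b (c *\<^sub>C \<xi>) = c *\<^sub>C blinfun_apply ?b \<xi>" for c \<xi>
    using ra(1) adjoint_complex_linear[OF adjoint_push] adjoint_complex_linear[OF adjoint_sym[OF adjoint_push]]
    by (simp add: bounded_ops_def)
  show ?thesis
  proof (rule stable_Roe_algebraicI[where r = R and B = C])
    show "?b \<in> bounded_ops (l2_on (f ` S))"
      unfolding bounded_ops_def
    proof (intro CollectI conjI allI impI subsetI)
      fix \<eta>
      assume "\<eta> \<in> range (blinfun_apply ?b)"
      then show "\<eta> \<in> l2_on (f ` S)"
        by (auto simp: l2_on_def push_apply intro!: sum.neutral)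
    next
      fix \<xi> :: "('b, hilb) l2"
      assume orth: "\<forall>\<eta>\<in>l2_on (f ` S). cinner \<xi> \<eta> = 0"
      have "l2_apply \<xi> y = 0" if "y \<in> f ` S" for y
      proof -
        have "l2_single y (l2_apply \<xi> y) \<in> l2_on (f ` S)"
          using that by (auto simp: l2_on_def l2_single.rep_eq)
        then have "cinner (l2_single y (l2_apply \<xi> y)) \<xi> = 0"
          using orth by (metis cinner_commute complex_cnj_zero)
        then show ?thesis
          by (simp add: cinner_l2_single cinner_self)
      qed
      then have "pull \<xi> = 0"
        by (intro l2_eqI) (simp add: pull_apply zero_l2.rep_eq)
      then show "blinfun_apply ?b \<xi> = 0"
        by simp
    qed (rule lin)
    show "finite C"
      unfolding C_def using i ra(4) by blast
    fix y y'
    assume "y \<in> f ` S" "y' \<in> f ` S"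
    show "entry ?b y y' = 0" if "R < d' y y'"
    proof (rule blinfun_eqI)
      fix h
      have "entry a x x' = 0" if "x \<in> S" "f x = y" "x' \<in> S" "f x' = y'" for x x'
        using R[of x x'] ra(3)[of x x'] S that \<open>R < d' y y'\<close> by force
      then show "(entry ?b y y') h = blinfun_apply 0 h"
        unfolding entry_transport[OF maps] by (auto intro!: sum.neutral)
    qed
    show "entry ?b y y' \<in> op_span C"
      unfolding bounded_ops_def
    proof (intro CollectI conjI allI impI subsetI)
      fix c and h :: hilb
      have "l2_single y (c *\<^sub>C h) = c *\<^sub>C l2_single y h"
        by (rule l2_eqI) (simp add: l2_single.rep_eq scaleC_l2.rep_eq)
      then show "(entry ?b y y') (c *\<^sub>C h) = c *\<^sub>C (entry ?b y y') h"
        unfolding entry_apply by (simp only: lin scaleC_l2.rep_eq)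
    next
      fix k
      assume "k \<in> range (blinfun_apply (entry ?b y y'))"
      then obtain h where k: "k = (entry ?b y y') h"
        by blast
      have "entry a x x' h' \<in> complex_vector.span B" if "x \<in> S" "x' \<in> S" for x x' h'
        using ra(5)[of x x'] S that unfolding bounded_ops_def by blast
      then show "k \<in> complex_vector.span C"
        unfolding k entry_transport[OF maps] by (auto intro!: complex_vector.span_sum shift_C)
    next
      fix h :: hilb
      assume orth: "\<forall>\<eta>\<in>complex_vector.span C. cinner h \<eta> = 0"
      have "entry a x x' (unshift (i x) h) = 0" if "x \<in> S" "x' \<in> S" for x x'
      proof -
        have "cinner (unshift (i x) h) s = 0" if "s \<in> complex_vector.span B" for s
          using orth shift_C[OF \<open>x \<in> S\<close> that] adjoint_sym[OF shift_adjoint] by metis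
        then show ?thesis
          using ra(5)[of x x'] S that unfolding bounded_ops_def by blast
      qed
      then show "(entry ?b y y') h = 0"
        unfolding entry_transport[OF maps] by (auto intro!: sum.neutral)
    qed
  qed
qed

lemma transport_stable_Roe:
  fixes i :: "'a \<Rightarrow> nat" and f :: "'a \<Rightarrow> 'b"
  assumes "fibre_maps S f N (\<lambda>x. shift (i x) :: hilb \<Rightarrow>\<^sub>L hilb) (\<lambda>x. unshift (i x))" "S \<subseteq> X" "finite (i ` S)"
    and "\<And>r. 0 < r \<Longrightarrow> \<exists>R. \<forall>x\<in>S. \<forall>x'\<in>S. d x x' \<le> r \<longrightarrow> d' (f x) (f x') \<le> R"
    and a: "a \<in> stable_Roe X d"
  shows "l2_push S f (\<lambda>x. shift (i x)) o\<^sub>L a o\<^sub>L l2_pull S f (\<lambda>x. unshift (i x)) \<in> stable_Roe (f ` S) d'"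
proof -
  obtain g where g: "\<And>n. g n \<in> stable_Roe_algebraic X d" "g \<longlonglongrightarrow> a"
    using a by (rule stable_Roe_seq) blast
  show ?thesis
  proof (rule stable_Roe_limit[where
        g = "\<lambda>n. l2_push S f (\<lambda>x. shift (i x)) o\<^sub>L g n o\<^sub>L l2_pull S f (\<lambda>x. unshift (i x))"])
    show "l2_push S f (\<lambda>x. shift (i x)) o\<^sub>L g n o\<^sub>L l2_pull S f (\<lambda>x. unshift (i x))
        \<in> stable_Roe_algebraic (f ` S) d'" for n
      by (rule transport_stable_Roe_algebraic[OF assms(1-3) _ g(1)]) (rule assms(4))
  qed (intro bounded_bilinear.tendsto[OF bounded_bilinear_blinfun_compose] tendsto_const g)
qed

section \<open>Operators in the Roe algebra of a sparse space\<close>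

text \<open>
  By density of finite sums, the row of \<open>a\<close> over \<open>y\<close> is determined by its entries even when infinitely many
  of them are nonzero.
\<close>

lemma apply_eq_zero_if_entries_zero:
  assumes a: "a \<in> bounded_ops (l2_on X)"
    and entry: "\<And>x. x \<in> X \<Longrightarrow> x \<notin> S \<Longrightarrow> entry a x y = 0"
    and \<xi>: "\<And>x. x \<in> S \<Longrightarrow> l2_apply \<xi> x = 0"
  shows "l2_apply (a \<xi>) y = 0"
proof (rule bounded_linear_zero_on_singles[where S = "- S" and T = "\<lambda>\<xi>. l2_apply (a \<xi>) y"])
  show "bounded_linear (\<lambda>\<xi>. l2_apply (a \<xi>) y)"
    by (rule bounded_linear_compose[OF bounded_linear_l2_apply blinfun.bounded_linear_right])
  fix x and h :: hilb
  assume "x \<in> - S"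
  show "l2_apply (a (l2_single x h)) y = 0"
  proof (cases "x \<in> X")
    case True
    then show ?thesis
      using entry[of x] \<open>x \<in> - S\<close> by (simp flip: entry_apply)
  next
    case False
    then have "a (l2_single x h) = 0"
      by (intro bounded_ops_l2_on_kernel[OF a]) (auto simp: l2_single.rep_eq)
    then show ?thesis
      by (simp add: zero_l2.rep_eq)
  qed
qed (use \<xi> in simp)

locale sparse_partition =
  fixes X :: "'a set" and d :: "'a \<Rightarrow> 'a \<Rightarrow> real" and P :: "nat \<Rightarrow> 'a set"
  assumes union: "(\<Union>n. P n) = X" and disjoint: "disjoint_family P" and finite_piece: "finite (P n)"
    and far: "\<exists>N. \<forall>m n. m \<noteq> n \<and> m + n \<ge> N \<longrightarrow> (\<forall>x\<in>P m. \<forall>y\<in>P n. r \<le> d x y)"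
begin

text \<open>
  An operator of propagation \<open>r\<close> cannot connect pieces that are further than \<open>r\<close> apart, so it is
  block diagonal outside finitely many pieces.
\<close>

lemma propagation_blocks:
  assumes a: "a \<in> bounded_ops (l2_on X)"
    and propagation: "\<And>x y. x \<in> X \<Longrightarrow> y \<in> X \<Longrightarrow> r < d x y \<Longrightarrow> entry a x y = 0"
  shows "\<exists>N. (\<forall>n\<ge>N. \<forall>y\<in>P n. \<forall>\<xi>. (\<forall>x\<in>P n. l2_apply \<xi> x = 0) \<longrightarrow> l2_apply (a \<xi>) y = 0)
    \<and> (\<forall>n\<ge>N. \<forall>y\<in>(\<Union>m<n. P m). \<forall>\<xi>. (\<forall>x\<in>(\<Union>m<n. P m). l2_apply \<xi> x = 0) \<longrightarrow>
        l2_apply (a \<xi>) y = 0)"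
proof -
  obtain N where N: "\<And>m n x y. m \<noteq> n \<Longrightarrow> m + n \<ge> N \<Longrightarrow> x \<in> P m \<Longrightarrow> y \<in> P n \<Longrightarrow> r + 1 \<le> d x y"
    using far[of "r + 1"] by blast
  have entry: "entry a x y = 0" if "m \<noteq> n" "m + n \<ge> N" "x \<in> P m" "y \<in> P n" for m n x y
    using propagation[of x y] N[OF that] that union by force
  show ?thesis
  proof (intro exI[of _ N] conjI allI impI ballI)
    fix n y and \<xi> :: "('a, hilb) l2"
    assume n: "N \<le> n" and y: "y \<in> P n" and \<xi>: "\<forall>x\<in>P n. l2_apply \<xi> x = 0"
    show "l2_apply (a \<xi>) y = 0"
    proof (rule apply_eq_zero_if_entries_zero[OF a, of "P n"])
      fix x
      assume "x \<in> X" "x \<notin> P n"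
      then obtain m where "x \<in> P m" "m \<noteq> n"
        using union by blast
      then show "entry a x y = 0"
        using entry y n by simp
    qed (use \<xi> in simp)
  next
    fix n y and \<xi> :: "('a, hilb) l2"
    assume n: "N \<le> n" and y: "y \<in> (\<Union>m<n. P m)" and \<xi>: "\<forall>x\<in>(\<Union>m<n. P m). l2_apply \<xi> x = 0"
    obtain k where k: "k < n" "y \<in> P k"
      using y by blast
    show "l2_apply (a \<xi>) y = 0"
    proof (rule apply_eq_zero_if_entries_zero[OF a, of "\<Union>m<n. P m"])
      fix x
      assume "x \<in> X" "x \<notin> (\<Union>m<n. P m)"
      then obtain m where "x \<in> P m" "n \<le> m"
        using union by (metis UN_iff lessThan_iff linorder_not_less)
      then show "entry a x y = 0"
        using entry[of m k x y] k n by simp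
    qed (use \<xi> in blast)
  qed
qed

text \<open>
  The approximants of finite propagation have no off-diagonal part over late pieces, so only the error of
  the approximation is left.
\<close>

lemma off_diagonal_small:
  assumes p: "p \<in> stable_Roe X d" and e: "0 < e"
  shows "\<exists>N. \<forall>n\<ge>N. \<forall>\<xi>. norm (corner (P n) (p (corner (- P n) \<xi>)))
    \<le> e * norm \<xi>"
proof -
  obtain a where a: "a \<in> stable_Roe_algebraic X d" and pa: "norm (p - a) < e"
    using p e by (rule stable_Roe_approx)
  obtain r B where ra: "a \<in> bounded_ops (l2_on X)" "0 < r"
    "\<And>x y. x \<in> X \<Longrightarrow> y \<in> X \<Longrightarrow> r < d x y \<Longrightarrow> entry a x y = 0"
    "finite B" "\<And>x y. x \<in> X \<Longrightarrow> y \<in> X \<Longrightarrow> entry a x y \<in> op_span B"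
    using a by (rule stable_Roe_algebraicE) blast
  obtain N where N: "\<forall>n\<ge>N. \<forall>y\<in>P n. \<forall>\<xi>. (\<forall>x\<in>P n. l2_apply \<xi> x = 0) \<longrightarrow> l2_apply (a \<xi>) y = 0"
    using propagation_blocks[OF ra(1,3)] by blast
  have "norm (corner (P n) (p (corner (- P n) \<xi>))) \<le> e * norm \<xi>"
    if n: "N \<le> n" for n \<xi>
  proof -
    define \<zeta> where "\<zeta> = corner (- P n) \<xi>"
    have "\<forall>x\<in>P n. l2_apply \<zeta> x = 0"
      by (simp add: \<zeta>_def corner_apply)
    then have "corner (P n) (p \<zeta>)
        = corner (P n) ((p - a) \<zeta>)"
      using N n by (intro l2_eqI) (simp add: corner_apply blinfun.diff_left minus_l2.rep_eq)
    also have "norm \<dots> \<le> norm (p - a) * norm \<zeta>"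
      by (rule order_trans[OF norm_corner norm_blinfun])
    also have "\<dots> \<le> e * norm \<xi>"
      using pa e by (intro mult_mono) (auto simp: \<zeta>_def norm_corner)
    finally show ?thesis
      by (simp add: \<zeta>_def)
  qed
  then show ?thesis
    by blast
qed

text \<open>
  If the rows over the pieces tend to zero, then the late diagonal blocks of an approximation of finite
  propagation are no larger than the error of the approximation, up to a constant, and cutting it down to finitely many pieces changes it by little.
\<close>

lemma compact_if_rows_tend_to_zero:
  assumes p: "p \<in> stable_Roe X d"
    and rows: "\<And>e. 0 < e \<Longrightarrow> \<exists>N. \<forall>n\<ge>N. \<forall>\<xi>. norm (corner (P n) (p \<xi>)) \<le> e * norm \<xi>"
  shows "compact_op p"
proof (rule compact_op_if_approximable)
  fix e :: real
  assume "0 < e"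
  then have e: "0 < e / 3"
    by simp
  obtain a where a: "a \<in> stable_Roe_algebraic X d" and pa: "norm (p - a) < e / 3"
    using p e by (rule stable_Roe_approx)
  obtain r B where ra: "a \<in> bounded_ops (l2_on X)" "0 < r"
    "\<And>x y. x \<in> X \<Longrightarrow> y \<in> X \<Longrightarrow> r < d x y \<Longrightarrow> entry a x y = 0"
    "finite B" "\<And>x y. x \<in> X \<Longrightarrow> y \<in> X \<Longrightarrow> entry a x y \<in> op_span B"
    using a by (rule stable_Roe_algebraicE) blast
  obtain N where N: "\<forall>n\<ge>N. \<forall>y\<in>P n. \<forall>\<xi>. (\<forall>x\<in>P n. l2_apply \<xi> x = 0) \<longrightarrow> l2_apply (a \<xi>) y = 0"
    "\<forall>n\<ge>N. \<forall>y\<in>(\<Union>m<n. P m). \<forall>\<xi>. (\<forall>x\<in>(\<Union>m<n. P m). l2_apply \<xi> x = 0) \<longrightarrow> l2_apply (a \<xi>) y = 0"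
    using propagation_blocks[OF ra(1,3)] by blast
  obtain M where M: "\<forall>n\<ge>M. \<forall>\<xi>. norm (corner (P n) (p \<xi>)) \<le> e / 3 * norm \<xi>"
    using rows[OF e] by blast
  \<comment> \<open>from piece \<open>K\<close> on, \<open>a\<close> is block diagonal and the rows of \<open>p\<close> are small\<close>
  define K where "K = max N M"
  define F where "F = (\<Union>m<K. P m)"
  define t where "t = corner F o\<^sub>L a o\<^sub>L corner F"
  have F: "finite F" "F \<subseteq> X"
    using finite_piece union by (auto simp: F_def)
  have "compact_op t"
  proof (rule compact_op_if_finite_rank[OF F(1) ra(4)])
    fix \<xi> :: "('a, hilb) l2" and y
    assume y: "y \<in> F"
    have "corner F \<xi> = (\<Sum>x\<in>F. l2_single x (l2_apply (corner F \<xi>) x))"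
      by (rule l2_finite_sum_singles[OF F(1)]) (simp add: corner_apply)
    then have "a (corner F \<xi>)
        = (\<Sum>x\<in>F. a (l2_single x (l2_apply (corner F \<xi>) x)))"
      by (metis (no_types, lifting) blinfun.sum_right sum.cong)
    moreover have "l2_apply (t \<xi>) y = l2_apply (a (corner F \<xi>)) y"
      using y by (simp add: t_def corner_apply)
    ultimately have "l2_apply (t \<xi>) y
        = (\<Sum>x\<in>F. (entry a x y) (l2_apply (corner F \<xi>) x))"
      by (simp only: l2_apply_sum entry_apply)
    moreover have "entry a x y h \<in> complex_vector.span B" if "x \<in> F" for x h
      using ra(5)[of x y] that y F(2) unfolding bounded_ops_def by blast
    ultimately show "l2_apply (t \<xi>) y \<in> complex_vector.span B"
      by (simp add: complex_vector.span_sum)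
  qed (simp add: t_def corner_apply)
  moreover have "norm (p - t) \<le> e"
  proof -
    have "norm (a - t) \<le> 2 * e / 3"
    proof (rule norm_blinfun_bound)
      fix \<xi>
      show "norm ((a - t) \<xi>) \<le> 2 * e / 3 * norm \<xi>"
      proof (rule norm_le_blockwise[OF disjoint])
        fix n
        show "norm (corner (P n) ((a - t) \<xi>))
          \<le> 2 * e / 3 * norm (corner (P n) \<xi>)"
        proof (cases "n < K")
          case True
          have "l2_apply ((a - t) \<xi>) y = 0" if "y \<in> P n" for y
          proof -
            have yF: "y \<in> F"
              using that True by (auto simp: F_def)
            have "l2_apply (a (\<xi> - corner F \<xi>)) y = 0"
              using N(2)[rule_format, of K y "\<xi> - corner F \<xi>"] yF
              by (simp add: F_def[symmetric] K_def[symmetric] corner_apply minus_l2.rep_eq) (simp add: K_def)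
            then show ?thesis
              using yF by (simp add: t_def blinfun.diff_left blinfun.diff_right minus_l2.rep_eq corner_apply)
          qed
          then have "corner (P n) ((a - t) \<xi>) = 0"
            by (intro l2_eqI) (simp add: corner_apply zero_l2.rep_eq)
          then show ?thesis
            using e by simp
        next
          case False
          define \<zeta> where "\<zeta> = corner (P n) \<xi>"
          have "l2_apply (a (\<xi> - \<zeta>)) y = 0" if "y \<in> P n" for y
            using N(1)[rule_format, of n y "\<xi> - \<zeta>"] False that
            by (simp add: \<zeta>_def corner_apply minus_l2.rep_eq K_def)
          moreover have "y \<notin> F" if "y \<in> P n" for y
          proof
            assume "y \<in> F"
            then obtain m where "m < K" "y \<in> P m"
              by (auto simp: F_def)
            then show False
              using False that disjoint_family_onD[OF disjoint, of m n] by auto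
          qed
          ultimately have "corner (P n) ((a - t) \<xi>)
              = corner (P n) (p \<zeta>) - corner (P n) ((p - a) \<zeta>)"
            by (intro l2_eqI) (simp add: t_def corner_apply blinfun.diff_left blinfun.diff_right
                minus_l2.rep_eq zero_l2.rep_eq)
          also have "norm \<dots> \<le> e / 3 * norm \<zeta> + norm (p - a) * norm \<zeta>"
            by (intro order_trans[OF norm_triangle_ineq4] add_mono order_trans[OF norm_corner norm_blinfun])
              (use M False in \<open>simp add: K_def\<close>)
          also have "\<dots> \<le> e / 3 * norm \<zeta> + e / 3 * norm \<zeta>"
            using pa by (intro add_left_mono mult_right_mono) auto
          finally show ?thesis
            by (simp add: \<zeta>_def)
        qed
      next
        fix x
        assume "x \<notin> (\<Union>n. P n)"
        then show "l2_apply ((a - t) \<xi>) x = 0"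
          using F(2) union by (auto simp: t_def blinfun.diff_left minus_l2.rep_eq corner_apply
              bounded_ops_l2_on_range[OF ra(1)])
      qed (use e in simp)
    qed (use e in simp)
    then show ?thesis
      using pa norm_triangle_ineq[of "p - a" "a - t"] by simp
  qed
  ultimately show "\<exists>t. compact_op t \<and> norm (p - t) \<le> e"
    by blast
qed

end

section \<open>Operators with small rows outside finite sets\<close>

text \<open>
  These operators form a closed right ideal. A perturbation by one of them changes the entries outside a
  finite set of rows only by little, so ghosts remain ghosts. Working with this ideal takes the place of an
  argument with compact perturbations.
\<close>

definition tail_small :: "'a set \<Rightarrow> (('a, 'h :: real_normed_vector) l2 \<Rightarrow>\<^sub>L ('a, 'h) l2) set"
  where "tail_small X =
    {t :: ('a, 'h) l2 \<Rightarrow>\<^sub>L ('a, 'h) l2. \<forall>e>0. \<exists>F. finite F \<and> F \<subseteq> X \<and> (\<forall>\<xi>. norm (corner (- F) (t \<xi>)) \<le> e * norm \<xi>)}"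

lemma tail_smallE:
  assumes "t \<in> tail_small X" "0 < e"
  obtains F where "finite F" "F \<subseteq> X"
    "\<And>\<xi>. norm (corner (- F) (t \<xi>)) \<le> e * norm \<xi>"
  using assms unfolding tail_small_def by blast

lemma tail_small_add:
  assumes "s \<in> tail_small X" "t \<in> tail_small X"
  shows "s + t \<in> tail_small X"
  unfolding tail_small_def
proof (intro CollectI allI impI)
  fix e :: real
  assume "0 < e"
  then have e: "0 < e / 2"
    by simp
  obtain F where F: "finite F" "F \<subseteq> X"
    "\<And>\<xi>. norm (corner (- F) (s \<xi>)) \<le> e / 2 * norm \<xi>"
    using assms(1) e by (rule tail_smallE) blast
  obtain G where G: "finite G" "G \<subseteq> X"
    "\<And>\<xi>. norm (corner (- G) (t \<xi>)) \<le> e / 2 * norm \<xi>"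
    using assms(2) e by (rule tail_smallE) blast
  have "norm (corner (- (F \<union> G)) ((s + t) \<xi>)) \<le> e * norm \<xi>" for \<xi>
  proof -
    have "norm (corner (- (F \<union> G)) ((s + t) \<xi>))
      \<le> norm (corner (- F) (s \<xi>)) + norm (corner (- G) (t \<xi>))"
      unfolding blinfun.add_left blinfun.add_right
      by (intro order_trans[OF norm_triangle_ineq] add_mono norm_corner_mono) auto
    also have "\<dots> \<le> e / 2 * norm \<xi> + e / 2 * norm \<xi>"
      by (intro add_mono F G)
    finally show ?thesis
      by simp
  qed
  then show "\<exists>F. finite F \<and> F \<subseteq> X \<and> (\<forall>\<xi>. norm (corner (- F) ((s + t) \<xi>)) \<le> e * norm \<xi>)"
    using F G by (intro exI[of _ "F \<union> G"]) simp
qed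

lemma tail_small_compose:
  assumes "t \<in> tail_small X"
  shows "t o\<^sub>L s \<in> tail_small X"
  unfolding tail_small_def
proof (intro CollectI allI impI)
  fix e :: real
  assume e: "0 < e"
  then have "0 < e / (norm s + 1)"
    by (simp add: add_nonneg_pos)
  with assms obtain F where F: "finite F" "F \<subseteq> X"
    "\<And>\<xi>. norm (corner (- F) (t \<xi>)) \<le> e / (norm s + 1) * norm \<xi>"
    by (rule tail_smallE) blast
  have "norm (corner (- F) ((t o\<^sub>L s) \<xi>)) \<le> e * norm \<xi>" for \<xi>
  proof -
    have "norm (s \<xi>) \<le> (norm s + 1) * norm \<xi>"
      by (rule order_trans[OF norm_blinfun]) (simp add: mult_right_mono)
    then have "e / (norm s + 1) * norm (s \<xi>) \<le> e / (norm s + 1) * ((norm s + 1) * norm \<xi>)"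
      using e by (intro mult_left_mono) (auto simp: add_nonneg_pos)
    also have "\<dots> = e * norm \<xi>"
      using norm_ge_zero[of s] by (simp add: add_nonneg_eq_0_iff)
    finally show ?thesis
      using F(3)[of "s \<xi>"] by simp
  qed
  then show "\<exists>F. finite F \<and> F \<subseteq> X \<and> (\<forall>\<xi>. norm (corner (- F) ((t o\<^sub>L s) \<xi>)) \<le> e * norm \<xi>)"
    using F by (intro exI[of _ F]) simp
qed

lemma tail_small_scaleR:
  assumes "t \<in> tail_small X"
  shows "r *\<^sub>R t \<in> tail_small X"
proof -
  have "r *\<^sub>R t = t o\<^sub>L (r *\<^sub>R id_blinfun)"
    by (rule blinfun_eqI) (simp add: blinfun.scaleR_left blinfun.scaleR_right)
  then show ?thesis
    using tail_small_compose[OF assms] by simp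
qed

lemma closed_tail_small: "closed (tail_small X)"
  unfolding closed_limpt islimpt_approachable
proof (intro allI impI)
  fix t :: "('a, 'b) l2 \<Rightarrow>\<^sub>L ('a, 'b) l2"
  assume lim: "\<forall>e>0. \<exists>s\<in>tail_small X. s \<noteq> t \<and> dist s t < e"
  show "t \<in> tail_small X"
    unfolding tail_small_def
  proof (intro CollectI allI impI)
    fix e :: real
    assume "0 < e"
    then have e: "0 < e / 2"
      by simp
    then obtain s where s: "s \<in> tail_small X" "norm (t - s) < e / 2"
      using lim by (metis dist_norm norm_minus_commute)
    obtain F where F: "finite F" "F \<subseteq> X"
      "\<And>\<xi>. norm (corner (- F) (s \<xi>)) \<le> e / 2 * norm \<xi>"
      using s(1) e by (rule tail_smallE) blast
    have "norm (corner (- F) (t \<xi>)) \<le> e * norm \<xi>" for \<xi>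
    proof -
      have "corner (- F) (t \<xi>)
          = corner (- F) (s \<xi>) + corner (- F) ((t - s) \<xi>)"
        by (simp add: blinfun.diff_left blinfun.diff_right)
      also have "norm \<dots> \<le> e / 2 * norm \<xi> + norm (t - s) * norm \<xi>"
        by (intro order_trans[OF norm_triangle_ineq] add_mono F order_trans[OF norm_corner norm_blinfun])
      also have "\<dots> \<le> e / 2 * norm \<xi> + e / 2 * norm \<xi>"
        using s(2) by (intro add_left_mono mult_right_mono) auto
      finally show ?thesis
        by simp
    qed
    then show "\<exists>F. finite F \<and> F \<subseteq> X \<and> (\<forall>\<xi>. norm (corner (- F) (t \<xi>)) \<le> e * norm \<xi>)"
      using F by (intro exI[of _ F]) simp
  qed
qed

section \<open>Moving a projection along a map\<close>

lemma projection_contraction: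
  assumes "projection_op p"
  shows "norm (p \<xi>) \<le> norm \<xi>"
proof -
  have p: "p (p \<xi>) = p \<xi>" for \<xi>
    using assms by (metis blinfun_apply_blinfun_compose projection_op_def)
  have "norm (p \<xi>) * norm (p \<xi>) = cmod (cinner (p \<xi>) (p \<xi>))"
    by (simp add: cinner_self norm_mult power2_eq_square)
  also have "\<dots> = cmod (cinner \<xi> (p \<xi>))"
    using assms p by (simp add: projection_op_def)
  also have "\<dots> \<le> norm \<xi> * norm (p \<xi>)"
    by (rule cauchy_schwarz)
  finally show ?thesis
    by (cases "p \<xi> = 0") auto
qed

text \<open>
  The pieces \<open>Q k\<close> are chosen from a sparse space so that the projection \<open>p\<close> almost leaves each of them
  invariant, with summable errors. The map \<open>push\<close> is isometric over their union, so conjugation with it turns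
  \<open>p\<close>, cut down to the union, into an almost projection \<open>b\<close> over the images of the pieces.
\<close>

locale transported_projection =
  fibre_isometry "\<Union>k. Q k" f N v w
  for Q :: "nat \<Rightarrow> 'a set" and f :: "'a \<Rightarrow> 'b" and N :: nat
    and v w :: "'a \<Rightarrow> 'h :: complex_inner \<Rightarrow>\<^sub>L 'h" +
  fixes p :: "('a, 'h) l2 \<Rightarrow>\<^sub>L ('a, 'h) l2" and \<delta> :: real
  assumes p: "projection_op p" and finite_Q: "finite (Q k)" and \<delta>: "0 < \<delta>"
    and off_diagonal: "norm (corner (Q k) (p (corner (- Q k) \<xi>)))
      \<le> \<delta> * (1 / 2) ^ k * norm \<xi>"
begin

definition b :: "('b, 'h) l2 \<Rightarrow>\<^sub>L ('b, 'h) l2"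
  where "b = push o\<^sub>L p o\<^sub>L pull"

lemma b_symmetric: "cinner (b \<xi>) \<eta> = cinner \<xi> (b \<eta>)"
  using p by (simp add: b_def adjoint_push adjoint_sym[OF adjoint_push] projection_op_def)

lemma norm_b: "norm b \<le> 1"
proof (rule norm_blinfun_bound)
  show "norm (b \<xi>) \<le> 1 * norm \<xi>" for \<xi>
    using norm_push[of "p (pull \<xi>)"] projection_contraction[OF p, of "pull \<xi>"]
      norm_pull[of \<xi>] by (simp add: b_def)
qed simp

lemma pull_push: "pull (push \<xi>) = corner (\<Union>k. Q k) \<xi>"
  by (rule l2_eqI) (simp add: pull_push_apply corner_apply)

text \<open>The defect of \<open>b\<close> comes from the part of \<open>p\<close> that leaves the chosen pieces.\<close>

lemma defect_b: "defect b \<xi>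
    = push (p (corner (- (\<Union>k. Q k)) (p (pull \<xi>))))"
proof -
  define \<theta> where "\<theta> = p (pull \<xi>)"
  have "p \<theta> = \<theta>"
    using p unfolding \<theta>_def by (metis blinfun_apply_blinfun_compose projection_op_def)
  moreover have "\<theta> - corner (\<Union>k. Q k) \<theta> = corner (- (\<Union>k. Q k)) \<theta>"
    using corner_compl[of "\<Union>k. Q k" \<theta>] by (metis add_diff_cancel_left')
  ultimately have "\<theta> - p (corner (\<Union>k. Q k) \<theta>)
      = p (corner (- (\<Union>k. Q k)) \<theta>)"
    by (metis blinfun.diff_right)
  then show ?thesis
    by (simp add: defect_def b_def blinfun.diff_left pull_push \<theta>_def flip: blinfun.diff_right)
qed

text \<open>
  Outside the images of the first \<open>k\<close> pieces only the later pieces contribute, and their errors form the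
  tail of a geometric series.
\<close>

lemma defect_b_tail:
  "norm (corner (- f ` (\<Union>j<k. Q j)) (defect b \<xi>)) \<le> 2 * \<delta> * (1 / 2) ^ k * norm \<xi>"
proof -
  define \<theta> where "\<theta> = p (pull \<xi>)"
  define \<zeta> where "\<zeta> = p (corner (- (\<Union>k. Q k)) \<theta>)"
  define T where "T = (\<Union>j. Q (j + k))"
  have \<theta>: "norm \<theta> \<le> norm \<xi>"
    unfolding \<theta>_def by (rule order_trans[OF projection_contraction[OF p] norm_pull])
  have in_T: "x \<in> T" if x: "x \<in> (\<Union>k. Q k)" "f x \<notin> f ` (\<Union>j<k. Q j)" for x
  proof -
    obtain m where m: "x \<in> Q m"
      using x(1) by blast
    then have "k \<le> m"
      using x(2) by (metis UN_I imageI lessThan_iff linorder_not_less)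
    then show ?thesis
      using m unfolding T_def by (metis UNIV_I UN_I le_add_diff_inverse2)
  qed
  have "corner (- f ` (\<Union>j<k. Q j)) (push \<zeta>)
      = corner (- f ` (\<Union>j<k. Q j)) (push (corner T \<zeta>))"
  proof (rule l2_eqI)
    fix y
    have "l2_apply (push \<zeta>) y = l2_apply (push (corner T \<zeta>)) y"
      if "y \<notin> f ` (\<Union>j<k. Q j)"
      unfolding push_apply by (rule sum.cong[OF refl]) (use in_T that in \<open>auto simp: corner_apply\<close>)
    then show "l2_apply (corner (- f ` (\<Union>j<k. Q j)) (push \<zeta>)) y
      = l2_apply (corner (- f ` (\<Union>j<k. Q j)) (push (corner T \<zeta>))) y"
      by (simp add: corner_apply)
  qed
  then have "norm (corner (- f ` (\<Union>j<k. Q j)) (defect b \<xi>))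
      \<le> norm (corner T \<zeta>)"
    unfolding defect_b \<theta>_def[symmetric] \<zeta>_def[symmetric]
    using order_trans[OF norm_corner norm_push] by metis
  also have "\<dots> \<le> (\<Sum>j. \<delta> * norm \<theta> * (1 / 2) ^ k * (1 / 2) ^ j)"
    unfolding T_def
  proof (rule norm_corner_UN_le_suminf)
    fix j
    have "corner (- (\<Union>k. Q k)) \<theta>
        = corner (- Q (j + k)) (corner (- (\<Union>k. Q k)) \<theta>)"
      by (rule l2_eqI) (auto simp: corner_apply)
    then have "norm (corner (Q (j + k)) \<zeta>)
        \<le> \<delta> * (1 / 2) ^ (j + k) * norm (corner (- (\<Union>k. Q k)) \<theta>)"
      unfolding \<zeta>_def using off_diagonal by metis
    also have "\<dots> \<le> \<delta> * (1 / 2) ^ (j + k) * norm \<theta>"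
      using \<delta> by (intro mult_left_mono norm_corner) auto
    finally show "norm (corner (Q (j + k)) \<zeta>) \<le> \<delta> * norm \<theta> * (1 / 2) ^ k * (1 / 2) ^ j"
      by (simp add: power_add mult_ac)
  qed (intro summable_mult summable_geometric, simp)
  also have "\<dots> = 2 * \<delta> * (1 / 2) ^ k * norm \<theta>"
    by (subst suminf_mult) (simp_all add: suminf_geometric summable_geometric)
  also have "\<dots> \<le> 2 * \<delta> * (1 / 2) ^ k * norm \<xi>"
    using \<delta> \<theta> by (intro mult_left_mono) auto
  finally show ?thesis .
qed

lemma norm_defect_b: "norm (defect b) \<le> 2 * \<delta>"
proof (rule norm_blinfun_bound)
  show "norm (defect b \<xi>) \<le> 2 * \<delta> * norm \<xi>" for \<xi>
    using defect_b_tail[of 0 \<xi>] corner_id[of UNIV "defect b \<xi>"] by simp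
qed (use \<delta> in simp)

lemma defect_b_tail_small: "defect b \<in> tail_small (f ` (\<Union>k. Q k))"
  unfolding tail_small_def
proof (intro CollectI allI impI)
  fix e :: real
  assume e: "0 < e"
  obtain k where "(1 / 2) ^ k < e / (2 * \<delta>)"
    using real_arch_pow_inv[of "e / (2 * \<delta>)" "1 / 2"] e \<delta> by auto
  then have k: "2 * \<delta> * (1 / 2) ^ k \<le> e"
    using \<delta> by (simp add: field_simps)
  show "\<exists>F. finite F \<and> F \<subseteq> f ` (\<Union>k. Q k) \<and>
      (\<forall>\<xi>. norm (corner (- F) (defect b \<xi>)) \<le> e * norm \<xi>)"
  proof (intro exI[of _ "f ` (\<Union>j<k. Q j)"] conjI allI)
    show "norm (corner (- f ` (\<Union>j<k. Q j)) (defect b \<xi>)) \<le> e * norm \<xi>" for \<xi>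
      by (rule order_trans[OF defect_b_tail mult_right_mono[OF k norm_ge_zero]])
  qed (use finite_Q in auto)
qed

lemma norm_b_push:
  assumes "\<And>x. x \<notin> Q k \<Longrightarrow> l2_apply u x = 0"
  shows "norm (corner (Q k) (p u)) \<le> norm (b (push u))"
proof -
  have "corner (\<Union>k. Q k) u = u"
    by (rule corner_id) (use assms in auto)
  then have "b (push u) = push (p u)"
    by (simp add: b_def pull_push)
  moreover have "norm (corner (Q k) (p u))
      \<le> norm (corner (\<Union>k. Q k) (p u))"
    by (rule norm_corner_mono) auto
  moreover have "\<dots> \<le> norm (push (p u))"
    using norm_pull[of "push (p u)"] by (simp add: pull_push)
  ultimately show ?thesis
    by simp
qed

text \<open>
  Since \<open>b\<close> is large on every piece and \<open>q\<close> is close to \<open>b\<close>, the projection \<open>q\<close> is bounded below on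
  a sequence in the unit ball that tends weakly to zero.
\<close>

lemma not_compact_near_b:
  assumes q: "projection_op q" and near: "norm (q - b) \<le> 20 * \<delta>"
    and large: "\<And>k. \<exists>\<xi>. 100 * \<delta> * norm \<xi> < norm (corner (Q k) (p \<xi>))"
    and disj: "disjoint_family (\<lambda>k. f ` Q k)"
  shows "\<not> compact_op q"
proof
  assume compact: "compact_op q"
  have "\<exists>u. (\<forall>x. x \<notin> Q k \<longrightarrow> l2_apply u x = 0) \<and> norm u \<le> 1 \<and>
      99 * \<delta> \<le> norm (corner (Q k) (p u))" for k
  proof -
    obtain \<xi> where \<xi>: "100 * \<delta> * norm \<xi> < norm (corner (Q k) (p \<xi>))"
      using large by blast
    define \<zeta> where "\<zeta> = corner (Q k) \<xi>"
    have "corner (Q k) (p \<xi>) = corner (Q k) (p \<zeta>)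
        + corner (Q k) (p (corner (- Q k) \<xi>))"
      unfolding \<zeta>_def by (simp add: corner_compl flip: blinfun.add_right)
    then have "norm (corner (Q k) (p \<xi>))
        \<le> norm (corner (Q k) (p \<zeta>)) + \<delta> * (1 / 2) ^ k * norm \<xi>"
      by (simp only:) (rule order_trans[OF norm_triangle_ineq add_left_mono[OF off_diagonal]])
    also have "\<delta> * (1 / 2) ^ k * norm \<xi> \<le> \<delta> * 1 * norm \<xi>"
      using \<delta> by (intro mult_right_mono mult_left_mono power_le_one) auto
    finally have "99 * \<delta> * norm \<xi> < norm (corner (Q k) (p \<zeta>))"
      using \<xi> by simp
    moreover have "99 * \<delta> * norm \<zeta> \<le> 99 * \<delta> * norm \<xi>"
      using \<delta> by (intro mult_left_mono) (auto simp: \<zeta>_def norm_corner)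
    ultimately have large: "99 * \<delta> * norm \<zeta> < norm (corner (Q k) (p \<zeta>))"
      by linarith
    then have "\<zeta> \<noteq> 0"
      by (auto simp: blinfun.zero_right)
    define u where "u = inverse (norm \<zeta>) *\<^sub>R \<zeta>"
    have "norm (corner (Q k) (p u))
        = inverse (norm \<zeta>) * norm (corner (Q k) (p \<zeta>))"
      by (simp add: u_def blinfun.scaleR_right)
    also have "99 * \<delta> \<le> \<dots>"
      using large \<open>\<zeta> \<noteq> 0\<close> by (simp add: field_simps)
    finally show ?thesis
      using \<open>\<zeta> \<noteq> 0\<close> by (intro exI[of _ u]) (simp add: u_def \<zeta>_def scaleR_l2.rep_eq corner_apply)
  qed
  then obtain u where u: "\<And>k x. x \<notin> Q k \<Longrightarrow> l2_apply (u k) x = 0" "\<And>k. norm (u k) \<le> 1"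
    "\<And>k. 99 * \<delta> \<le> norm (corner (Q k) (p (u k)))"
    by metis
  define \<eta> where "\<eta> k = push (u k)" for k
  have \<eta>: "norm (\<eta> k) \<le> 1" for k
    using norm_push[of "u k"] u(2)[of k] by (simp add: \<eta>_def)
  show False
  proof (rule compact_projection_weakly_null[OF compact q _ \<eta>])
    show "0 < 79 * \<delta>"
      using \<delta> by simp
    show "79 * \<delta> \<le> norm (q (\<eta> k))" for k
    proof -
      have "norm ((q - b) (\<eta> k)) \<le> 20 * \<delta> * 1"
        by (rule order_trans[OF norm_blinfun mult_mono[OF near \<eta>]]) (use \<delta> in auto)
      moreover have "99 * \<delta> \<le> norm (b (\<eta> k))"
        unfolding \<eta>_def by (rule order_trans[OF u(3) norm_b_push]) (rule u(1))
      moreover have "norm (b (\<eta> k)) \<le> norm (q (\<eta> k)) + norm ((q - b) (\<eta> k))"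
        unfolding blinfun.diff_left by (metis norm_minus_commute norm_triangle_sub)
      ultimately show ?thesis
        by linarith
    qed
    show "(\<lambda>k. cinner (\<eta> k) \<zeta>) \<longlonglongrightarrow> 0" for \<zeta>
    proof (rule disjoint_supports_weakly_null[OF disj _ \<eta>])
      show "l2_apply (\<eta> k) y = 0" if "y \<notin> f ` Q k" for k y
        unfolding \<eta>_def push_apply
      proof (rule sum.neutral, rule ballI)
        fix x
        assume "x \<in> {x \<in> \<Union>k. Q k. f x = y}"
        then have "x \<notin> Q k"
          using that by auto
        then show "v x (l2_apply (u k) x) = 0"
          by (simp add: u(1) blinfun.zero_right)
      qed
    qed
  qed
qed

end

lemma ghost_if_tail_small_perturbation:
  assumes X: "Metric_space X d" and q: "q \<in> stable_Roe X d" and diff: "q - b \<in> tail_small X"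
    and b: "\<And>e. 0 < e \<Longrightarrow> \<exists>A. Metric_space.mbounded X d A \<and> (\<forall>x\<in>X - A. \<forall>y\<in>X - A. norm (entry b x y) < e)"
  shows "ghost X d q"
  unfolding ghost_def
proof (intro conjI allI impI q)
  interpret Metric_space X d
    by (rule X)
  fix e :: real
  assume "0 < e"
  then have e: "0 < e / 2"
    by simp
  obtain A where A: "mbounded A" "\<forall>x\<in>X - A. \<forall>y\<in>X - A. norm (entry b x y) < e / 2"
    using b[OF e] by blast
  obtain F where F: "finite F" "F \<subseteq> X"
    "\<And>\<xi>. norm (corner (- F) ((q - b) \<xi>)) \<le> e / 2 * norm \<xi>"
    using diff e by (rule tail_smallE) blast
  have "mbounded F"
    using F(1,2) by (induction F rule: finite_induct) (auto simp: mbounded_insert)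
  then have "mbounded (A \<union> F)"
    using A(1) by (simp add: mbounded_Un)
  moreover have "norm (entry q x y) < e" if "x \<in> X - (A \<union> F)" "y \<in> X - (A \<union> F)" for x y
  proof -
    have "norm (entry (q - b) x y) \<le> e / 2"
    proof (rule norm_blinfun_bound)
      fix h
      have "entry (q - b) x y h
          = l2_apply (corner (- F) ((q - b) (l2_single x h))) y"
        using that by (simp add: entry_apply corner_apply)
      also have "norm \<dots> \<le> e / 2 * norm (l2_single x h)"
        by (rule order_trans[OF norm_l2_apply_le F(3)])
      finally show "norm (entry (q - b) x y h) \<le> e / 2 * norm h"
        by (simp add: norm_l2_single)
    qed (use e in simp)
    moreover have "entry q x y = entry b x y + entry (q - b) x y"
      by (simp flip: entry_add)
    moreover have "norm (entry b x y) < e / 2"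
      using A(2) that by blast
    ultimately show ?thesis
      using norm_triangle_ineq[of "entry b x y" "entry (q - b) x y"] by simp
  qed
  ultimately show "\<exists>A. mbounded A \<and> (\<forall>x\<in>X - A. \<forall>y\<in>X - A. norm (entry q x y) < e)"
    by blast
qed

section \<open>Choice of the pieces\<close>

text \<open>
  The points of every fibre are numbered; the numbers select the orthogonal copies of \<open>H\<close>.
\<close>

lemma fibre_index:
  assumes "\<And>y. finite {x \<in> X. f x = y}" "\<And>y. card {x \<in> X. f x = y} \<le> N"
  shows "\<exists>i :: 'a \<Rightarrow> nat. (\<forall>x\<in>X. i x < N) \<and> (\<forall>x\<in>X. \<forall>x'\<in>X. f x = f x' \<longrightarrow> i x = i x' \<longrightarrow> x = x')"
proof -
  have "\<forall>y. \<exists>g. bij_betw g {x \<in> X. f x = y} {0..<card {x \<in> X. f x = y}}"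
    using assms(1) by (simp add: ex_bij_betw_finite_nat)
  then obtain g where g: "\<And>y. bij_betw (g y) {x \<in> X. f x = y} {0..<card {x \<in> X. f x = y}}"
    by metis
  show ?thesis
  proof (intro exI[of _ "\<lambda>x. g (f x) x"] conjI ballI impI)
    fix x
    assume x: "x \<in> X"
    then have "g (f x) x \<in> {0..<card {x' \<in> X. f x' = f x}}"
      using bij_betwE[OF g[of "f x"]] by blast
    then show "g (f x) x < N"
      using assms(2)[of "f x"] by simp
    fix x'
    assume "x' \<in> X" "f x = f x'" "g (f x) x = g (f x') x'"
    then show "x = x'"
      using bij_betw_imp_inj_on[OF g[of "f x"]] x by (auto simp: inj_on_def)
  qed
qed

text \<open>
  Here \<open>D\<close> is the distance of the images under a map, \<open>E k\<close> a property of all late pieces and \<open>L\<close> one of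
  infinitely many. The points with an image close to the images of the pieces chosen so far form a finite
  set, which only finitely many of the disjoint pieces meet; so every choice leaves room for the next.
\<close>

lemma separated_pieces:
  fixes P :: "nat \<Rightarrow> 'a set" and D :: "'a \<Rightarrow> 'a \<Rightarrow> real"
  assumes disj: "disjoint_family P" and fin: "\<And>n. finite (P n)"
    and balls: "\<And>n x' r. x' \<in> P n \<Longrightarrow> finite {x \<in> (\<Union>n. P n). D x x' \<le> r}"
    and ev: "\<And>k. \<exists>N. \<forall>n\<ge>N. E k n" and inf: "\<And>n0 :: nat. \<exists>n\<ge>n0. L n"
  shows "\<exists>s. \<forall>k. E k (s k) \<and> L (s k) \<and> (\<forall>j<k. \<forall>x\<in>P (s k). \<forall>x'\<in>P (s j). real k < D x x')"
proof (rule dependent_wellorder_choice)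
  fix r :: nat and s s' :: "nat \<Rightarrow> nat" and k :: nat
  assume "\<And>j. j < k \<Longrightarrow> s j = s' j"
  then show "(E k r \<and> L r \<and> (\<forall>j<k. \<forall>x\<in>P r. \<forall>x'\<in>P (s j). real k < D x x'))
      = (E k r \<and> L r \<and> (\<forall>j<k. \<forall>x\<in>P r. \<forall>x'\<in>P (s' j). real k < D x x'))"
    by simp
next
  fix k :: nat and s :: "nat \<Rightarrow> nat"
  define G where "G = (\<Union>j<k. \<Union>x'\<in>P (s j). {x \<in> (\<Union>n. P n). D x x' \<le> real k})"
  have "finite G"
    unfolding G_def using fin balls by blast
  then have "finite {n. P n \<inter> G \<noteq> {}}"
  proof (rule finite_surj[where f = "\<lambda>x. THE n. x \<in> P n", OF _ subsetI])
    fix n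
    assume "n \<in> {n. P n \<inter> G \<noteq> {}}"
    then obtain x where x: "x \<in> P n" "x \<in> G"
      by blast
    have "(THE n. x \<in> P n) = n"
    proof (rule the_equality)
      show "m = n" if "x \<in> P m" for m
        using that x(1) disjoint_family_onD[OF disj, of m n] by auto
    qed (rule x(1))
    then show "n \<in> (\<lambda>x. THE n. x \<in> P n) ` G"
      using x(2) by (metis image_eqI)
  qed
  then obtain M where M: "\<forall>n\<in>{n. P n \<inter> G \<noteq> {}}. n < M"
    using finite_nat_set_iff_bounded by blast
  obtain N where N: "\<forall>n\<ge>N. E k n"
    using ev by blast
  obtain n where n: "n \<ge> max M N" "L n"
    using inf by blast
  have "real k < D x x'" if "j < k" "x \<in> P n" "x' \<in> P (s j)" for j x x'
  proof (rule ccontr)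
    assume "\<not> real k < D x x'"
    then have "x \<in> {x \<in> (\<Union>n. P n). D x x' \<le> real k}"
      using that(2) by auto
    then have "x \<in> G"
      unfolding G_def using that(1,3) by blast
    then have "n < M"
      using M that(2) by blast
    then show False
      using n(1) by simp
  qed
  then show "\<exists>n. E k n \<and> L n \<and> (\<forall>j<k. \<forall>x\<in>P n. \<forall>x'\<in>P (s j). real k < D x x')"
    using N n by (intro exI[of _ n]) auto
qed

section \<open>Permanence under uniformly finite-to-one coarse maps\<close>

theorem theorem7p5:
  fixes X :: "'a set" and d :: "'a \<Rightarrow> 'a \<Rightarrow> real"
    and Y :: "'b set" and d' :: "'b \<Rightarrow> 'b \<Rightarrow> real"
    and f :: "'a \<Rightarrow> 'b"
  assumes "Metric_space X d"
    and "Metric_space Y d'"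
    and "uniformly_locally_finite Y d'"
    and "coarse_map X d Y d' f"
    and "uniformly_finite_to_one X Y f"
    and "sparse_only_compact_ghost_projections Y d'"
  shows "sparse_only_compact_ghost_projections X d"
  unfolding sparse_only_compact_ghost_projections_def
proof (intro allI impI, elim conjE)
  fix X' p
  assume sub: "X' \<subseteq> X" and sparse: "sparse_space X' d" and ghost: "ghost X' d p" and p: "projection_op p"
  interpret Y: Metric_space Y d'
    by (rule assms(2))
  interpret X': Metric_space X' d
    by (rule Metric_space.subspace[OF assms(1) sub])
  obtain P where P: "sparse_partition X' d P"
    using sparse unfolding sparse_space_def sparse_partition_def by blast
  interpret sparse_partition X' d P
    by (rule P)
  have f: "f x \<in> Y" if "x \<in> X'" for x
    using assms(4) that sub unfolding coarse_map_def by blast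
  have coarse: "\<exists>R. \<forall>x\<in>X'. \<forall>x'\<in>X'. d x x' \<le> r \<longrightarrow> d' (f x) (f x') \<le> R" if "0 < r" for r
  proof -
    have "bdd_above {d' (f x) (f y) | x y. x \<in> X \<and> y \<in> X \<and> d x y \<le> r}"
      using assms(4) that unfolding coarse_map_def by simp
    then obtain R where R: "\<And>z. z \<in> {d' (f x) (f y) | x y. x \<in> X \<and> y \<in> X \<and> d x y \<le> r} \<Longrightarrow> z \<le> R"
      unfolding bdd_above_def by blast
    have "d' (f x) (f x') \<le> R" if "x \<in> X'" "x' \<in> X'" "d x x' \<le> r" for x x'
      by (rule R) (use that sub in blast)
    then show ?thesis
      by blast
  qed
  obtain N where N: "\<And>y. y \<in> Y \<Longrightarrow> finite {x \<in> X. f x = y} \<and> card {x \<in> X. f x = y} \<le> N"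
    using assms(5) unfolding uniformly_finite_to_one_def by blast
  have fibres: "finite {x \<in> S. f x = y} \<and> card {x \<in> S. f x = y} \<le> N" if "S \<subseteq> X'" for S y
  proof (cases "y \<in> Y")
    case True
    have le: "{x \<in> S. f x = y} \<subseteq> {x \<in> X. f x = y}"
      using that sub by blast
    then show ?thesis
      using N[OF True] finite_subset[OF le] card_mono[OF _ le] by force
  next
    case False
    then have empty: "{x \<in> S. f x = y} = {}"
      using f that by blast
    show ?thesis
      unfolding empty by simp
  qed
  have balls_Y: "finite {y \<in> Y. d' x y \<le> r}" if "x \<in> Y" for x r
  proof -
    have "finite (Y.mcball x (max r 1))"
      using assms(3) that unfolding uniformly_locally_finite_def by (meson less_max_iff_disj zero_less_one)
    moreover have "{y \<in> Y. d' x y \<le> r} \<subseteq> Y.mcball x (max r 1)"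
      using that by auto
    ultimately show ?thesis
      by (rule rev_finite_subset)
  qed
  have p_Roe: "p \<in> stable_Roe X' d"
    using ghost by (simp add: ghost_def)
  show "compact_op p"
  proof (rule ccontr)
    assume "\<not> compact_op p"
    then have "\<not> (\<forall>e>0. \<exists>N. \<forall>n\<ge>N. \<forall>\<xi>. norm (corner (P n) (p \<xi>)) \<le> e * norm \<xi>)"
      using compact_if_rows_tend_to_zero[OF p_Roe] by blast
    then obtain c where c: "0 < c" and large_c: "\<forall>N. \<exists>n\<ge>N. \<exists>\<xi>. \<not> norm (corner (P n) (p \<xi>)) \<le> c * norm \<xi>"
      by blast
    \<comment> \<open>\<open>2\<delta>\<close> bounds the defect of the transported operator, so \<open>2\<delta> \<le> 1/32\<close> makes it correctable to a
      projection at distance at most \<open>20\<delta>\<close>; the rows of \<open>p\<close> over the pieces have size at least \<open>c \<ge> 100\<delta>\<close>,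
      so the correction does not make them vanish\<close>
    define \<delta> where "\<delta> = min c 1 / 100"
    have \<delta>: "0 < \<delta>" "100 * \<delta> \<le> c" "2 * \<delta> \<le> 1 / 32"
      using c by (auto simp: \<delta>_def)
    have large: "\<exists>n\<ge>N. \<exists>\<xi>. 100 * \<delta> * norm \<xi> < norm (corner (P n) (p \<xi>))" for N
      using large_c \<delta>(2) by (meson linorder_not_le mult_right_mono norm_ge_zero order.strict_trans1)
    \<comment> \<open>balls in \<open>Y\<close> and fibres of \<open>f\<close> are finite\<close>
    have balls: "finite {x \<in> (\<Union>n. P n). d' (f x) (f x') \<le> r}" if "x' \<in> P n" for n x' r
    proof -
      have x': "f x' \<in> Y"
        using that union f by blast
      have "{x \<in> (\<Union>n. P n). d' (f x) (f x') \<le> r} \<subseteq> (\<Union>y\<in>{y \<in> Y. d' (f x') y \<le> r}. {x \<in> X'. f x = y})"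
        using union f by (auto simp: Y.commute)
      moreover have "finite (\<Union>y\<in>{y \<in> Y. d' (f x') y \<le> r}. {x \<in> X'. f x = y})"
        using balls_Y[OF x'] fibres[of X'] by blast
      ultimately show ?thesis
        by (rule finite_subset)
    qed
    have "\<exists>s. \<forall>k. (\<forall>\<xi>. norm (corner (P (s k)) (p (corner (- P (s k)) \<xi>)))
          \<le> \<delta> * (1 / 2) ^ k * norm \<xi>)
        \<and> (\<exists>\<xi>. 100 * \<delta> * norm \<xi> < norm (corner (P (s k)) (p \<xi>)))
        \<and> (\<forall>j<k. \<forall>x\<in>P (s k). \<forall>x'\<in>P (s j). real k < d' (f x) (f x'))"
    proof (rule separated_pieces[OF disjoint finite_piece])
      show "\<exists>N. \<forall>n\<ge>N. \<forall>\<xi>. norm (corner (P n) (p (corner (- P n) \<xi>)))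
          \<le> \<delta> * (1 / 2) ^ k * norm \<xi>" for k
        by (rule off_diagonal_small[OF p_Roe]) (use \<delta> in simp)
      show "\<exists>n\<ge>N. \<exists>\<xi>. 100 * \<delta> * norm \<xi> < norm (corner (P n) (p \<xi>))" for N
        by (rule large)
    qed (rule balls)
    then obtain s where s: "\<forall>k. (\<forall>\<xi>. norm (corner (P (s k)) (p (corner (- P (s k)) \<xi>)))
          \<le> \<delta> * (1 / 2) ^ k * norm \<xi>)
        \<and> (\<exists>\<xi>. 100 * \<delta> * norm \<xi> < norm (corner (P (s k)) (p \<xi>)))
        \<and> (\<forall>j<k. \<forall>x\<in>P (s k). \<forall>x'\<in>P (s j). real k < d' (f x) (f x'))" ..
    have s1: "norm (corner (P (s k)) (p (corner (- P (s k)) \<xi>)))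
          \<le> \<delta> * (1 / 2) ^ k * norm \<xi>" for k \<xi>
      by (rule s[THEN spec, THEN conjunct1, THEN spec])
    have s2: "\<exists>\<xi>. 100 * \<delta> * norm \<xi> < norm (corner (P (s k)) (p \<xi>))" for k
      by (rule s[THEN spec, THEN conjunct2, THEN conjunct1])
    have s3: "real k < d' (f x) (f x')" if "j < k" "x \<in> P (s k)" "x' \<in> P (s j)" for j k x x'
      using s[THEN spec, of k] that by blast
    define Q where "Q k = P (s k)" for k
    define S where "S = (\<Union>k. Q k)"
    define Y' where "Y' = f ` S"
    have S: "S \<subseteq> X'"
      using union by (auto simp: S_def Q_def)
    have Y': "Y' \<subseteq> Y"
      using S f by (auto simp: Y'_def)
    interpret Y': Metric_space Y' d'
      by (rule Y.subspace[OF Y'])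
    obtain i :: "'a \<Rightarrow> nat" where i: "\<forall>x\<in>X'. i x < N" "\<forall>x\<in>X'. \<forall>x'\<in>X'. f x = f x' \<longrightarrow> i x = i x' \<longrightarrow> x = x'"
      using fibre_index[of X' f N] fibres[of X'] by auto
    interpret T: transported_projection Q f N "\<lambda>x. shift (i x) :: hilb \<Rightarrow>\<^sub>L hilb" "\<lambda>x. unshift (i x)" p \<delta>
    proof
      fix y
      show "finite {x \<in> (\<Union>k. Q k). f x = y}" "card {x \<in> (\<Union>k. Q k). f x = y} \<le> N"
        using fibres[OF S, of y] by (simp_all add: S_def)
    next
      fix x x' and h :: hilb
      assume "x \<in> (\<Union>k. Q k)" "x' \<in> (\<Union>k. Q k)" "f x = f x'" "x \<noteq> x'"
      then have "i x \<noteq> i x'"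
        using i(2) S unfolding S_def by blast
      then show "unshift (i x) (shift (i x') h) = 0"
        by (rule unshift_shift_other)
    qed (simp_all add: norm_shift norm_unshift shift_adjoint unshift_shift Q_def finite_piece s1 \<delta>(1) p)
    have far_Q: "real (max j k) < d' y y'" if "j \<noteq> k" "y \<in> f ` Q j" "y' \<in> f ` Q k" for j k y y'
    proof (cases "j < k")
      case True
      then show ?thesis
        using s3[of j k] that by (auto simp: Q_def Y.commute)
    next
      case False
      then show ?thesis
        using s3[of k j] that by (auto simp: Q_def)
    qed
    have disj: "disjoint_family (\<lambda>k. f ` Q k)"
      unfolding disjoint_family_on_def
    proof (intro ballI impI, rule ccontr)
      fix j k :: nat
      assume jk: "j \<noteq> k" "f ` Q j \<inter> f ` Q k \<noteq> {}"
      then obtain y where y: "y \<in> f ` Q j" "y \<in> f ` Q k"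
        by blast
      then have "y \<in> Y'"
        by (auto simp: Y'_def S_def)
      then have "d' y y = 0"
        using Y'.mdist_zero by blast
      then show False
        using far_Q[OF jk(1) y] by simp
    qed
    have sparse_Y': "sparse_space Y' d'"
      unfolding sparse_space_def
    proof (intro exI[of _ "\<lambda>k. f ` Q k"] conjI allI)
      show "(\<Union>k. f ` Q k) = Y'"
        by (auto simp: Y'_def S_def)
      show "finite (f ` Q k)" for k
        by (simp add: Q_def finite_piece)
      fix r :: real
      obtain M :: nat where M: "r \<le> real M"
        using real_arch_simple by blast
      have "r \<le> d' y y'" if "m \<noteq> n" "2 * M \<le> m + n" "y \<in> f ` Q m" "y' \<in> f ` Q n" for m n y y'
        using far_Q[OF that(1,3,4)] M that(2) by linarith
      then show "\<exists>N. \<forall>m n. m \<noteq> n \<and> m + n \<ge> N \<longrightarrow> (\<forall>y\<in>f ` Q m. \<forall>y'\<in>f ` Q n. r \<le> d' y y')"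
        by blast
    qed (rule disj)
    have fin_i: "finite (i ` S)"
      by (rule finite_subset[of _ "{..<N}"]) (use i(1) S in auto)
    have coarse_S: "\<exists>R. \<forall>x\<in>S. \<forall>x'\<in>S. d x x' \<le> r \<longrightarrow> d' (f x) (f x') \<le> R" if "0 < r" for r
      using coarse[OF that] S by (meson subsetD)
    have b_Roe: "T.b \<in> stable_Roe Y' d'"
      unfolding T.b_def Y'_def S_def
      by (rule transport_stable_Roe[OF T.fibre_maps_axioms S[unfolded S_def] fin_i[unfolded S_def]
            coarse_S[unfolded S_def] p_Roe])
    have "\<exists>q. projection_op q \<and> q \<in> stable_Roe Y' d' \<and> q - T.b \<in> tail_small Y' \<and> norm (q - T.b) \<le> 10 * (2 * \<delta>)"
    proof (rule projection_near_almost_projection)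
      show "closed (stable_Roe Y' d')"
        by (simp add: stable_Roe_def)
      show "a o\<^sub>L b \<in> stable_Roe Y' d'" if "a \<in> stable_Roe Y' d'" "b \<in> stable_Roe Y' d'" for a b
      proof (rule stable_Roe_compose[OF Y'.Metric_space_axioms _ that])
        show "finite {y \<in> Y'. d' x y \<le> r}" if "x \<in> Y'" for x r
          by (rule finite_subset[OF _ balls_Y[of x r]]) (use that Y' in auto)
      qed
      show "defect T.b \<in> tail_small Y'"
        using T.defect_b_tail_small by (simp add: Y'_def S_def)
    qed (use T.b_symmetric T.norm_b T.norm_defect_b \<delta>(3) b_Roe in
        \<open>auto intro: stable_Roe_add stable_Roe_scaleR tail_small_add tail_small_scaleR tail_small_compose closed_tail_small\<close>)
    then obtain q where q: "projection_op q" "q \<in> stable_Roe Y' d'" "q - T.b \<in> tail_small Y'"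
      "norm (q - T.b) \<le> 20 * \<delta>"
      by auto
    have "ghost Y' d' q"
    proof (rule ghost_if_tail_small_perturbation[OF Y'.Metric_space_axioms q(2,3)])
      fix e :: real
      assume e: "0 < e"
      \<comment> \<open>an entry of \<open>T.b\<close> is a sum of at most \<open>N\<^sup>2\<close> terms, each bounded by an entry of \<open>p\<close>; adding \<open>1\<close> makes the bound strict\<close>
      define e' where "e' = e / (real N * real N + 1)"
      have pos: "0 < real N * real N + 1"
        by (simp add: add_nonneg_pos)
      have e': "0 < e'" "N * (N * e') < e"
        using e pos by (simp_all add: e'_def field_simps)
      obtain A where A: "X'.mbounded A" "\<And>x x'. x \<in> X' - A \<Longrightarrow> x' \<in> X' - A \<Longrightarrow> norm (entry p x x') < e'"
        using ghost e'(1) unfolding ghost_def by (meson DiffI)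
      have bounded: "Y'.mbounded (f ` (A \<inter> S))"
      proof -
        obtain r where r: "0 < r" "\<And>x x'. x \<in> A \<Longrightarrow> x' \<in> A \<Longrightarrow> d x x' \<le> r"
          using A(1) unfolding X'.mbounded_alt_pos by blast
        obtain R where "\<And>x x'. x \<in> X' \<Longrightarrow> x' \<in> X' \<Longrightarrow> d x x' \<le> r \<Longrightarrow> d' (f x) (f x') \<le> R"
          using coarse[OF r(1)] by blast
        then have "d' (f x) (f x') \<le> R" if "x \<in> A \<inter> S" "x' \<in> A \<inter> S" for x x'
          using r(2) that S by blast
        then show ?thesis
          unfolding Y'.mbounded_alt by (auto simp: Y'_def intro!: exI[of _ R])
      qed
      have "norm (entry T.b y y') < e" if "y \<in> Y' - f ` (A \<inter> S)" "y' \<in> Y' - f ` (A \<inter> S)" for y y'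
      proof -
        have "norm (entry T.b y y') \<le> N * (N * e')"
          unfolding T.b_def
        proof (rule norm_entry_transport[OF T.fibre_maps_axioms])
          fix x x'
          assume "x \<in> (\<Union>k. Q k)" "f x = y" "x' \<in> (\<Union>k. Q k)" "f x' = y'"
          then have "x \<in> S" "f x = y" "x' \<in> S" "f x' = y'"
            by (simp_all only: S_def)
          then have "x \<in> X' - A" "x' \<in> X' - A"
            using that S by blast+
          then show "norm (entry p x x') \<le> e'"
            using A(2) by (simp add: less_imp_le)
        qed (use e' in simp)
        then show ?thesis
          using e'(2) by simp
      qed
      then show "\<exists>A. Y'.mbounded A \<and> (\<forall>y\<in>Y' - A. \<forall>y'\<in>Y' - A. norm (entry T.b y y') < e)"
        using bounded by (intro exI[of _ "f ` (A \<inter> S)"]) simp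
    qed
    then have "compact_op q"
      using assms(6) Y' sparse_Y' q(1) unfolding sparse_only_compact_ghost_projections_def by blast
    moreover have "\<not> compact_op q"
      by (rule T.not_compact_near_b[OF q(1,4) _ disj]) (simp add: Q_def s2)
    ultimately show False
      by blast
  qed
qed

end
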